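(* For any nonzero finite-dimensional complex solvable Lie algebra $\mathfrak{s}$ and any $j\geq0$, \[ b_j(\mathfrak{s})\leq\binom{\kappa(\mathfrak{s})-1}{j}. \]
   Context: For a basis $x_1,\dots,x_N$ of $\mathfrak{s}$, the characteristic polynomial is $Q_{\mathfrak{s}}(z_0,\mathbf{z})=\det(z_0I+\sum_{i=1}^N z_i\operatorname{ad}x_i)$; for solvable $\mathfrak{s}$ it is a product of linear forms. The spectral index $\kappa(\mathfrak{s})$ is the number of distinct irreducible factors of $Q_{\mathfrak{s}}$. The variable $z_0$ divides $Q_{\mathfrak{s}}$; write $Q_{\mathfrak{s}}=z_0^a p_{\mathfrak{s}}$ with $z_0\nmid p_{\mathfrak{s}}$. The eigenvariety complement is $V_{\mathfrak{s}}^c=\{(z_0,\mathbf{z})\in\mathbb{C}^{N+1}:p_{\mathfrak{s}}(z_0,\mathbf{z})\ne0\}$, and $b_j(\mathfrak{s})=\dim_{\mathbb{C}}H^j(V_{\mathfrak{s}}^c,\mathbb{C})$ (de Rham cohomology with complex coefficients). *)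

theory Defs
  imports
    "HOL-Analysis.Analysis"
    "HOL-Library.Poly_Mapping"
    "HOL-Library.Function_Algebras"
    "HOL-Library.Extended_Nat"
begin

section \<open>De Rham cohomology of open sets, with complex coefficients\<close>

primrec times_cont_diff_on ::
    "nat \<Rightarrow> 'a::real_normed_vector set \<Rightarrow> ('a \<Rightarrow> 'b::real_normed_vector) \<Rightarrow> bool" where
  "times_cont_diff_on 0 U f \<longleftrightarrow> continuous_on U f"
| "times_cont_diff_on (Suc n) U f \<longleftrightarrow>
     (\<forall>x\<in>U. f differentiable (at x)) \<and>
     (\<forall>v. times_cont_diff_on n U (\<lambda>x. frechet_derivative f (at x) v))"

text \<open>
  Meant for open \<open>U\<close> in a finite-dimensional space, where the existence and continuity of all
  iterated directional derivatives is the same as being of class \<open>C\<^sup>\<infinity>\<close>.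
\<close>
definition smooth_on :: "'a::real_normed_vector set \<Rightarrow> ('a \<Rightarrow> 'b::real_normed_vector) \<Rightarrow> bool" where
  "smooth_on U f \<longleftrightarrow> (\<forall>n. times_cont_diff_on n U f)"

text \<open>
  A form of degree \<open>k\<close> assigns to a point a function of the list of its \<open>k\<close> argument vectors.
  Multilinearity is over the reals: these are complex-valued forms on the underlying real manifold.
  Values at points outside \<open>U\<close> and on lists of the wrong length are junk and are normalised to 0,
  so that equality of forms on \<open>U\<close> is equality of functions.
\<close>
type_synonym 'a form = "'a \<Rightarrow> 'a list \<Rightarrow> complex"

definition smooth_forms :: "nat \<Rightarrow> 'a::euclidean_space set \<Rightarrow> 'a form set" where
  "smooth_forms k U = {\<omega>.
     (\<forall>x vs. x \<notin> U \<or> length vs \<noteq> k \<longrightarrow> \<omega> x vs = 0) \<and>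
     (\<forall>x\<in>U. \<forall>vs. length vs = k \<longrightarrow> (\<forall>i<k. linear (\<lambda>w. \<omega> x (vs[i := w])))) \<and>
     (\<forall>x\<in>U. \<forall>vs. length vs = k \<longrightarrow> \<not> distinct vs \<longrightarrow> \<omega> x vs = 0) \<and>
     (\<forall>vs. length vs = k \<longrightarrow> smooth_on U (\<lambda>x. \<omega> x vs))}"

text \<open>
  \<open>(d\<omega>)\<^sub>x(v\<^sub>0,\<dots>,v\<^sub>k) = \<Sum>\<^sub>i (-1)\<^sup>i D\<^bsub>v\<^sub>i\<^esub>(y \<mapsto> \<omega>\<^sub>y(v\<^sub>0,\<dots>,v\<^sub>i omitted,\<dots>,v\<^sub>k))(x)\<close> for constant vectors \<open>v\<^sub>i\<close>.
\<close>
definition ext_deriv :: "'a::euclidean_space set \<Rightarrow> 'a form \<Rightarrow> 'a form" where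
  "ext_deriv U \<omega> = (\<lambda>x vs. if x \<in> U
     then (\<Sum>i<length vs. (-1) ^ i *
            frechet_derivative (\<lambda>y. \<omega> y (take i vs @ drop (Suc i) vs)) (at x) (vs ! i))
     else 0)"

definition closed_forms :: "nat \<Rightarrow> 'a::euclidean_space set \<Rightarrow> 'a form set" where
  "closed_forms k U = {\<omega> \<in> smooth_forms k U. ext_deriv U \<omega> = 0}"

definition exact_forms :: "nat \<Rightarrow> 'a::euclidean_space set \<Rightarrow> 'a form set" where
  "exact_forms k U = (case k of 0 \<Rightarrow> {0} | Suc l \<Rightarrow> ext_deriv U ` smooth_forms l U)"

text \<open>
  The residue classes modulo the subspace \<open>W\<close> of the elements of the finite set \<open>S\<close> are pairwise
  distinct and form a basis of the quotient space \<open>V / W\<close>.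
\<close>
definition quotient_basis ::
    "('k::field \<Rightarrow> 'v::ab_group_add \<Rightarrow> 'v) \<Rightarrow> 'v set \<Rightarrow> 'v set \<Rightarrow> 'v set \<Rightarrow> bool" where
  "quotient_basis smul V W S \<longleftrightarrow> finite S \<and> S \<subseteq> V \<and>
     (\<forall>c. (\<Sum>s\<in>S. smul (c s) s) \<in> W \<longrightarrow> (\<forall>s\<in>S. c s = 0)) \<and>
     (\<forall>v\<in>V. \<exists>c. v - (\<Sum>s\<in>S. smul (c s) s) \<in> W)"

definition quotient_dim ::
    "('k::field \<Rightarrow> 'v::ab_group_add \<Rightarrow> 'v) \<Rightarrow> 'v set \<Rightarrow> 'v set \<Rightarrow> enat" where
  "quotient_dim smul V W =
     (if \<exists>S. quotient_basis smul V W S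
      then enat (card (SOME S. quotient_basis smul V W S)) else \<infinity>)"

definition scale_form :: "complex \<Rightarrow> 'a form \<Rightarrow> 'a form" where
  "scale_form c \<omega> = (\<lambda>x vs. c * \<omega> x vs)"

definition de_rham_betti :: "nat \<Rightarrow> 'a::euclidean_space set \<Rightarrow> enat" where
  "de_rham_betti j U = quotient_dim scale_form (closed_forms j U) (exact_forms j U)"


section \<open>Polynomials in \<open>z\<^sub>0\<close> and \<open>z\<^sub>1, \<dots>, z\<^sub>N\<close>\<close>

text \<open>
  The variables are indexed by \<^typ>\<open>'n option\<close>: \<^term>\<open>None\<close> stands for the distinguished
  variable \<open>z\<^sub>0\<close> and \<^term>\<open>Some i\<close> for \<open>z\<^sub>i\<close>. A polynomial is a finitely supported function on
  monomials, and a monomial is a finitely supported function giving the exponents.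
\<close>
type_synonym 'n polynomial = "('n option \<Rightarrow>\<^sub>0 nat) \<Rightarrow>\<^sub>0 complex"

definition const_poly :: "complex \<Rightarrow> 'n polynomial" where
  "const_poly c = Poly_Mapping.single 0 c"

definition var_poly :: "'n option \<Rightarrow> 'n polynomial" where
  "var_poly i = Poly_Mapping.single (Poly_Mapping.single i 1) 1"

definition eval_poly :: "'n::finite polynomial \<Rightarrow> complex ^ 'n option \<Rightarrow> complex" where
  "eval_poly p z = (\<Sum>m\<in>Poly_Mapping.keys p. Poly_Mapping.lookup p m * (\<Prod>i\<in>UNIV. (z $ i) ^ Poly_Mapping.lookup m i))"

text \<open>Distinct irreducible factors are counted up to associates.\<close>
definition num_irreducible_factors :: "'n polynomial \<Rightarrow> nat" where
  "num_irreducible_factors q =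
     card ({f. irreducible f \<and> f dvd q} // {(f, g). f dvd g \<and> g dvd f})"

text \<open>For \<open>q \<noteq> 0\<close>, the polynomial \<open>p\<close> with \<open>q = z\<^sub>0\<^sup>a p\<close> and \<open>z\<^sub>0\<close> not dividing \<open>p\<close>.\<close>
definition z0_free_part :: "'n polynomial \<Rightarrow> 'n polynomial" where
  "z0_free_part q = (THE p. (\<exists>a. q = var_poly None ^ a * p) \<and> \<not> var_poly None dvd p)"


section \<open>Complex Lie algebras\<close>

locale complex_lie_algebra = vector_space smul
  for smul :: "complex \<Rightarrow> 'a::ab_group_add \<Rightarrow> 'a" +
  fixes bracket :: "'a \<Rightarrow> 'a \<Rightarrow> 'a"
  assumes linear_bracket_right: "Vector_Spaces.linear smul smul (\<lambda>y. bracket x y)"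
    and linear_bracket_left: "Vector_Spaces.linear smul smul (\<lambda>x. bracket x y)"
    and bracket_self: "bracket x x = 0"
    and jacobi: "bracket x (bracket y z) + bracket y (bracket z x) + bracket z (bracket x y) = 0"
begin

primrec derived_series :: "nat \<Rightarrow> 'a set" where
  "derived_series 0 = UNIV"
| "derived_series (Suc n) = span {bracket x y | x y. x \<in> derived_series n \<and> y \<in> derived_series n}"

definition solvable :: bool where
  "solvable \<longleftrightarrow> (\<exists>n. derived_series n = {0})"

text \<open>
  A basis is indexed by a finite type. Since types are nonempty, the Lie algebras having such a
  basis are exactly the nonzero finite-dimensional ones, with \<open>N = CARD('n)\<close>.
\<close>
definition indexed_basis :: "('n::finite \<Rightarrow> 'a) \<Rightarrow> bool" where
  "indexed_basis e \<longleftrightarrow> inj e \<and> independent (range e) \<and> span (range e) = UNIV"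

text \<open>The matrix of \<open>ad x\<close>: column \<open>l\<close> holds the coordinates of \<open>[x, e\<^sub>l]\<close>.\<close>
definition ad_matrix :: "('n::finite \<Rightarrow> 'a) \<Rightarrow> 'a \<Rightarrow> complex ^ 'n ^ 'n" where
  "ad_matrix e x = (\<chi> k l. representation (range e) (bracket x (e l)) (e k))"

definition char_poly :: "('n::finite \<Rightarrow> 'a) \<Rightarrow> 'n polynomial" where
  "char_poly e = det (mat (var_poly None) +
     (\<Sum>i\<in>UNIV. \<chi> k l. var_poly (Some i) * const_poly (ad_matrix e (e i) $ k $ l)))"

definition spectral_index :: "('n::finite \<Rightarrow> 'a) \<Rightarrow> nat" where
  "spectral_index e = num_irreducible_factors (char_poly e)"

definition eigenvariety_complement :: "('n::finite \<Rightarrow> 'a) \<Rightarrow> (complex ^ 'n option) set" where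
  "eigenvariety_complement e = {z. eval_poly (z0_free_part (char_poly e)) z \<noteq> 0}"

definition betti :: "nat \<Rightarrow> ('n::finite \<Rightarrow> 'a) \<Rightarrow> enat" where
  "betti j e = de_rham_betti j (eigenvariety_complement e)"

end

end

theory Submission
  imports Defs "HOL-Computational_Algebra.Fundamental_Theorem_Algebra"
begin

text \<open>
  By Lie's theorem the operators \<open>ad x\<close> are simultaneously triangular, so \<open>Q\<close> is a product of linear
  forms \<open>z\<^sub>0 + \<lambda>\<^sub>k(z)\<close>; since \<open>[x, x] = 0\<close>, it vanishes for \<open>z\<^sub>0 = 0\<close>, so some \<open>\<lambda>\<^sub>k\<close> is \<open>0\<close>. Hence the
  eigenvariety complement is the complement of \<open>\<kappa> - 1\<close> hyperplanes through the origin, and the bound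
  is the one for an arbitrary arrangement of \<open>m\<close> hyperplanes, \<open>b\<^sub>j \<le> (m choose j)\<close>. The latter follows
  by induction on \<open>m\<close> from \<open>b\<^sub>j(M) \<le> b\<^sub>j(M') + b\<^bsub>j-1\<^esub>(M'')\<close> for the deletion \<open>M'\<close> and the restriction
  \<open>M''\<close>. To see this inequality, add a disc bundle \<open>T\<close> around \<open>M''\<close> to \<open>M\<close>. Cover the punctured disc
  bundle by two bundles of slit discs, whose intersection is a disjoint union of two bundles of half
  discs. All these pieces are homotopy equivalent to \<open>M''\<close>, so two applications of Mayer-Vietoris
  suffice, and no residues or products of forms are needed.
\<close>

section \<open>Smooth functions\<close>

text \<open>Upper bounds pass through the induction as generation statements:
  \<open>betti_le\<close> asks that r classes generate, so finiteness never has to be known in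
  advance, and Mayer-Vietoris appears as diagram chases with forms instead of an exact sequence of
  dimensions. Linear algebra turns generators into a dimension only at the end. The obstacle to a
  direct chase is that a bundle of punctured discs is not equivalent to its base; slit discs and
  half discs are, because their fibres are star-shaped and the disc bundle T deforms into each of
  them. Restriction from T to each piece is therefore bijective in cohomology, and all classes can
  be compared on T itself. Of the two classes on the half discs, one is absorbed by a class from T,
  which is why the restriction contributes its Betti number once, one degree higher. All covers are
  described by the signs of explicit smooth functions, which yield the cut-offs. On the algebraic
  side, divisibility by a linear form is decided by values on its hyperplane.\<close>

lemma has_derivative_cong_open:
  assumes "open U" "x \<in> U" "\<And>y. y \<in> U \<Longrightarrow> f y = g y"
  shows "(f has_derivative F) (at x) \<longleftrightarrow> (g has_derivative F) (at x)"
  using assms by (metis has_derivative_transform_within_open)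

lemma frechet_derivative_cong_open:
  assumes "open U" "x \<in> U" "\<And>y. y \<in> U \<Longrightarrow> f y = g y"
  shows "frechet_derivative f (at x) = frechet_derivative g (at x)"
  unfolding frechet_derivative_def using has_derivative_cong_open[OF assms] by simp

lemma differentiable_cong_open:
  assumes "open U" "x \<in> U" "\<And>y. y \<in> U \<Longrightarrow> f y = g y"
  shows "f differentiable (at x) \<longleftrightarrow> g differentiable (at x)"
  unfolding differentiable_def using has_derivative_cong_open[OF assms] by simp

section \<open>Closure properties of iterated differentiability\<close>

lemma times_cont_diff_on_cong:
  assumes U: "open U" and eq: "\<And>x. x \<in> U \<Longrightarrow> f x = g x"
  shows "times_cont_diff_on n U f \<longleftrightarrow> times_cont_diff_on n U g"
  using eq
proof (induction n arbitrary: f g)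
  case 0
  then show ?case by (simp cong: continuous_on_cong)
next
  case (Suc n)
  have "times_cont_diff_on n U (\<lambda>x. frechet_derivative f (at x) v) \<longleftrightarrow>
        times_cont_diff_on n U (\<lambda>x. frechet_derivative g (at x) v)" for v
    by (rule Suc.IH) (metis frechet_derivative_cong_open U Suc.prems)
  moreover have "f differentiable (at x) \<longleftrightarrow> g differentiable (at x)" if "x \<in> U" for x
    by (rule differentiable_cong_open[OF U that Suc.prems])
  ultimately show ?case by simp
qed

text \<open>Common shape of the closure proofs that follow: exhibit a derivative whose value in
  every fixed direction is again built by the operation in question, then appeal to the order below.
  Openness of U lets the derivative be replaced by any formula valid on U.\<close>

lemma times_cont_diff_on_SucI:
  assumes U: "open U" and d: "\<And>x. x \<in> U \<Longrightarrow> (f has_derivative f' x) (at x)"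
    and t: "\<And>v. times_cont_diff_on n U (\<lambda>x. f' x v)"
  shows "times_cont_diff_on (Suc n) U f"
proof -
  have "frechet_derivative f (at x) = f' x" if "x \<in> U" for x
    using d[OF that] frechet_derivative_at by metis
  then have "times_cont_diff_on n U (\<lambda>x. frechet_derivative f (at x) v)" for v
    using t[of v] times_cont_diff_on_cong[OF U, of "\<lambda>x. frechet_derivative f (at x) v" "\<lambda>x. f' x v"] by simp
  then show ?thesis using d by (auto simp: differentiable_def)
qed

lemma times_cont_diff_on_SucD:
  assumes "times_cont_diff_on (Suc n) U f" "x \<in> U"
  shows "(f has_derivative frechet_derivative f (at x)) (at x)"
  using assms by (simp add: frechet_derivative_works)

lemma times_cont_diff_on_Suc_imp: "times_cont_diff_on (Suc n) U f \<Longrightarrow> times_cont_diff_on n U f"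
proof (induction n arbitrary: f)
  case 0
  then have "\<forall>x\<in>U. f differentiable at x" by simp
  then show ?case
    by (auto intro!: continuous_at_imp_continuous_on differentiable_imp_continuous_within)
next
  case (Suc n)
  then show ?case by (metis times_cont_diff_on.simps(2))
qed

lemma times_cont_diff_on_const: "times_cont_diff_on n U (\<lambda>x. c)"
  by (induction n arbitrary: c) auto

lemma times_cont_diff_on_add:
  assumes U: "open U" and "times_cont_diff_on n U f" "times_cont_diff_on n U g"
  shows "times_cont_diff_on n U (\<lambda>x. f x + g x)"
  using assms(2,3)
proof (induction n arbitrary: f g)
  case 0
  then show ?case by (auto intro: continuous_intros)
next
  case (Suc n)
  show ?case
    by (rule times_cont_diff_on_SucI[OF U has_derivative_add[OF times_cont_diff_on_SucD[OF Suc.prems(1)] times_cont_diff_on_SucD[OF Suc.prems(2)]]])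
       (use Suc in auto)
qed

lemma times_cont_diff_on_sum:
  assumes U: "open U" and "\<And>i. i \<in> I \<Longrightarrow> times_cont_diff_on n U (f i)"
  shows "times_cont_diff_on n U (\<lambda>x. \<Sum>i\<in>I. f i x)"
  using assms(2)
proof (induction I rule: infinite_finite_induct)
  case (insert i I)
  then show ?case by (simp add: times_cont_diff_on_add[OF U])
qed (auto simp: times_cont_diff_on_const)

lemma (in bounded_linear) times_cont_diff_on_linear:
  assumes U: "open U" and "times_cont_diff_on n U g"
  shows "times_cont_diff_on n U (\<lambda>x. f (g x))"
  using assms(2)
proof (induction n arbitrary: g)
  case 0
  then show ?case by (auto intro: continuous_on)
next
  case (Suc n)
  show ?case
    by (rule times_cont_diff_on_SucI[OF U has_derivative[OF times_cont_diff_on_SucD[OF Suc.prems(1)]]]) (use Suc in auto)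
qed

lemma (in bounded_bilinear) times_cont_diff_on_bilinear:
  assumes U: "open U" and "times_cont_diff_on n U f" "times_cont_diff_on n U g"
  shows "times_cont_diff_on n U (\<lambda>x. prod (f x) (g x))"
  using assms(2,3)
proof (induction n arbitrary: f g)
  case 0
  then show ?case by (auto intro: continuous_on)
next
  case (Suc n)
  show ?case
    by (rule times_cont_diff_on_SucI[OF U FDERIV[OF times_cont_diff_on_SucD[OF Suc.prems(1)] times_cont_diff_on_SucD[OF Suc.prems(2)]]])
       (auto intro!: times_cont_diff_on_add[OF U] Suc.IH times_cont_diff_on_Suc_imp[OF Suc.prems(1)] times_cont_diff_on_Suc_imp[OF Suc.prems(2)]
          simp: Suc.prems[unfolded times_cont_diff_on.simps(2)])
qed

lemma times_cont_diff_on_id: "times_cont_diff_on n U (\<lambda>x. x)"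
  by (cases n) (auto simp: times_cont_diff_on_const)

lemma linear_eq_sum_Basis:
  fixes f :: "'a::euclidean_space \<Rightarrow> 'b::real_vector"
  assumes "linear f"
  shows "f w = (\<Sum>b\<in>Basis. (w \<bullet> b) *\<^sub>R f b)"
proof -
  have "f w = f (\<Sum>b\<in>Basis. (w \<bullet> b) *\<^sub>R b)" by (simp add: euclidean_representation)
  also have "\<dots> = (\<Sum>b\<in>Basis. (w \<bullet> b) *\<^sub>R f b)"
    by (simp only: linear_sum[OF assms] linear_scale[OF assms])
  finally show ?thesis .
qed

text \<open>By the chain rule the derivative is f' at g x applied to a direction that moves with x,
  and this is not a composition with g. Expanding that direction in \<open>Basis\<close> leaves sums
  of products of derivatives of g with derivatives of f in fixed directions, to which the induction
  hypothesis applies.\<close>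

lemma times_cont_diff_on_compose:
  fixes f :: "'c::euclidean_space \<Rightarrow> 'b::real_normed_vector"
  assumes U: "open U" and W: "open W" and gW: "\<And>x. x \<in> U \<Longrightarrow> g x \<in> W"
    and "times_cont_diff_on n W f" and g: "times_cont_diff_on n U g"
  shows "times_cont_diff_on n U (\<lambda>x. f (g x))"
  using assms(4,5)
proof (induction n arbitrary: f)
  case 0
  then show ?case using gW by (auto intro: continuous_on_compose2)
next
  case (Suc n)
  let ?D = "\<lambda>x v. \<Sum>b\<in>Basis. (frechet_derivative g (at x) v \<bullet> b) *\<^sub>R frechet_derivative f (at (g x)) b"
  show ?case
  proof (rule times_cont_diff_on_SucI[OF U, where f' = ?D])
    fix x assume x: "x \<in> U"
    have f: "(f has_derivative frechet_derivative f (at (g x))) (at (g x))"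
      using times_cont_diff_on_SucD[OF Suc.prems(1)] gW x by blast
    have "frechet_derivative f (at (g x)) w = (\<Sum>b\<in>Basis. (w \<bullet> b) *\<^sub>R frechet_derivative f (at (g x)) b)" for w
      by (rule linear_eq_sum_Basis[OF has_derivative_linear[OF f]])
    then have "frechet_derivative f (at (g x)) (frechet_derivative g (at x) v) = ?D x v" for v
      by blast
    moreover have "((\<lambda>x. f (g x)) has_derivative
        (\<lambda>v. frechet_derivative f (at (g x)) (frechet_derivative g (at x) v))) (at x)"
      using has_derivative_compose[OF times_cont_diff_on_SucD[OF Suc.prems(2) x] f] .
    ultimately show "((\<lambda>x. f (g x)) has_derivative ?D x) (at x)" by simp
  next
    fix v
    have "times_cont_diff_on n U (\<lambda>x. frechet_derivative f (at (g x)) b)" for b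
      using Suc.IH[of "\<lambda>y. frechet_derivative f (at y) b"] Suc.prems times_cont_diff_on_Suc_imp by auto
    moreover have "times_cont_diff_on n U (\<lambda>x. frechet_derivative g (at x) v \<bullet> b)" for b
      using Suc.prems(2) by (auto intro!: bounded_linear.times_cont_diff_on_linear[OF bounded_linear_inner_left U])
    ultimately show "times_cont_diff_on n U (\<lambda>x. ?D x v)"
      by (intro times_cont_diff_on_sum[OF U] bounded_bilinear.times_cont_diff_on_bilinear[OF bounded_bilinear_scaleR U])
  qed
qed

lemma smooth_on_cong:
  "open U \<Longrightarrow> (\<And>x. x \<in> U \<Longrightarrow> f x = g x) \<Longrightarrow> smooth_on U f \<longleftrightarrow> smooth_on U g"
  unfolding smooth_on_def by (simp add: times_cont_diff_on_cong[of U f g])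

lemma smooth_on_has_derivative:
  "smooth_on U f \<Longrightarrow> x \<in> U \<Longrightarrow> (f has_derivative frechet_derivative f (at x)) (at x)"
  unfolding smooth_on_def using times_cont_diff_on_SucD by blast

lemma smooth_on_frechet: "smooth_on U f \<Longrightarrow> smooth_on U (\<lambda>x. frechet_derivative f (at x) v)"
  unfolding smooth_on_def by (metis times_cont_diff_on.simps(2))

lemma smooth_on_continuous: "smooth_on U f \<Longrightarrow> continuous_on U f"
  unfolding smooth_on_def by (metis times_cont_diff_on.simps(1))

lemma smooth_on_subset: "smooth_on U f \<Longrightarrow> V \<subseteq> U \<Longrightarrow> smooth_on V f"
proof -
  have "times_cont_diff_on n U f \<Longrightarrow> V \<subseteq> U \<Longrightarrow> times_cont_diff_on n V f" for n
    by (induction n arbitrary: f) (auto intro: continuous_on_subset)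
  then show "smooth_on U f \<Longrightarrow> V \<subseteq> U \<Longrightarrow> smooth_on V f" unfolding smooth_on_def by blast
qed

lemma smooth_on_Un:
  assumes "open A" "open B" "smooth_on A f" "smooth_on B f"
  shows "smooth_on (A \<union> B) f"
proof -
  have "times_cont_diff_on n A f \<Longrightarrow> times_cont_diff_on n B f \<Longrightarrow> times_cont_diff_on n (A \<union> B) f" for n
    by (induction n arbitrary: f) (auto intro: continuous_on_open_Un assms)
  then show ?thesis using assms unfolding smooth_on_def by blast
qed

named_theorems smooth_intros

lemma smooth_on_const [smooth_intros]: "smooth_on U (\<lambda>x. c)"
  unfolding smooth_on_def by (simp add: times_cont_diff_on_const)

lemma smooth_on_id [smooth_intros]: "smooth_on U (\<lambda>x. x)"
  unfolding smooth_on_def by (simp add: times_cont_diff_on_id)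

lemma smooth_on_add [smooth_intros]:
  "open U \<Longrightarrow> smooth_on U f \<Longrightarrow> smooth_on U g \<Longrightarrow> smooth_on U (\<lambda>x. f x + g x)"
  unfolding smooth_on_def by (simp add: times_cont_diff_on_add)

lemma smooth_on_sum [smooth_intros]:
  "open U \<Longrightarrow> (\<And>i. i \<in> I \<Longrightarrow> smooth_on U (f i)) \<Longrightarrow> smooth_on U (\<lambda>x. \<Sum>i\<in>I. f i x)"
  unfolding smooth_on_def by (simp add: times_cont_diff_on_sum)

lemma smooth_on_linear:
  "bounded_linear L \<Longrightarrow> open U \<Longrightarrow> smooth_on U g \<Longrightarrow> smooth_on U (\<lambda>x. L (g x))"
  unfolding smooth_on_def by (simp add: bounded_linear.times_cont_diff_on_linear)

lemma smooth_on_bilinear: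
  "bounded_bilinear B \<Longrightarrow> open U \<Longrightarrow> smooth_on U f \<Longrightarrow> smooth_on U g \<Longrightarrow> smooth_on U (\<lambda>x. B (f x) (g x))"
  unfolding smooth_on_def by (simp add: bounded_bilinear.times_cont_diff_on_bilinear)

lemmas smooth_on_scaleR [smooth_intros] = smooth_on_bilinear[OF bounded_bilinear_scaleR]
lemmas smooth_on_mult [smooth_intros] = smooth_on_bilinear[OF bounded_bilinear_mult]
lemmas smooth_on_inner_left = smooth_on_linear[OF bounded_linear_inner_left]
lemmas smooth_on_minus [smooth_intros] = smooth_on_linear[OF bounded_linear_minus[OF bounded_linear_ident]]
lemmas smooth_on_Re [smooth_intros] = smooth_on_linear[OF bounded_linear_Re]
lemmas smooth_on_Im [smooth_intros] = smooth_on_linear[OF bounded_linear_Im]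
lemmas smooth_on_of_real [smooth_intros] = smooth_on_linear[OF bounded_linear_of_real]
lemmas smooth_on_fst [smooth_intros] = smooth_on_linear[OF bounded_linear_fst]
lemmas smooth_on_snd [smooth_intros] = smooth_on_linear[OF bounded_linear_snd]

lemma smooth_on_diff [smooth_intros]:
  "open U \<Longrightarrow> smooth_on U f \<Longrightarrow> smooth_on U g \<Longrightarrow> smooth_on U (\<lambda>x. f x - g x)"
  using smooth_on_add[of U f "\<lambda>x. - g x"] smooth_on_minus[of U g] by simp

lemma smooth_on_power [smooth_intros]:
  fixes f :: "'a::real_normed_vector \<Rightarrow> 'b::real_normed_algebra_1"
  shows "open U \<Longrightarrow> smooth_on U f \<Longrightarrow> smooth_on U (\<lambda>x. f x ^ n)"
  by (induction n) (auto intro: smooth_intros)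

lemma smooth_on_compose:
  fixes f :: "'c::euclidean_space \<Rightarrow> 'b::real_normed_vector"
  shows "open U \<Longrightarrow> open W \<Longrightarrow> (\<And>x. x \<in> U \<Longrightarrow> g x \<in> W) \<Longrightarrow> smooth_on W f \<Longrightarrow> smooth_on U g \<Longrightarrow>
    smooth_on U (\<lambda>x. f (g x))"
  unfolding smooth_on_def by (simp add: times_cont_diff_on_compose)

lemma smooth_on_Pair [smooth_intros]:
  assumes "open U" "smooth_on U f" "smooth_on U g"
  shows "smooth_on U (\<lambda>x. (f x, g x))"
proof -
  have "smooth_on U (\<lambda>x. (f x, 0) + (0, g x))"
    by (intro smooth_on_add smooth_on_linear[where L = "\<lambda>x. (x, 0)"] smooth_on_linear[where L = "\<lambda>x. (0, x)"] assms)
       (auto intro: bounded_linear_intros bounded_linear_Pair)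
  then show ?thesis by simp
qed

text \<open>The derivative is a polynomial in the function itself, so every order reduces to the
  previous one by the product rule.\<close>

lemma smooth_on_inverse_real: "smooth_on {x::real. x \<noteq> 0} inverse"
proof -
  have o: "open {x::real. x \<noteq> 0}" by (simp add: open_Collect_neq)
  have "times_cont_diff_on n {x::real. x \<noteq> 0} inverse" for n
  proof (induction n)
    case 0
    then show ?case by (auto intro!: continuous_intros)
  next
    case (Suc n)
    show ?case
    proof (rule times_cont_diff_on_SucI[OF o])
      show "(inverse has_derivative (\<lambda>h. - (inverse x * h * inverse x))) (at x)"
        if "x \<in> {x. x \<noteq> 0}" for x :: real
        using that by (auto intro: has_derivative_inverse')
      show "times_cont_diff_on n {x. x \<noteq> 0} (\<lambda>x. - (inverse x * v * inverse x))" for v :: real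
        by (intro bounded_linear.times_cont_diff_on_linear[OF bounded_linear_minus[OF bounded_linear_ident]]
            bounded_bilinear.times_cont_diff_on_bilinear[OF bounded_bilinear_mult] times_cont_diff_on_const Suc o)
    qed
  qed
  then show ?thesis unfolding smooth_on_def by blast
qed

lemma smooth_on_divide:
  fixes f g :: "'a::real_normed_vector \<Rightarrow> real"
  assumes "open U" "smooth_on U f" "smooth_on U g" "\<And>x. x \<in> U \<Longrightarrow> g x \<noteq> 0"
  shows "smooth_on U (\<lambda>x. f x / g x)"
proof -
  have "smooth_on U (\<lambda>x. inverse (g x))"
    by (rule smooth_on_compose[OF assms(1) _ _ smooth_on_inverse_real assms(3)])
       (use assms in \<open>auto simp: open_Collect_neq\<close>)
  then show ?thesis using assms by (simp add: divide_inverse smooth_on_mult)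
qed

lemma smooth_on_prod:
  fixes f :: "'i \<Rightarrow> 'a::real_normed_vector \<Rightarrow> real"
  assumes "open U" "\<And>i. i \<in> I \<Longrightarrow> smooth_on U (f i)"
  shows "smooth_on U (\<lambda>x. \<Prod>i\<in>I. f i x)"
  using assms(2)
proof (induction I rule: infinite_finite_induct)
  case (insert i I)
  then show ?case by (simp add: smooth_on_mult[OF assms(1)])
qed (auto simp: smooth_on_const)

text \<open>Unlike \<open>e\<^bsup>-1/t\<^esup>\<close> alone, the family \<open>p(1/t) e\<^bsup>-1/t\<^esup>\<close> is closed under differentiation.\<close>

definition flat_fun :: "real poly \<Rightarrow> real \<Rightarrow> real" where
  "flat_fun p t = (if t > 0 then poly p (1 / t) * exp (- 1 / t) else 0)"

lemma flat_fun_tendsto_0: "(flat_fun p \<longlongrightarrow> 0) (at_right 0)"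
proof -
  have "((\<lambda>s. \<Sum>i\<le>degree p. coeff p i * (s ^ i / exp s)) \<longlongrightarrow> (\<Sum>i\<le>degree p. coeff p i * 0)) at_top"
    by (intro tendsto_sum tendsto_mult tendsto_const tendsto_power_div_exp_0)
  then have "((\<lambda>s. poly p s * exp (- s)) \<longlongrightarrow> 0) at_top"
    by (simp add: poly_altdef exp_minus divide_inverse sum_distrib_left algebra_simps)
  then have "((\<lambda>t. poly p (inverse t) * exp (- inverse t)) \<longlongrightarrow> 0) (at_right 0)"
    by (rule filterlim_compose[OF _ filterlim_inverse_at_top_right])
  moreover have "\<forall>\<^sub>F t in at_right 0. poly p (inverse t) * exp (- inverse t) = flat_fun p t"
    by (auto simp: flat_fun_def eventually_at_right_less divide_inverse
        intro: eventually_mono[OF eventually_at_right_less])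
  ultimately show ?thesis by (rule Lim_transform_eventually)
qed

text \<open>For t > 0 the derivative of p(1/t) exp(-1/t) is (p - p')(1/t) exp(-1/t) / t^2, and 1/t^2
  is the polynomial \<open>[:0, 0, 1:]\<close> in 1/t.\<close>

lemma flat_fun_has_derivative:
  "(flat_fun p has_real_derivative flat_fun ([:0, 0, 1:] * (p - pderiv p)) t) (at t)"
proof -
  consider "t > 0" | "t < 0" | "t = 0" by linarith
  then show ?thesis
  proof cases
    case 1
    have "((\<lambda>t. poly p (1 / t) * exp (- 1 / t)) has_real_derivative
        flat_fun ([:0, 0, 1:] * (p - pderiv p)) t) (at t)"
      using 1 by (auto intro!: derivative_eq_intros simp: flat_fun_def field_simps power2_eq_square)
    then show ?thesis
      by (rule has_field_derivative_transform_within_open[where S = "{0<..}"])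
         (use 1 in \<open>auto simp: flat_fun_def\<close>)
  next
    case 2
    have "((\<lambda>t. 0) has_real_derivative flat_fun ([:0, 0, 1:] * (p - pderiv p)) t) (at t)"
      using 2 by (simp add: flat_fun_def)
    then show ?thesis
      by (rule has_field_derivative_transform_within_open[where S = "{..<0}"])
         (use 2 in \<open>auto simp: flat_fun_def\<close>)
  next
    case 3
    \<comment> \<open>The variable of p stands for 1/h, so dividing by h multiplies p by its
      variable: the quotient is the flat function of \<open>pCons 0 p\<close>.\<close>
    have r: "((\<lambda>h. flat_fun p h / h) \<longlongrightarrow> 0) (at_right 0)"
      by (rule Lim_transform_eventually[OF flat_fun_tendsto_0[of "pCons 0 p"]])
         (auto simp: flat_fun_def intro: eventually_mono[OF eventually_at_right_less])
    have l: "((\<lambda>h. flat_fun p h / h) \<longlongrightarrow> 0) (at_left 0)"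
      by (rule Lim_transform_eventually[OF tendsto_const])
         (auto simp: flat_fun_def eventually_at_filter)
    show ?thesis
      using filterlim_split_at[OF l r] 3 by (simp add: DERIV_def flat_fun_def)
  qed
qed

lemma smooth_on_flat_fun: "smooth_on UNIV (flat_fun p)"
proof -
  have "times_cont_diff_on n UNIV (flat_fun p)" for n
  proof (induction n arbitrary: p)
    case 0
    then show ?case
      by (auto intro!: continuous_at_imp_continuous_on DERIV_isCont flat_fun_has_derivative)
  next
    case (Suc n)
    show ?case
      by (rule times_cont_diff_on_SucI[OF open_UNIV flat_fun_has_derivative[unfolded has_field_derivative_def]])
         (intro bounded_bilinear.times_cont_diff_on_bilinear[OF bounded_bilinear_mult] times_cont_diff_on_const Suc open_UNIV)
  qed
  then show ?thesis unfolding smooth_on_def by blast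
qed

section \<open>Smooth cut-off functions\<close>

definition flat_exp :: "real \<Rightarrow> real" where "flat_exp = flat_fun 1"

lemma flat_exp_pos: "t > 0 \<Longrightarrow> flat_exp t > 0" and flat_exp_zero: "t \<le> 0 \<Longrightarrow> flat_exp t = 0"
  and flat_exp_nonneg: "flat_exp t \<ge> 0"
  by (auto simp: flat_exp_def flat_fun_def)

lemma smooth_on_flat_exp:
  "open U \<Longrightarrow> smooth_on U f \<Longrightarrow> smooth_on U (\<lambda>x. flat_exp (f x))"
  unfolding flat_exp_def by (rule smooth_on_compose[OF _ open_UNIV _ smooth_on_flat_fun]) auto

text \<open>At each point one of \<open>flat_exp (a x)\<close> and \<open>flat_exp (b x)\<close> is
  positive, so the first can be divided by their sum. The regions where the cut-off is constant are
  given by the signs of two smooth functions, which are explicit in every application.\<close>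

lemma smooth_cutoff:
  fixes a b :: "'a::real_normed_vector \<Rightarrow> real"
  assumes "open U" "smooth_on U a" "smooth_on U b" "\<And>x. x \<in> U \<Longrightarrow> a x > 0 \<or> b x > 0"
  obtains \<phi> :: "'a \<Rightarrow> real" where "smooth_on U \<phi>" "\<And>x. x \<in> U \<Longrightarrow> a x \<le> 0 \<Longrightarrow> \<phi> x = 0"
    "\<And>x. x \<in> U \<Longrightarrow> b x \<le> 0 \<Longrightarrow> \<phi> x = 1" "\<And>x. x \<in> U \<Longrightarrow> 0 \<le> \<phi> x \<and> \<phi> x \<le> 1"
proof -
  let ?\<phi> = "\<lambda>x. flat_exp (a x) / (flat_exp (a x) + flat_exp (b x))"
  have pos: "flat_exp (a x) + flat_exp (b x) > 0" if "x \<in> U" for x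
    using assms(4)[OF that] flat_exp_pos[of "a x"] flat_exp_pos[of "b x"]
      flat_exp_nonneg[of "a x"] flat_exp_nonneg[of "b x"] by auto
  show thesis
  proof (rule that[of ?\<phi>])
    show "smooth_on U ?\<phi>"
      using less_imp_neq[OF pos]
      by (intro smooth_on_divide smooth_on_add smooth_on_flat_exp assms(1-3)) auto
    show "?\<phi> x = 0" if "x \<in> U" "a x \<le> 0" for x
      using that by (simp add: flat_exp_zero)
    show "?\<phi> x = 1" if "x \<in> U" "b x \<le> 0" for x
      using that pos[of x] by (simp add: flat_exp_zero)
    show "0 \<le> ?\<phi> x \<and> ?\<phi> x \<le> 1" if "x \<in> U" for x
      using pos[OF that] flat_exp_nonneg[of "a x"] flat_exp_nonneg[of "b x"] by (simp add: divide_simps)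
  qed
qed

section \<open>Symmetry of second derivatives\<close>

lemma mixed_partials:
  fixes \<phi> :: "real \<Rightarrow> real \<Rightarrow> 'b::euclidean_space"
  assumes \<delta>: "\<delta> > 0"
    and A: "\<And>s t. \<bar>s\<bar> \<le> \<delta> \<Longrightarrow> \<bar>t\<bar> \<le> \<delta> \<Longrightarrow> ((\<lambda>s. \<phi> s t) has_vector_derivative A s t) (at s)"
    and B: "\<And>s t. \<bar>s\<bar> \<le> \<delta> \<Longrightarrow> \<bar>t\<bar> \<le> \<delta> \<Longrightarrow> ((\<lambda>t. \<phi> s t) has_vector_derivative B s t) (at t)"
    and C: "\<And>s t. \<bar>s\<bar> \<le> \<delta> \<Longrightarrow> \<bar>t\<bar> \<le> \<delta> \<Longrightarrow> ((\<lambda>s. B s t) has_vector_derivative C s t) (at s)"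
    and cont: "continuous_on ({-\<delta>..\<delta>} \<times> {-\<delta>..\<delta>}) (\<lambda>(s, t). C s t)"
    and D: "((\<lambda>t. A 0 t) has_vector_derivative D) (at 0)"
  shows "D = C 0 0"
proof -
  have Bint: "(B s has_integral \<phi> s t - \<phi> s 0) {0..t}" if "0 \<le> t" "t \<le> \<delta>" "\<bar>s\<bar> \<le> \<delta>" for s t
  proof (rule fundamental_theorem_of_calculus)
    fix u assume "u \<in> {0..t}"
    then show "(\<phi> s has_vector_derivative B s u) (at u within {0..t})"
      using that by (intro has_vector_derivative_at_within[OF B]) auto
  qed (use that in auto)
  \<comment> \<open>Both sides are the derivative at s = 0 of \<phi> s t - \<phi> s 0: once read off
    from A, once by writing the difference as an integral of B and differentiating under the
    integral sign.\<close>
  have eq: "A 0 t - A 0 0 = integral {0..t} (C 0)" if t: "0 \<le> t" "t \<le> \<delta>" for t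
  proof -
    have "((\<lambda>s. integral (cbox 0 t) (B s)) has_vector_derivative integral (cbox 0 t) (C 0)) (at 0 within {-\<delta>..\<delta>})"
    proof (rule leibniz_rule_vector_derivative)
      show "((\<lambda>x. B x u) has_vector_derivative C x u) (at x within {- \<delta>..\<delta>})"
        if "x \<in> {- \<delta>..\<delta>}" "u \<in> cbox 0 t" for x u
        using that t by (intro has_vector_derivative_at_within[OF C]) auto
      show "B x integrable_on cbox 0 t" if "x \<in> {- \<delta>..\<delta>}" for x
        using has_integral_integrable[OF Bint[OF t, of x]] that by auto
      show "continuous_on ({- \<delta>..\<delta>} \<times> cbox 0 t) (\<lambda>(x, t). C x t)"
        by (rule continuous_on_subset[OF cont]) (use t in auto)
    qed (use \<delta> in auto)
    then have "((\<lambda>s. \<phi> s t - \<phi> s 0) has_vector_derivative integral (cbox 0 t) (C 0)) (at 0 within {-\<delta>..\<delta>})"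
      by (rule has_vector_derivative_transform[rotated 2])
         (use \<delta> t in \<open>auto intro!: integral_unique[symmetric] Bint\<close>)
    then have "((\<lambda>s. \<phi> s t - \<phi> s 0) has_vector_derivative integral {0..t} (C 0)) (at 0 within {-\<delta>..\<delta>})"
      by simp
    moreover have "((\<lambda>s. \<phi> s t - \<phi> s 0) has_vector_derivative A 0 t - A 0 0) (at 0 within {-\<delta>..\<delta>})"
      by (rule has_vector_derivative_at_within[OF has_vector_derivative_diff[OF A A]]) (use t \<delta> in auto)
    ultimately show ?thesis
      by (rule vector_derivative_unique_within_closed_interval
          [where a = "-\<delta>" and b = \<delta>, unfolded cbox_interval, symmetric, rotated 2]) (use \<delta> in auto)
  qed
  have "continuous_on {0..\<delta>} (\<lambda>u. case (0, u) of (s, t) \<Rightarrow> C s t)"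
    by (rule continuous_on_compose2[OF cont]) (use \<delta> in \<open>auto intro!: continuous_intros\<close>)
  then have "continuous_on {0..\<delta>} (C 0)" by simp
  \<comment> \<open>The interval lies to the right of 0; a one-sided derivative already determines
    D.\<close>
  then have "((\<lambda>t. integral {0..t} (C 0)) has_vector_derivative C 0 0) (at 0 within {0..\<delta>})"
    using integral_has_vector_derivative \<delta> by fastforce
  then have "((\<lambda>t. A 0 t - A 0 0) has_vector_derivative C 0 0) (at 0 within {0..\<delta>})"
    by (rule has_vector_derivative_transform[rotated 2]) (use \<delta> eq in auto)
  moreover have "((\<lambda>t. A 0 t - A 0 0) has_vector_derivative D) (at 0 within {0..\<delta>})"
    using has_vector_derivative_at_within[OF has_vector_derivative_diff[OF D has_vector_derivative_const]] by simp
  ultimately show ?thesis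
    by (rule vector_derivative_unique_within_closed_interval
        [where a = 0 and b = \<delta>, unfolded cbox_interval, symmetric, rotated 2]) (use \<delta> in auto)
qed

lemma frechet_derivative_symmetric:
  fixes f :: "'a::euclidean_space \<Rightarrow> 'b::euclidean_space"
  assumes U: "open U" and f: "smooth_on U f" and x: "x \<in> U"
  shows "frechet_derivative (\<lambda>y. frechet_derivative f (at y) v) (at x) w =
         frechet_derivative (\<lambda>y. frechet_derivative f (at y) w) (at x) v"
proof -
  obtain r where r: "r > 0" "ball x r \<subseteq> U" using U x openE by blast
  \<comment> \<open>Small enough to keep x + s v + t w in the ball for |s|, |t| at most \<delta>;
    the summand 1 covers v = w = 0.\<close>
  define \<delta> where "\<delta> = r / (2 * (norm v + norm w + 1))"
  have nn: "norm v + norm w + 1 > 0" by (simp add: add_nonneg_pos)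
  have \<delta>: "\<delta> > 0" using r nn by (simp add: \<delta>_def)
  let ?p = "\<lambda>s t. x + s *\<^sub>R v + t *\<^sub>R w"
  have inU: "?p s t \<in> U" if "\<bar>s\<bar> \<le> \<delta>" "\<bar>t\<bar> \<le> \<delta>" for s t
  proof -
    have "norm (s *\<^sub>R v + t *\<^sub>R w) \<le> \<bar>s\<bar> * norm v + \<bar>t\<bar> * norm w"
      by (rule norm_triangle_le) simp
    also have "\<dots> \<le> \<delta> * norm v + \<delta> * norm w"
      using that by (intro add_mono mult_right_mono) auto
    also have "\<dots> < \<delta> * (2 * (norm v + norm w + 1))"
      using \<delta> by (simp add: algebra_simps add_nonneg_pos)
    also have "\<dots> = r" unfolding \<delta>_def using nn by simp
    finally have "norm (- (s *\<^sub>R v + t *\<^sub>R w)) < r" unfolding norm_minus_cancel .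
    moreover have "- (s *\<^sub>R v + t *\<^sub>R w) = x - ?p s t" by simp
    ultimately have "dist x (?p s t) < r" by (simp only: dist_norm)
    then show ?thesis using r(2) by auto
  qed
  have hs: "((\<lambda>s. ?p s t) has_derivative (\<lambda>h. h *\<^sub>R v)) (at s)" for s t
    by (auto intro!: derivative_eq_intros)
  have ht: "((\<lambda>t. ?p s t) has_derivative (\<lambda>h. h *\<^sub>R w)) (at t)" for s t
    by (auto intro!: derivative_eq_intros)
  have ds: "((\<lambda>s. g (?p s t)) has_vector_derivative frechet_derivative g (at (?p s t)) v) (at s)"
    if "smooth_on U g" "\<bar>s\<bar> \<le> \<delta>" "\<bar>t\<bar> \<le> \<delta>" for s t and g :: "'a \<Rightarrow> 'b"
    using has_derivative_compose[OF hs smooth_on_has_derivative[OF that(1) inU[OF that(2,3)]]]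
      linear_scale[OF has_derivative_linear[OF smooth_on_has_derivative[OF that(1) inU[OF that(2,3)]]]]
    by (simp add: has_vector_derivative_def)
  have dt: "((\<lambda>t. g (?p s t)) has_vector_derivative frechet_derivative g (at (?p s t)) w) (at t)"
    if "smooth_on U g" "\<bar>s\<bar> \<le> \<delta>" "\<bar>t\<bar> \<le> \<delta>" for s t and g :: "'a \<Rightarrow> 'b"
    using has_derivative_compose[OF ht smooth_on_has_derivative[OF that(1) inU[OF that(2,3)]]]
      linear_scale[OF has_derivative_linear[OF smooth_on_has_derivative[OF that(1) inU[OF that(2,3)]]]]
    by (simp add: has_vector_derivative_def)
  define fv where "fv = (\<lambda>y. frechet_derivative f (at y) v)"
  define fw where "fw = (\<lambda>y. frechet_derivative f (at y) w)"
  have sm: "smooth_on U fv" "smooth_on U fw"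
    unfolding fv_def fw_def using smooth_on_frechet[OF f] by auto
  have "frechet_derivative fv (at (?p 0 0)) w = frechet_derivative fw (at (?p 0 0)) v"
  proof (rule mixed_partials[OF \<delta>, where \<phi> = "\<lambda>s t. f (?p s t)" and A = "\<lambda>s t. fv (?p s t)"
        and B = "\<lambda>s t. fw (?p s t)" and C = "\<lambda>s t. frechet_derivative fw (at (?p s t)) v"])
    have "continuous_on U (\<lambda>y. frechet_derivative fw (at y) v)"
      by (intro smooth_on_continuous smooth_on_frechet sm)
    then show "continuous_on ({-\<delta>..\<delta>} \<times> {-\<delta>..\<delta>}) (\<lambda>(s, t). frechet_derivative fw (at (?p s t)) v)"
      unfolding split_beta by (rule continuous_on_compose2) (auto intro!: continuous_intros inU)
    show "((\<lambda>t. fv (?p 0 t)) has_vector_derivative frechet_derivative fv (at (?p 0 0)) w) (at 0)"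
      using dt[OF sm(1), of 0 0] \<delta> by simp
  qed (use ds[OF sm(2)] ds[OF f] dt[OF f] in \<open>auto simp: fv_def fw_def\<close>)
  then show ?thesis by (simp add: fv_def fw_def)
qed

section \<open>Integrals depending smoothly on a parameter\<close>

lemma has_derivative_integral:
  fixes g :: "'a::euclidean_space \<times> real \<Rightarrow> 'b::euclidean_space"
  assumes U: "open U" and g: "smooth_on (U \<times> UNIV) g" and x: "x \<in> U"
  shows "((\<lambda>x. integral {0..1} (\<lambda>t. g (x, t))) has_derivative
       (\<lambda>v. integral {0..1} (\<lambda>t. frechet_derivative g (at (x, t)) (v, 0)))) (at x)"
proof -
  obtain r where r: "r > 0" "ball x r \<subseteq> U" using U x openE by blast
  let ?D = "\<lambda>y t v. frechet_derivative g (at (y, t)) (v, 0)"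
  have hd: "((\<lambda>y. g (y, t)) has_derivative ?D y t) (at y)" if "y \<in> U" for y t
    by (rule has_derivative_compose[OF _ smooth_on_has_derivative[OF g], of "\<lambda>y. (y, t)"])
       (use that in \<open>auto intro!: derivative_eq_intros\<close>)
  have bl: "bounded_linear (?D y t)" if "y \<in> U" for y t
    using has_derivative_bounded_linear[OF hd[OF that]] .
  \<comment> \<open>The Leibniz rule takes the derivative as a point of the space of bounded linear
    maps; continuity there is checked direction by direction.\<close>
  let ?F = "\<lambda>y t. Blinfun (?D y t)"
  have F: "blinfun_apply (?F y t) = ?D y t" if "y \<in> U" for y t
    using bounded_linear_Blinfun_apply[OF bl[OF that]] .
  have cont: "continuous_on (ball x r \<times> cbox 0 1) (\<lambda>(y, t). ?F y t)"
  proof (rule continuous_on_blinfun_componentwise)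
    fix i :: 'a
    have "continuous_on (ball x r \<times> cbox 0 1) (\<lambda>z. frechet_derivative g (at z) (i, 0))"
      by (rule continuous_on_subset[OF smooth_on_continuous[OF smooth_on_frechet[OF g]]]) (use r in auto)
    then show "continuous_on (ball x r \<times> cbox 0 1) (\<lambda>z. blinfun_apply (case z of (y, t) \<Rightarrow> ?F y t) i)"
      by (rule continuous_on_eq) (use r F in \<open>auto simp: subset_eq\<close>)
  qed
  have "((\<lambda>y. integral (cbox 0 1) (\<lambda>t. g (y, t))) has_derivative
     blinfun_apply (integral (cbox 0 1) (?F x))) (at x within ball x r)"
  proof (rule leibniz_rule[OF _ _ cont])
    show "((\<lambda>y. g (y, t)) has_derivative blinfun_apply (?F y t)) (at y within ball x r)"
      if "y \<in> ball x r" for y t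
      using that r F hd by (auto simp: subset_eq intro: has_derivative_at_withinI)
    show "(\<lambda>t. g (y, t)) integrable_on cbox 0 1" if "y \<in> ball x r" for y
      by (rule integrable_continuous, rule continuous_on_compose2[OF smooth_on_continuous[OF g]])
         (use r that in \<open>auto intro!: continuous_intros\<close>)
  qed (use r in auto)
  moreover have "blinfun_apply (integral (cbox 0 1) (?F x)) = (\<lambda>v. integral {0..1} (\<lambda>t. ?D x t v))"
  proof
    fix v
    have "?F x integrable_on cbox 0 1"
      by (rule integrable_continuous, rule continuous_on_compose2[OF cont, of _ "\<lambda>t. (x, t)", simplified])
         (use r in \<open>auto intro!: continuous_intros\<close>)
    then have "blinfun_apply (integral (cbox 0 1) (?F x)) v = integral (cbox 0 1) (\<lambda>t. blinfun_apply (?F x t) v)"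
      by (rule blinfun_apply_integral)
    then show "blinfun_apply (integral (cbox 0 1) (?F x)) v = integral {0..1} (\<lambda>t. ?D x t v)"
      using F[OF x] by simp
  qed
  ultimately show ?thesis using r at_within_open[of x "ball x r"] by simp
qed

text \<open>The derivative in x is an integral of the same type, so induction on the order applies.
  The parameter t ranges over the whole line although only [0,1] is integrated, which keeps the
  domain open; homotopies below have the whole line as time for the same reason.\<close>

lemma smooth_on_integral:
  fixes g :: "'a::euclidean_space \<times> real \<Rightarrow> 'b::euclidean_space"
  assumes U: "open U" and g: "smooth_on (U \<times> UNIV) g"
  shows "smooth_on U (\<lambda>x. integral {0..1} (\<lambda>t. g (x, t)))"
proof -
  have "times_cont_diff_on n U (\<lambda>x. integral {0..1} (\<lambda>t. g (x, t)))" for n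
    using g
  proof (induction n arbitrary: g)
    case 0
    show ?case
      by (auto intro!: continuous_at_imp_continuous_on has_derivative_continuous
          has_derivative_integral[OF U 0])
  next
    case (Suc n)
    show ?case
      by (rule times_cont_diff_on_SucI[OF U has_derivative_integral[OF U Suc.prems]])
         (use Suc smooth_on_frechet in blast)+
  qed
  then show ?thesis unfolding smooth_on_def by blast
qed

section \<open>Alternating forms, exterior derivative and pullback\<close>

definition omit :: "nat \<Rightarrow> 'a list \<Rightarrow> 'a list" where
  "omit i vs = take i vs @ drop (Suc i) vs"

lemma length_omit: "i < length vs \<Longrightarrow> length (omit i vs) = length vs - 1"
  by (simp add: omit_def)

lemma map_omit: "map f (omit i vs) = omit i (map f vs)"
  by (simp add: omit_def take_map drop_map)

lemma omit_0: "omit 0 (v # vs) = vs" and omit_Suc: "omit (Suc i) (v # vs) = v # omit i vs"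
  by (simp_all add: omit_def)

lemma nth_omit: "i < length vs \<Longrightarrow> j < length vs - 1 \<Longrightarrow> omit i vs ! j = vs ! (if j < i then j else Suc j)"
  by (auto simp: omit_def nth_append min_def)

text \<open>A pair of positions i < Suc j. The later one is written \<open>Suc j\<close> because it
  becomes j once position i has been omitted, which is how two successive omissions are indexed in
  \<open>sum_cancel\<close>.\<close>

lemma split_two:
  assumes "i \<le> j" "Suc j < length vs"
  obtains us ms ws where "vs = us @ vs ! i # ms @ vs ! Suc j # ws" "length us = i" "length ms = j - i"
proof -
  have 1: "vs = take i vs @ vs ! i # drop (Suc i) vs"
    using assms by (intro id_take_nth_drop) simp
  have 2: "drop (Suc i) vs = take (j - i) (drop (Suc i) vs) @ drop (Suc i) vs ! (j - i) #
      drop (Suc (j - i)) (drop (Suc i) vs)"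
    using assms by (intro id_take_nth_drop) simp
  have 3: "drop (Suc i) vs ! (j - i) = vs ! Suc j" using assms by simp
  show thesis
    by (rule that[of "take i vs" "take (j - i) (drop (Suc i) vs)" "drop (Suc (j - i)) (drop (Suc i) vs)"])
       (use 1 2 3 assms in auto)
qed

lemma omit_append: "omit (length us) (us @ a # ws) = us @ ws"
  by (simp add: omit_def)

text \<open>For i \<le> j, omitting i and then j removes the same two entries as omitting Suc j and
  then i. This pairs off the whole double index set, so it suffices that paired terms are
  opposite.\<close>

lemma sum_cancel:
  fixes a :: "nat \<Rightarrow> nat \<Rightarrow> 'b::ab_group_add"
  assumes "\<And>i j. i \<le> j \<Longrightarrow> j < n \<Longrightarrow> a i j + a (Suc j) i = 0"
  shows "(\<Sum>i<Suc n. \<Sum>j<n. a i j) = 0"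
proof -
  let ?P = "{..<Suc n} \<times> {..<n}"
  let ?A = "{(i, j) \<in> ?P. i \<le> j}" and ?B = "{(i, j) \<in> ?P. j < i}"
  have "(\<Sum>i<Suc n. \<Sum>j<n. a i j) = (\<Sum>(i, j)\<in>?P. a i j)"
    by (rule sum.cartesian_product)
  also have "?P = ?A \<union> ?B" by auto
  also have "(\<Sum>(i, j)\<in>?A \<union> ?B. a i j) = (\<Sum>(i, j)\<in>?A. a i j) + (\<Sum>(i, j)\<in>?B. a i j)"
    by (rule sum.union_disjoint) (auto intro: finite_subset[of _ ?P])
  also have "(\<Sum>(i, j)\<in>?B. a i j) = (\<Sum>(i, j)\<in>?A. a (Suc j) i)"
    by (rule sum.reindex_bij_witness[of _ "\<lambda>(i, j). (Suc j, i)" "\<lambda>(i, j). (j, i - 1)"]) auto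
  also have "(\<Sum>(i, j)\<in>?A. a i j) + (\<Sum>(i, j)\<in>?A. a (Suc j) i) = (\<Sum>(i, j)\<in>?A. a i j + a (Suc j) i)"
    by (simp add: sum.distrib[symmetric] split_beta)
  also have "\<dots> = 0" by (rule sum.neutral) (use assms in auto)
  finally show ?thesis .
qed

text \<open>The pointwise part of \<open>smooth_forms\<close>. Because lists of the wrong length get
  the value 0, linearity and the sign rules below hold for lists of every length.\<close>

definition alt_form :: "nat \<Rightarrow> ('a::real_vector list \<Rightarrow> complex) \<Rightarrow> bool" where
  "alt_form k f \<longleftrightarrow> (\<forall>vs. length vs \<noteq> k \<longrightarrow> f vs = 0) \<and>
     (\<forall>vs. length vs = k \<longrightarrow> (\<forall>i<k. linear (\<lambda>w. f (vs[i := w])))) \<and>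
     (\<forall>vs. length vs = k \<longrightarrow> \<not> distinct vs \<longrightarrow> f vs = 0)"

lemma alt_form_length: "alt_form k f \<Longrightarrow> length vs \<noteq> k \<Longrightarrow> f vs = 0"
  unfolding alt_form_def by blast

lemma alt_form_distinct: "alt_form k f \<Longrightarrow> \<not> distinct vs \<Longrightarrow> f vs = 0"
  unfolding alt_form_def by blast

lemma linear_zero_fun: "linear (\<lambda>w. 0)"
  by (rule linearI) auto

lemma alt_form_linear:
  assumes "alt_form k f" shows "linear (\<lambda>w. f (us @ w # ws))"
proof (cases "length (us @ 0 # ws) = k")
  case True
  have "\<forall>vs. length vs = k \<longrightarrow> (\<forall>i<k. linear (\<lambda>w. f (vs[i := w])))"
    using assms unfolding alt_form_def by blast
  from this[rule_format, of "us @ 0 # ws" "length us"] True show ?thesis by simp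
next
  case False
  then have "(\<lambda>w. f (us @ w # ws)) = (\<lambda>w. 0)"
    using alt_form_length[OF assms] by auto
  then show ?thesis using linear_zero_fun by metis
qed

lemma alt_form_swap:
  assumes f: "alt_form k f" shows "f (us @ a # b # ws) = - f (us @ b # a # ws)"
proof -
  have l1: "f (us @ (x + y) # ws') = f (us @ x # ws') + f (us @ y # ws')" for x y ws'
    using linear_add[OF alt_form_linear[OF f]] .
  have l2: "f (us @ c # (x + y) # ws) = f (us @ c # x # ws) + f (us @ c # y # ws)" for c x y
    using linear_add[OF alt_form_linear[OF f, of "us @ [c]" ws]] by simp
  have z: "f (us @ c # c # ws) = 0" for c
    by (rule alt_form_distinct[OF f]) simp
  have "0 = f (us @ (a + b) # (a + b) # ws)" using z by simp
  also have "\<dots> = f (us @ a # b # ws) + f (us @ b # a # ws)"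
    by (simp only: l1 l2) (simp add: z)
  finally show ?thesis by (metis eq_neg_iff_add_eq_0)
qed

lemma alt_form_move:
  assumes f: "alt_form k f"
  shows "f (us @ a # ms @ ws) = (-1) ^ length ms * f (us @ ms @ a # ws)"
proof (induction ms arbitrary: us)
  case (Cons m ms)
  have "f (us @ a # (m # ms) @ ws) = - f ((us @ [m]) @ a # ms @ ws)"
    using alt_form_swap[OF f, of us a m "ms @ ws"] by simp
  also have "\<dots> = - ((-1) ^ length ms * f ((us @ [m]) @ ms @ a # ws))"
    by (simp only: Cons.IH)
  finally show ?case by simp
qed simp

lemma smooth_forms_iff:
  "\<omega> \<in> smooth_forms k U \<longleftrightarrow> (\<forall>x. x \<notin> U \<longrightarrow> \<omega> x = (\<lambda>_. 0)) \<and> (\<forall>x. alt_form k (\<omega> x)) \<and>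
     (\<forall>vs. smooth_on U (\<lambda>x. \<omega> x vs))"
proof
  assume \<omega>: "\<omega> \<in> smooth_forms k U"
  have out: "\<omega> x = (\<lambda>_. 0)" if "x \<notin> U" for x
    using \<omega> that unfolding smooth_forms_def by auto
  have "alt_form k (\<omega> x)" for x
  proof (cases "x \<in> U")
    case True
    then show ?thesis using \<omega> unfolding smooth_forms_def alt_form_def by blast
  next
    case False
    then show ?thesis by (simp add: out alt_form_def linear_zero_fun)
  qed
  moreover have "smooth_on U (\<lambda>x. \<omega> x vs)" for vs
  proof (cases "length vs = k")
    case True
    then show ?thesis using \<omega> unfolding smooth_forms_def by blast
  next
    case False
    then have "(\<lambda>x. \<omega> x vs) = (\<lambda>x. 0)" using \<omega> unfolding smooth_forms_def by auto
    then show ?thesis using smooth_on_const by metis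
  qed
  ultimately show "(\<forall>x. x \<notin> U \<longrightarrow> \<omega> x = (\<lambda>_. 0)) \<and> (\<forall>x. alt_form k (\<omega> x)) \<and>
     (\<forall>vs. smooth_on U (\<lambda>x. \<omega> x vs))" using out by blast
next
  assume "(\<forall>x. x \<notin> U \<longrightarrow> \<omega> x = (\<lambda>_. 0)) \<and> (\<forall>x. alt_form k (\<omega> x)) \<and>
     (\<forall>vs. smooth_on U (\<lambda>x. \<omega> x vs))"
  then show "\<omega> \<in> smooth_forms k U"
    unfolding smooth_forms_def alt_form_def by auto
qed

lemma smooth_forms_outside: "\<omega> \<in> smooth_forms k U \<Longrightarrow> x \<notin> U \<Longrightarrow> \<omega> x vs = 0"
  and smooth_forms_alt: "\<omega> \<in> smooth_forms k U \<Longrightarrow> alt_form k (\<omega> x)"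
  and smooth_forms_smooth: "\<omega> \<in> smooth_forms k U \<Longrightarrow> smooth_on U (\<lambda>x. \<omega> x vs)"
  unfolding smooth_forms_iff by auto

lemma smooth_forms_has_derivative:
  "\<omega> \<in> smooth_forms k U \<Longrightarrow> x \<in> U \<Longrightarrow>
    ((\<lambda>y. \<omega> y vs) has_derivative frechet_derivative (\<lambda>y. \<omega> y vs) (at x)) (at x)"
  by (rule smooth_on_has_derivative[OF smooth_forms_smooth])

lemma frechet_derivative_eqI: "(f has_derivative f') (at x) \<Longrightarrow> frechet_derivative f (at x) = f'"
  using frechet_derivative_at by metis

lemma ext_deriv_apply:
  "x \<in> U \<Longrightarrow> ext_deriv U \<omega> x vs =
    (\<Sum>i<length vs. (-1) ^ i * frechet_derivative (\<lambda>y. \<omega> y (omit i vs)) (at x) (vs ! i))"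
  by (simp add: ext_deriv_def omit_def)

section \<open>Exterior derivative\<close>

lemma linear_frechet_param:
  assumes d: "\<And>w. ((\<lambda>y. g y w) has_derivative frechet_derivative (\<lambda>y. g y w) (at x)) (at x)"
    and l: "\<And>y. linear (g y)"
  shows "linear (\<lambda>w. frechet_derivative (\<lambda>y. g y w) (at x) u)"
proof (rule linearI)
  fix w w'
  have "(\<lambda>y. g y (w + w')) = (\<lambda>y. g y w + g y w')" using linear_add[OF l] by auto
  then show "frechet_derivative (\<lambda>y. g y (w + w')) (at x) u =
      frechet_derivative (\<lambda>y. g y w) (at x) u + frechet_derivative (\<lambda>y. g y w') (at x) u"
    using frechet_derivative_eqI[OF has_derivative_add[OF d[of w] d[of w']]] by simp
next
  fix c w
  have "(\<lambda>y. g y (c *\<^sub>R w)) = (\<lambda>y. c *\<^sub>R g y w)" using linear_scale[OF l] by auto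
  then show "frechet_derivative (\<lambda>y. g y (c *\<^sub>R w)) (at x) u = c *\<^sub>R frechet_derivative (\<lambda>y. g y w) (at x) u"
    using frechet_derivative_eqI[OF has_derivative_scaleR_right[OF d[of w]]] by simp
qed

lemma linear_sum_fun: "(\<And>i. i \<in> I \<Longrightarrow> linear (f i)) \<Longrightarrow> linear (\<lambda>x. \<Sum>i\<in>I. f i x)"
  by (rule linear_compose_sum) blast

lemma linear_times: "linear f \<Longrightarrow> linear (\<lambda>x. (c::complex) * f x)"
  by (rule linear_compose[of f "\<lambda>x. c * x", unfolded o_def]) (auto intro: linearI simp: algebra_simps)

lemma ext_deriv_smooth_forms:
  fixes U :: "'a::euclidean_space set"
  assumes U: "open U" and \<omega>: "\<omega> \<in> smooth_forms k U"
  shows "ext_deriv U \<omega> \<in> smooth_forms (Suc k) U"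
  unfolding smooth_forms_iff
proof (intro conjI allI impI)
  show "ext_deriv U \<omega> x = (\<lambda>_. 0)" if "x \<notin> U" for x using that by (auto simp: ext_deriv_def)
next
  fix vs :: "'a list"
  have "smooth_on U (\<lambda>x. \<Sum>i<length vs. (-1) ^ i * frechet_derivative (\<lambda>y. \<omega> y (omit i vs)) (at x) (vs ! i))"
    by (intro smooth_on_sum smooth_on_mult smooth_on_const smooth_on_frechet smooth_forms_smooth[OF \<omega>] U)
  then show "smooth_on U (\<lambda>x. ext_deriv U \<omega> x vs)"
    by (subst smooth_on_cong[OF U ext_deriv_apply]) auto
next
  fix x
  have zero: "frechet_derivative (\<lambda>y. \<omega> y vs) (at x) v = 0" if "\<And>y. \<omega> y vs = 0" for vs v
    using that by simp
  show "alt_form (Suc k) (ext_deriv U \<omega> x)"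
  proof (cases "x \<in> U")
    case False
    then show ?thesis by (simp add: ext_deriv_def alt_form_def linear_zero_fun)
  next
    case x: True
    show ?thesis unfolding alt_form_def
    proof (intro conjI allI impI)
      fix vs :: "'a list" assume "length vs \<noteq> Suc k"
      then have "\<omega> y (omit i vs) = 0" if "i < length vs" for i y
        using that by (intro alt_form_length[OF smooth_forms_alt[OF \<omega>]]) (auto simp: length_omit)
      then show "ext_deriv U \<omega> x vs = 0" by (simp add: ext_deriv_apply[OF x])
    next
      fix vs :: "'a list" and p assume len: "length vs = Suc k" and p: "p < Suc k"
      have "linear (\<lambda>w. (-1) ^ i * frechet_derivative (\<lambda>y. \<omega> y (omit i (vs[p := w]))) (at x) (vs[p := w] ! i))"
        if i: "i < Suc k" for i
      proof (cases "i = p")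
        case True
        have "omit p (vs[p := w]) = omit p vs" for w by (simp add: omit_def)
        then show ?thesis using True p len
            has_derivative_linear[OF smooth_forms_has_derivative[OF \<omega> x, of "omit p vs"]]
          by (auto intro: linear_times)
      next
        case False
        \<comment> \<open>Position of the varied argument after entry i has been omitted.\<close>
        define q where "q = (if p < i then p else p - 1)"
        have om: "omit i (vs[p := w]) = (omit i vs)[q := w]" for w
          using False i p len unfolding q_def
          by (intro nth_equalityI) (auto simp: length_omit nth_omit nth_list_update)
        have q: "q < length (omit i vs)" using False i p len by (auto simp: length_omit q_def)
        have "linear (\<lambda>w. frechet_derivative (\<lambda>y. \<omega> y ((omit i vs)[q := w])) (at x) (vs ! i))"
          using alt_form_linear[OF smooth_forms_alt[OF \<omega>]] q
          by (intro linear_frechet_param smooth_forms_has_derivative[OF \<omega> x]) (simp add: upd_conv_take_nth_drop)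
        then show ?thesis using False by (auto simp: om intro!: linear_times)
      qed
      then show "linear (\<lambda>w. ext_deriv U \<omega> x (vs[p := w]))"
        unfolding ext_deriv_apply[OF x] length_list_update len by (intro linear_sum_fun) auto
    next
      fix vs :: "'a list" assume len: "length vs = Suc k" and "\<not> distinct vs"
      then obtain us a ms ws where vs: "vs = us @ a # ms @ a # ws"
        using not_distinct_decomp[of vs] by auto
      define p where "p = length us"
      define q where "q = Suc (p + length ms)"
      have pq: "p < q" "q < length vs" "vs ! p = a" "vs ! q = a"
        by (auto simp: p_def q_def vs nth_append)
      have op: "omit p vs = us @ ms @ a # ws" unfolding p_def vs omit_append by simp
      have oq: "omit q vs = us @ a # ms @ ws"
        using omit_append[of "us @ a # ms" a ws] by (simp add: vs p_def q_def)
      let ?t = "\<lambda>i. (-1) ^ i * frechet_derivative (\<lambda>y. \<omega> y (omit i vs)) (at x) (vs ! i)"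
      \<comment> \<open>With any other entry omitted both copies of a survive, so the form vanishes
        on the list; the terms for p and q remain.\<close>
      have "?t i = 0" if i: "i < length vs" "i \<noteq> p" "i \<noteq> q" for i
      proof -
        define s where "s = (\<lambda>p. if p < i then p else p - 1)"
        have "omit i vs ! s p = a" "omit i vs ! s q = a" "s p < s q" "s q < length (omit i vs)"
          using i pq by (auto simp: s_def nth_omit length_omit)
        then have "\<not> distinct (omit i vs)" using nth_eq_iff_index_eq by fastforce
        then show ?thesis using alt_form_distinct[OF smooth_forms_alt[OF \<omega>]] by simp
      qed
      then have "(\<Sum>i<length vs. ?t i) = (\<Sum>i\<in>{p, q}. ?t i)"
        by (intro sum.mono_neutral_right) (use pq in auto)
      also have "\<dots> = ?t p + ?t q" using pq by simp
      \<comment> \<open>Carrying a past \<open>ms\<close> costs the sign (-1)^length ms, and q - p =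
        length ms + 1, so the two terms are opposite.\<close>
      also have "?t q = - ?t p"
      proof -
        have "(\<lambda>y. \<omega> y (omit q vs)) = (\<lambda>y. (-1) ^ length ms * \<omega> y (omit p vs))"
          unfolding op oq using alt_form_move[OF smooth_forms_alt[OF \<omega>]] by blast
        then have "frechet_derivative (\<lambda>y. \<omega> y (omit q vs)) (at x) a =
            (-1) ^ length ms * frechet_derivative (\<lambda>y. \<omega> y (omit p vs)) (at x) a"
          using frechet_derivative_eqI[OF has_derivative_mult_right[OF smooth_forms_has_derivative[OF \<omega> x]]]
          by simp
        then show ?thesis unfolding pq by (simp add: q_def power_add flip: power_mult_distrib)
      qed
      finally show "ext_deriv U \<omega> x vs = 0" by (simp add: ext_deriv_apply[OF x])
    qed
  qed
qed

text \<open>Second derivatives are symmetric in their two directions, while the two orders of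
  omitting the same pair of arguments carry opposite signs.\<close>

lemma ext_deriv_ext_deriv:
  fixes U :: "'a::euclidean_space set"
  assumes U: "open U" and \<omega>: "\<omega> \<in> smooth_forms k U"
  shows "ext_deriv U (ext_deriv U \<omega>) = 0"
proof (intro ext)
  fix x and vs :: "'a list"
  show "ext_deriv U (ext_deriv U \<omega>) x vs = 0 x vs"
  proof (cases "x \<in> U \<and> vs \<noteq> []")
    case False
    then show ?thesis by (auto simp: ext_deriv_def)
  next
    case True
    then have x: "x \<in> U" and "\<exists>n. length vs = Suc n" by (cases vs; auto)+
    then obtain n where n: "length vs = Suc n" by blast
    let ?D = "\<lambda>v w us. frechet_derivative (\<lambda>y. frechet_derivative (\<lambda>z. \<omega> z us) (at y) w) (at x) v"
    have d: "frechet_derivative (\<lambda>y. ext_deriv U \<omega> y us) (at x) v =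
        (\<Sum>j<length us. (-1) ^ j * ?D v (us ! j) (omit j us))" for us v
    proof -
      have "frechet_derivative (\<lambda>y. ext_deriv U \<omega> y us) (at x) =
          frechet_derivative (\<lambda>y. \<Sum>j<length us. (-1) ^ j * frechet_derivative (\<lambda>z. \<omega> z (omit j us)) (at y) (us ! j)) (at x)"
        by (rule frechet_derivative_cong_open[OF U x ext_deriv_apply])
      also have "\<dots> = (\<lambda>v. \<Sum>j<length us. (-1) ^ j * ?D v (us ! j) (omit j us))"
        by (intro frechet_derivative_eqI has_derivative_sum has_derivative_mult_right
            smooth_on_has_derivative[OF smooth_on_frechet[OF smooth_forms_smooth[OF \<omega>]] x])
      finally show ?thesis by simp
    qed
    have "ext_deriv U (ext_deriv U \<omega>) x vs =
        (\<Sum>i<Suc n. \<Sum>j<n. (-1) ^ (i + j) * ?D (vs ! i) (omit i vs ! j) (omit j (omit i vs)))"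
      unfolding ext_deriv_apply[OF x] d n
      by (intro sum.cong refl) (simp add: length_omit n sum_distrib_left power_add mult.assoc)
    also have "\<dots> = 0"
    proof (rule sum_cancel)
      fix i j assume ij: "i \<le> j" "j < n"
      obtain us ms ws where vs: "vs = us @ vs ! i # ms @ vs ! Suc j # ws" "length us = i" "length ms = j - i"
        using split_two[OF ij(1), of vs] ij n by auto
      have 1: "omit i vs = us @ ms @ vs ! Suc j # ws"
        using omit_append[of us "vs ! i"] vs by metis
      have 2: "omit (Suc j) vs = us @ vs ! i # ms @ ws"
        using omit_append[of "us @ vs ! i # ms" "vs ! Suc j" ws] vs ij by simp
      have 3: "omit j (omit i vs) = us @ ms @ ws"
        unfolding 1 using omit_append[of "us @ ms" "vs ! Suc j" ws] vs ij by simp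
      have 4: "omit i (omit (Suc j) vs) = us @ ms @ ws"
        unfolding 2 using omit_append[of us "vs ! i" "ms @ ws"] vs by simp
      have 5: "omit i vs ! j = vs ! Suc j" "omit (Suc j) vs ! i = vs ! i"
        using ij n by (auto simp: nth_omit)
      show "(-1) ^ (i + j) * ?D (vs ! i) (omit i vs ! j) (omit j (omit i vs)) +
         (-1) ^ (Suc j + i) * ?D (vs ! Suc j) (omit (Suc j) vs ! i) (omit i (omit (Suc j) vs)) = 0"
        unfolding 3 4 5 using frechet_derivative_symmetric[OF U smooth_forms_smooth[OF \<omega>] x]
        by (simp add: add.commute)
    qed
    finally show ?thesis by simp
  qed
qed

section \<open>Pullback of forms\<close>

definition pull :: "'a::euclidean_space set \<Rightarrow> ('a \<Rightarrow> 'b::euclidean_space) \<Rightarrow> 'b form \<Rightarrow> 'a form" where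
  "pull U F \<omega> = (\<lambda>x vs. if x \<in> U then \<omega> (F x) (map (frechet_derivative F (at x)) vs) else 0)"

text \<open>Turns an argument that varies with the point into scalar coefficients and fixed basis
  vectors; smoothness is part of the definition of a form for fixed arguments.\<close>

lemma smooth_forms_expand:
  assumes "\<omega> \<in> smooth_forms k W"
  shows "\<omega> y (us @ w # ws) = (\<Sum>b\<in>Basis. (w \<bullet> b) *\<^sub>R \<omega> y (us @ b # ws))"
  by (rule linear_eq_sum_Basis[OF alt_form_linear[OF smooth_forms_alt[OF assms]]])

lemma smooth_on_form_args:
  fixes F :: "'a::euclidean_space \<Rightarrow> 'b::euclidean_space"
  assumes U: "open U" and W: "open W" and F: "smooth_on U F" "\<And>x. x \<in> U \<Longrightarrow> F x \<in> W"
    and \<omega>: "\<omega> \<in> smooth_forms k W" and gs: "\<And>g. g \<in> set gs \<Longrightarrow> smooth_on U g"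
  shows "smooth_on U (\<lambda>x. \<omega> (F x) (us @ map (\<lambda>g. g x) gs))"
  using gs
proof (induction gs arbitrary: us)
  case Nil
  show ?case
    using smooth_on_compose[OF U W F(2) smooth_forms_smooth[OF \<omega>] F(1)] by simp
next
  case (Cons g gs)
  have "smooth_on U (\<lambda>x. \<Sum>b\<in>Basis. (g x \<bullet> b) *\<^sub>R \<omega> (F x) ((us @ [b]) @ map (\<lambda>g. g x) gs))"
    using Cons.prems by (intro smooth_on_sum smooth_on_scaleR smooth_on_inner_left Cons.IH U) auto
  then show ?case by (simp add: smooth_forms_expand[OF \<omega>, of _ us "g y" for y])
qed

text \<open>Product rule for a form whose base point and arguments both move: the base point
  contributes the first term, each argument one summand. The constant prefix \<open>us\<close> is
  generalised because the expansion makes the first moving argument a constant one.\<close>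

lemma has_derivative_form_args:
  fixes F :: "'a::euclidean_space \<Rightarrow> 'b::euclidean_space"
  assumes F: "(F has_derivative F') (at x)" "F x \<in> W"
    and \<omega>: "\<omega> \<in> smooth_forms k W"
    and gs: "\<And>g. g \<in> set gs \<Longrightarrow> (g has_derivative frechet_derivative g (at x)) (at x)"
  shows "((\<lambda>x. \<omega> (F x) (us @ map (\<lambda>g. g x) gs)) has_derivative
    (\<lambda>v. frechet_derivative (\<lambda>y. \<omega> y (us @ map (\<lambda>g. g x) gs)) (at (F x)) (F' v) +
      (\<Sum>j<length gs. \<omega> (F x) (us @ (map (\<lambda>g. g x) gs)[j := frechet_derivative (gs ! j) (at x) v]))))
    (at x)"
  using gs
proof (induction gs arbitrary: us)
  case Nil
  show ?case using has_derivative_compose[OF F(1) smooth_forms_has_derivative[OF \<omega> F(2)]] by simp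
next
  case (Cons g gs)
  let ?L = "map (\<lambda>g. g x) gs"
  let ?D = "\<lambda>us v. frechet_derivative (\<lambda>y. \<omega> y (us @ ?L)) (at (F x)) (F' v) +
      (\<Sum>j<length gs. \<omega> (F x) (us @ ?L[j := frechet_derivative (gs ! j) (at x) v]))"
  have g: "((\<lambda>y. g y \<bullet> b) has_derivative (\<lambda>v. frechet_derivative g (at x) v \<bullet> b)) (at x)" for b
    using Cons.prems by (intro has_derivative_inner_left) auto
  have "((\<lambda>y. \<Sum>b\<in>Basis. (g y \<bullet> b) *\<^sub>R \<omega> (F y) ((us @ [b]) @ map (\<lambda>g. g y) gs)) has_derivative
     (\<lambda>v. \<Sum>b\<in>Basis. (g x \<bullet> b) *\<^sub>R ?D (us @ [b]) v +
        (frechet_derivative g (at x) v \<bullet> b) *\<^sub>R \<omega> (F x) ((us @ [b]) @ ?L))) (at x)"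
    using Cons.prems by (intro has_derivative_sum has_derivative_scaleR g Cons.IH) auto
  moreover have "(\<lambda>y. \<Sum>b\<in>Basis. (g y \<bullet> b) *\<^sub>R \<omega> (F y) ((us @ [b]) @ map (\<lambda>g. g y) gs)) =
      (\<lambda>y. \<omega> (F y) (us @ map (\<lambda>g. g y) (g # gs)))"
    by (simp add: smooth_forms_expand[OF \<omega>, of _ us "g y" for y])
  moreover have "(\<Sum>b\<in>Basis. (g x \<bullet> b) *\<^sub>R ?D (us @ [b]) v +
        (frechet_derivative g (at x) v \<bullet> b) *\<^sub>R \<omega> (F x) ((us @ [b]) @ ?L)) =
     frechet_derivative (\<lambda>y. \<omega> y (us @ map (\<lambda>g. g x) (g # gs))) (at (F x)) (F' v) +
      (\<Sum>j<length (g # gs). \<omega> (F x) (us @ (map (\<lambda>g. g x) (g # gs))[j := frechet_derivative ((g # gs) ! j) (at x) v]))"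
    for v
  proof -
    have "frechet_derivative (\<lambda>y. \<omega> y (us @ map (\<lambda>g. g x) (g # gs))) (at (F x)) =
       frechet_derivative (\<lambda>y. \<Sum>b\<in>Basis. (g x \<bullet> b) *\<^sub>R \<omega> y (us @ b # ?L)) (at (F x))"
      by (simp add: smooth_forms_expand[OF \<omega>, of _ us "g x"])
    also have "\<dots> = (\<lambda>v. \<Sum>b\<in>Basis. (g x \<bullet> b) *\<^sub>R frechet_derivative (\<lambda>y. \<omega> y (us @ b # ?L)) (at (F x)) v)"
      by (intro frechet_derivative_eqI has_derivative_sum has_derivative_scaleR_right
          smooth_forms_has_derivative[OF \<omega> F(2)])
    finally have 1: "frechet_derivative (\<lambda>y. \<omega> y (us @ map (\<lambda>g. g x) (g # gs))) (at (F x)) (F' v) =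
       (\<Sum>b\<in>Basis. (g x \<bullet> b) *\<^sub>R frechet_derivative (\<lambda>y. \<omega> y (us @ b # ?L)) (at (F x)) (F' v))" by simp
    have 2: "(\<Sum>j<length (g # gs). \<omega> (F x) (us @ (map (\<lambda>g. g x) (g # gs))[j := frechet_derivative ((g # gs) ! j) (at x) v])) =
       \<omega> (F x) (us @ frechet_derivative g (at x) v # ?L) +
       (\<Sum>j<length gs. \<omega> (F x) (us @ g x # ?L[j := frechet_derivative (gs ! j) (at x) v]))"
      by (simp add: sum.lessThan_Suc_shift del: sum.lessThan_Suc)
    have 3: "\<omega> (F x) (us @ frechet_derivative g (at x) v # ?L) =
        (\<Sum>b\<in>Basis. (frechet_derivative g (at x) v \<bullet> b) *\<^sub>R \<omega> (F x) (us @ b # ?L))"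
      by (rule smooth_forms_expand[OF \<omega>])
    have 4: "(\<Sum>j<length gs. \<omega> (F x) (us @ g x # ?L[j := frechet_derivative (gs ! j) (at x) v])) =
      (\<Sum>b\<in>Basis. (g x \<bullet> b) *\<^sub>R (\<Sum>j<length gs. \<omega> (F x) (us @ b # ?L[j := frechet_derivative (gs ! j) (at x) v])))"
      unfolding smooth_forms_expand[OF \<omega>, of _ us "g x"] scaleR_sum_right by (rule sum.swap)
    show ?thesis unfolding 1 2 3 4
      by (simp add: sum.distrib scaleR_add_right algebra_simps)
  qed
  ultimately show ?case by (simp only:)
qed

lemma pull_smooth_forms:
  assumes U: "open U" and W: "open W" and F: "smooth_on U F" "\<And>x. x \<in> U \<Longrightarrow> F x \<in> W"
    and \<omega>: "\<omega> \<in> smooth_forms k W"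
  shows "pull U F \<omega> \<in> smooth_forms k U"
  unfolding smooth_forms_iff
proof (intro conjI allI impI)
  show "pull U F \<omega> x = (\<lambda>_. 0)" if "x \<notin> U" for x using that by (auto simp: pull_def)
next
  fix vs
  have "smooth_on U (\<lambda>x. \<omega> (F x) ([] @ map (\<lambda>g. g x) (map (\<lambda>v y. frechet_derivative F (at y) v) vs)))"
    by (rule smooth_on_form_args[OF U W F \<omega>]) (auto intro: smooth_on_frechet[OF F(1)])
  then show "smooth_on U (\<lambda>x. pull U F \<omega> x vs)"
    by (subst smooth_on_cong[OF U]) (auto simp: pull_def o_def)
next
  fix x
  show "alt_form k (pull U F \<omega> x)"
  proof (cases "x \<in> U")
    case False
    then show ?thesis by (simp add: pull_def alt_form_def linear_zero_fun)
  next
    case x: True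
    let ?F = "frechet_derivative F (at x)"
    have lin: "linear ?F" using has_derivative_linear[OF smooth_on_has_derivative[OF F(1) x]] .
    note a = smooth_forms_alt[OF \<omega>, of "F x"]
    have "linear (\<lambda>w. \<omega> (F x) (map ?F (vs[i := w])))" if "i < length vs" for vs i
      using linear_compose[OF lin alt_form_linear[OF a, of "take i (map ?F vs)" "drop (Suc i) (map ?F vs)"]] that
      by (simp add: map_update upd_conv_take_nth_drop o_def take_map drop_map)
    moreover have "\<not> distinct (map ?F vs)" if "\<not> distinct vs" for vs
      using that by (simp add: distinct_map)
    ultimately show ?thesis using x a
      unfolding alt_form_def pull_def by simp
  qed
qed

text \<open>By the product rule the left side is the pulled back derivative plus terms containing a
  second derivative of F. Those cancel in pairs: second derivatives are symmetric and the form is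
  alternating.\<close>

lemma pull_ext_deriv:
  assumes U: "open U" and W: "open W" and F: "smooth_on U F" "\<And>x. x \<in> U \<Longrightarrow> F x \<in> W"
    and \<omega>: "\<omega> \<in> smooth_forms k W"
  shows "ext_deriv U (pull U F \<omega>) = pull U F (ext_deriv W \<omega>)"
proof (intro ext)
  fix x vs
  show "ext_deriv U (pull U F \<omega>) x vs = pull U F (ext_deriv W \<omega>) x vs"
  proof (cases "x \<in> U \<and> vs \<noteq> []")
    case False
    then show ?thesis by (auto simp: ext_deriv_def pull_def)
  next
    case True
    then have x: "x \<in> U" and "\<exists>n. length vs = Suc n" by (cases vs; auto)+
    then obtain n where n: "length vs = Suc n" by blast
    let ?F = "frechet_derivative F (at x)"
    let ?B = "\<lambda>u v. frechet_derivative (\<lambda>y. frechet_derivative F (at y) v) (at x) u"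
    have d: "frechet_derivative (\<lambda>y. pull U F \<omega> y us) (at x) v =
       frechet_derivative (\<lambda>y. \<omega> y (map ?F us)) (at (F x)) (?F v) +
       (\<Sum>j<length us. \<omega> (F x) ((map ?F us)[j := ?B v (us ! j)]))" for us v
    proof -
      let ?gs = "map (\<lambda>v y. frechet_derivative F (at y) v) us"
      have "frechet_derivative (\<lambda>y. pull U F \<omega> y us) (at x) =
          frechet_derivative (\<lambda>y. \<omega> (F y) ([] @ map (\<lambda>g. g y) ?gs)) (at x)"
        by (rule frechet_derivative_cong_open[OF U x]) (simp add: pull_def o_def)
      also have "\<dots> = (\<lambda>v. frechet_derivative (\<lambda>y. \<omega> y ([] @ map (\<lambda>g. g x) ?gs)) (at (F x)) (?F v) +
         (\<Sum>j<length ?gs. \<omega> (F x) ([] @ (map (\<lambda>g. g x) ?gs)[j := frechet_derivative (?gs ! j) (at x) v])))"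
        by (intro frechet_derivative_eqI has_derivative_form_args[OF smooth_on_has_derivative[OF F(1) x] F(2)[OF x] \<omega>])
           (auto intro: smooth_on_has_derivative[OF smooth_on_frechet[OF F(1)] x])
      finally show ?thesis by (simp add: o_def)
    qed
    let ?a = "\<lambda>i j. (-1) ^ i * \<omega> (F x) ((map ?F (omit i vs))[j := ?B (vs ! i) (omit i vs ! j)])"
    have "ext_deriv U (pull U F \<omega>) x vs =
      (\<Sum>i<Suc n. (-1) ^ i * frechet_derivative (\<lambda>y. \<omega> y (map ?F (omit i vs))) (at (F x)) (?F (vs ! i))) +
      (\<Sum>i<Suc n. \<Sum>j<n. ?a i j)"
      unfolding ext_deriv_apply[OF x] d n sum.distrib[symmetric]
      by (intro sum.cong refl) (simp add: length_omit n sum_distrib_left algebra_simps)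
    also have "(\<Sum>i<Suc n. (-1) ^ i * frechet_derivative (\<lambda>y. \<omega> y (map ?F (omit i vs))) (at (F x)) (?F (vs ! i))) =
        pull U F (ext_deriv W \<omega>) x vs"
      using x F(2)[OF x] by (simp add: pull_def ext_deriv_apply n map_omit del: sum.lessThan_Suc)
    also have "(\<Sum>i<Suc n. \<Sum>j<n. ?a i j) = 0"
    proof (rule sum_cancel)
      fix i j assume ij: "i \<le> j" "j < n"
      obtain us ms ws where vs: "vs = us @ vs ! i # ms @ vs ! Suc j # ws" "length us = i" "length ms = j - i"
        using split_two[OF ij(1), of vs] ij n by auto
      let ?b = "?B (vs ! i) (vs ! Suc j)"
      have 1: "omit i vs = us @ ms @ vs ! Suc j # ws"
        using omit_append[of us "vs ! i"] vs by metis
      have 2: "omit (Suc j) vs = us @ vs ! i # ms @ ws"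
        using omit_append[of "us @ vs ! i # ms" "vs ! Suc j" ws] vs ij by simp
      have 3: "omit i vs ! j = vs ! Suc j" "omit (Suc j) vs ! i = vs ! i"
        using ij n by (auto simp: nth_omit)
      have sym: "?B (vs ! Suc j) (vs ! i) = ?b"
        by (rule frechet_derivative_symmetric[OF U F(1) x])
      have 4: "(map ?F (omit i vs))[j := ?b] = map ?F us @ map ?F ms @ ?b # map ?F ws"
        unfolding 1 using vs(2,3) ij(1) by (simp add: list_update_append)
      have 5: "(map ?F (omit (Suc j) vs))[i := ?b] = map ?F us @ ?b # map ?F ms @ map ?F ws"
        unfolding 2 using vs(2,3) ij(1) by (simp add: list_update_append)
      have "(-1) ^ Suc j * (-1) ^ (j - i) = - ((-1) ^ i :: complex)"
      proof -
        have "(-1) ^ j = (-1) ^ i * ((-1) ^ (j - i) :: complex)" using ij(1) by (simp flip: power_add)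
        then show ?thesis by (simp flip: power_mult_distrib)
      qed
      then show "?a i j + ?a (Suc j) i = 0"
        unfolding 3 sym 4 5 alt_form_move[OF smooth_forms_alt[OF \<omega>]] length_map vs(3)
        by (simp only: mult.assoc[symmetric]) simp
    qed
    finally show ?thesis by simp
  qed
qed

section \<open>Cohomology classes and homotopy invariance\<close>

lemma alt_form_add: "alt_form k f \<Longrightarrow> alt_form k g \<Longrightarrow> alt_form k (\<lambda>vs. f vs + g vs)"
  unfolding alt_form_def by (auto intro: linear_compose_add)

lemma alt_form_times: "alt_form k f \<Longrightarrow> alt_form k (\<lambda>vs. c * f vs)"
  unfolding alt_form_def by (auto intro: linear_times)

lemma alt_form_zero: "alt_form k (\<lambda>vs. 0)"
  by (simp add: alt_form_def linear_zero_fun)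

lemma smooth_forms_zero: "0 \<in> smooth_forms k U"
  by (auto simp: smooth_forms_iff zero_fun_def alt_form_zero smooth_on_const)

lemma smooth_forms_add:
  assumes "open U" "\<omega> \<in> smooth_forms k U" "\<eta> \<in> smooth_forms k U"
  shows "\<omega> + \<eta> \<in> smooth_forms k U"
  using assms by (auto simp: smooth_forms_iff plus_fun_def intro: alt_form_add smooth_on_add)

lemma smooth_forms_scale:
  assumes "open U" "\<omega> \<in> smooth_forms k U"
  shows "scale_form c \<omega> \<in> smooth_forms k U"
  using assms
  by (simp add: smooth_forms_iff scale_form_def alt_form_times smooth_on_mult smooth_on_const)

lemma ext_deriv_zero: "ext_deriv U 0 = 0"
  by (auto simp: ext_deriv_def fun_eq_iff)

lemma ext_deriv_add:
  assumes "\<omega> \<in> smooth_forms k U" "\<eta> \<in> smooth_forms k U"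
  shows "ext_deriv U (\<omega> + \<eta>) = ext_deriv U \<omega> + ext_deriv U \<eta>"
proof (intro ext)
  fix x vs
  show "ext_deriv U (\<omega> + \<eta>) x vs = (ext_deriv U \<omega> + ext_deriv U \<eta>) x vs"
  proof (cases "x \<in> U")
    case True
    have "frechet_derivative (\<lambda>y. (\<omega> + \<eta>) y us) (at x) = (\<lambda>v. frechet_derivative (\<lambda>y. \<omega> y us) (at x) v +
        frechet_derivative (\<lambda>y. \<eta> y us) (at x) v)" for us
      unfolding plus_fun_def
      by (intro frechet_derivative_eqI has_derivative_add smooth_forms_has_derivative[OF assms(1)]
          smooth_forms_has_derivative[OF assms(2)] True)
    then show ?thesis using True by (simp add: ext_deriv_apply algebra_simps sum.distrib del: plus_fun_apply) (simp add: ext_deriv_apply)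
  qed (simp add: ext_deriv_def)
qed

lemma ext_deriv_scale:
  assumes "\<omega> \<in> smooth_forms k U"
  shows "ext_deriv U (scale_form c \<omega>) = scale_form c (ext_deriv U \<omega>)"
proof (intro ext)
  fix x vs
  show "ext_deriv U (scale_form c \<omega>) x vs = scale_form c (ext_deriv U \<omega>) x vs"
  proof (cases "x \<in> U")
    case True
    have "frechet_derivative (\<lambda>y. scale_form c \<omega> y us) (at x) = (\<lambda>v. c * frechet_derivative (\<lambda>y. \<omega> y us) (at x) v)" for us
      unfolding scale_form_def
      by (intro frechet_derivative_eqI has_derivative_mult_right smooth_forms_has_derivative[OF assms(1)] True)
    then show ?thesis using True
      by (simp add: ext_deriv_apply scale_form_def[of c "ext_deriv U \<omega>"] sum_distrib_left algebra_simps)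
  qed (simp add: ext_deriv_def scale_form_def)
qed

lemma scale_form_minus: "\<omega> - \<eta> = \<omega> + scale_form (-1) \<eta>"
  by (auto simp: scale_form_def fun_eq_iff)

lemma scale_form_add_right: "scale_form c (\<omega> + \<eta>) = scale_form c \<omega> + scale_form c \<eta>"
  and scale_form_diff_right: "scale_form c (\<omega> - \<eta>) = scale_form c \<omega> - scale_form c \<eta>"
  and scale_form_add_left: "scale_form (c + d) \<omega> = scale_form c \<omega> + scale_form d \<omega>"
  and scale_form_diff_left: "scale_form (c - d) \<omega> = scale_form c \<omega> - scale_form d \<omega>"
  and scale_form_scale: "scale_form c (scale_form d \<omega>) = scale_form (c * d) \<omega>"
  and scale_form_0: "scale_form 0 \<omega> = 0"
  and scale_form_zero: "scale_form c 0 = 0"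
  by (auto simp: scale_form_def fun_eq_iff algebra_simps)

definition form_subspace :: "'a form set \<Rightarrow> bool" where
  "form_subspace V \<longleftrightarrow> 0 \<in> V \<and> (\<forall>x\<in>V. \<forall>y\<in>V. x + y \<in> V) \<and> (\<forall>c. \<forall>x\<in>V. scale_form c x \<in> V)"

lemma form_subspace_0: "form_subspace V \<Longrightarrow> 0 \<in> V"
  and form_subspace_add: "form_subspace V \<Longrightarrow> x \<in> V \<Longrightarrow> y \<in> V \<Longrightarrow> x + y \<in> V"
  and form_subspace_scale: "form_subspace V \<Longrightarrow> x \<in> V \<Longrightarrow> scale_form c x \<in> V"
  unfolding form_subspace_def by blast+

lemma form_subspace_diff: "form_subspace V \<Longrightarrow> x \<in> V \<Longrightarrow> y \<in> V \<Longrightarrow> x - y \<in> V"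
  unfolding scale_form_minus by (intro form_subspace_add form_subspace_scale)

lemma form_subspace_sum: "form_subspace V \<Longrightarrow> (\<And>i. i \<in> I \<Longrightarrow> f i \<in> V) \<Longrightarrow> (\<Sum>i\<in>I. f i) \<in> V"
  by (induction I rule: infinite_finite_induct) (auto intro: form_subspace_0 form_subspace_add)

lemma closed_formsI: "\<omega> \<in> smooth_forms k U \<Longrightarrow> ext_deriv U \<omega> = 0 \<Longrightarrow> \<omega> \<in> closed_forms k U"
  and closed_forms_smooth: "\<omega> \<in> closed_forms k U \<Longrightarrow> \<omega> \<in> smooth_forms k U"
  and closed_forms_ext_deriv: "\<omega> \<in> closed_forms k U \<Longrightarrow> ext_deriv U \<omega> = 0"
  unfolding closed_forms_def by auto

lemma subspace_smooth_forms: "open U \<Longrightarrow> form_subspace (smooth_forms k U)"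
  unfolding form_subspace_def using smooth_forms_zero smooth_forms_add smooth_forms_scale by blast

lemma subspace_closed_forms: "open U \<Longrightarrow> form_subspace (closed_forms k U)"
  unfolding form_subspace_def closed_forms_def
  by (auto simp: smooth_forms_zero smooth_forms_add smooth_forms_scale ext_deriv_zero
      ext_deriv_add ext_deriv_scale scale_form_zero)

lemma subspace_exact_forms:
  assumes "open U" shows "form_subspace (exact_forms k U)"
proof (cases k)
  case 0
  then show ?thesis by (simp add: form_subspace_def exact_forms_def scale_form_zero)
next
  case (Suc l)
  have "0 \<in> ext_deriv U ` smooth_forms l U"
    using ext_deriv_zero smooth_forms_zero by (metis image_eqI)
  moreover have "ext_deriv U \<omega> + ext_deriv U \<eta> \<in> ext_deriv U ` smooth_forms l U"
    if "\<omega> \<in> smooth_forms l U" "\<eta> \<in> smooth_forms l U" for \<omega> \<eta>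
    using ext_deriv_add[OF that] smooth_forms_add[OF assms that] by (metis image_eqI)
  moreover have "scale_form c (ext_deriv U \<omega>) \<in> ext_deriv U ` smooth_forms l U"
    if "\<omega> \<in> smooth_forms l U" for \<omega> c
    using ext_deriv_scale[OF that] smooth_forms_scale[OF assms that] by (metis image_eqI)
  ultimately show ?thesis unfolding form_subspace_def Suc exact_forms_def by auto
qed

lemma exact_forms_closed: "open U \<Longrightarrow> \<omega> \<in> exact_forms k U \<Longrightarrow> \<omega> \<in> closed_forms k U"
  by (cases k) (auto simp: exact_forms_def form_subspace_0[OF subspace_closed_forms]
      intro!: closed_formsI ext_deriv_smooth_forms ext_deriv_ext_deriv)

lemma pull_zero: "pull U F 0 = 0"
  by (auto simp: pull_def fun_eq_iff)

lemma pull_closed: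
  assumes "open U" "open W" "smooth_on U F" "\<And>x. x \<in> U \<Longrightarrow> F x \<in> W" "\<omega> \<in> closed_forms k W"
  shows "pull U F \<omega> \<in> closed_forms k U"
  using pull_ext_deriv[OF assms(1-4) closed_forms_smooth[OF assms(5)]]
    pull_smooth_forms[OF assms(1-4) closed_forms_smooth[OF assms(5)]]
  by (intro closed_formsI) (simp_all only: closed_forms_ext_deriv[OF assms(5)] pull_zero)

lemma pull_exact:
  assumes "open U" "open W" "smooth_on U F" "\<And>x. x \<in> U \<Longrightarrow> F x \<in> W" "\<omega> \<in> exact_forms k W"
  shows "pull U F \<omega> \<in> exact_forms k U"
proof (cases k)
  case 0
  then show ?thesis using assms(5) by (simp add: exact_forms_def pull_zero)
next
  case (Suc l)
  then obtain \<eta> where \<eta>: "\<eta> \<in> smooth_forms l W" "\<omega> = ext_deriv W \<eta>"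
    using assms(5) by (auto simp: exact_forms_def)
  have "pull U F \<omega> = ext_deriv U (pull U F \<eta>)"
    unfolding \<eta>(2) using pull_ext_deriv[OF assms(1-4) \<eta>(1)] by simp
  then show ?thesis
    using pull_smooth_forms[OF assms(1-4) \<eta>(1)] Suc by (auto simp: exact_forms_def)
qed

lemma pull_pull:
  assumes "open U" "smooth_on U G" "\<And>x. x \<in> U \<Longrightarrow> G x \<in> W" "smooth_on W F"
  shows "pull U G (pull W F \<omega>) = pull U (\<lambda>x. F (G x)) \<omega>"
proof (intro ext)
  fix x vs
  show "pull U G (pull W F \<omega>) x vs = pull U (\<lambda>x. F (G x)) \<omega> x vs"
  proof (cases "x \<in> U")
    case True
    have "frechet_derivative (\<lambda>x. F (G x)) (at x) =
       (\<lambda>v. frechet_derivative F (at (G x)) (frechet_derivative G (at x) v))"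
      by (intro frechet_derivative_eqI has_derivative_compose[OF smooth_on_has_derivative[OF assms(2)]
            smooth_on_has_derivative[OF assms(4)]] True assms(3))
    then show ?thesis using True assms(3) by (simp add: pull_def o_def)
  qed (simp add: pull_def)
qed

lemma pull_cong:
  assumes "open U" "\<And>x. x \<in> U \<Longrightarrow> F x = G x"
  shows "pull U F \<omega> = pull U G \<omega>"
  using frechet_derivative_cong_open[OF assms(1) _ assms(2)] assms(2)
  by (auto simp: pull_def fun_eq_iff cong: map_cong)

section \<open>Restriction to open subsets, and homotopies\<close>

definition res :: "'a set \<Rightarrow> 'a form \<Rightarrow> 'a form" where
  "res U \<omega> = (\<lambda>x vs. if x \<in> U then \<omega> x vs else 0)"

lemma res_eq_pull: "res U \<omega> = pull U (\<lambda>x. x) \<omega>"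
  by (auto simp: res_def pull_def fun_eq_iff)

lemma res_add: "res U (\<omega> + \<eta>) = res U \<omega> + res U \<eta>"
  and res_diff: "res U (\<omega> - \<eta>) = res U \<omega> - res U \<eta>"
  and res_scale: "res U (scale_form c \<omega>) = scale_form c (res U \<omega>)"
  and res_zero: "res U 0 = 0"
  and res_res: "U \<subseteq> W \<Longrightarrow> res U (res W \<omega>) = res U \<omega>"
  by (auto simp: res_def fun_eq_iff scale_form_def)

lemma res_sum: "res U (\<Sum>i\<in>I. f i) = (\<Sum>i\<in>I. res U (f i))"
  by (induction I rule: infinite_finite_induct)
     (simp_all only: sum.infinite sum.empty sum.insert not_False_eq_True res_zero res_add)

lemma res_id: "\<omega> \<in> smooth_forms k U \<Longrightarrow> res U \<omega> = \<omega>"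
  by (auto simp: res_def fun_eq_iff smooth_forms_outside)

lemma res_smooth_forms: "open U \<Longrightarrow> open W \<Longrightarrow> U \<subseteq> W \<Longrightarrow> \<omega> \<in> smooth_forms k W \<Longrightarrow> res U \<omega> \<in> smooth_forms k U"
  unfolding res_eq_pull by (rule pull_smooth_forms) (auto intro: smooth_on_id)

lemma res_closed: "open U \<Longrightarrow> open W \<Longrightarrow> U \<subseteq> W \<Longrightarrow> \<omega> \<in> closed_forms k W \<Longrightarrow> res U \<omega> \<in> closed_forms k U"
  unfolding res_eq_pull by (rule pull_closed) (auto intro: smooth_on_id)

lemma res_exact: "open U \<Longrightarrow> open W \<Longrightarrow> U \<subseteq> W \<Longrightarrow> \<omega> \<in> exact_forms k W \<Longrightarrow> res U \<omega> \<in> exact_forms k U"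
  unfolding res_eq_pull by (rule pull_exact) (auto intro: smooth_on_id)

lemma ext_deriv_res:
  "open U \<Longrightarrow> open W \<Longrightarrow> U \<subseteq> W \<Longrightarrow> \<omega> \<in> smooth_forms k W \<Longrightarrow> ext_deriv U (res U \<omega>) = res U (ext_deriv W \<omega>)"
  unfolding res_eq_pull by (rule pull_ext_deriv) (auto intro: smooth_on_id)

text \<open>Integration along the fibre of U x [0,1]. The fibre direction enters as the first
  argument, which fixes the signs of the homotopy formula.\<close>

definition fiber_integral :: "'a::euclidean_space set \<Rightarrow> ('a \<times> real) form \<Rightarrow> 'a form" where
  "fiber_integral U \<eta> = (\<lambda>x vs. if x \<in> U
     then integral {0..1} (\<lambda>t. \<eta> (x, t) ((0, 1) # map (\<lambda>v. (v, 0)) vs)) else 0)"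

lemma smooth_on_slice_integrable:
  fixes g :: "'a::euclidean_space \<times> real \<Rightarrow> 'b::euclidean_space"
  assumes "smooth_on (U \<times> UNIV) g" "x \<in> U"
  shows "(\<lambda>t. g (x, t)) integrable_on {0..1}"
  by (rule integrable_continuous_real, rule continuous_on_compose2[OF smooth_on_continuous[OF assms(1)]])
     (use assms in \<open>auto intro!: continuous_intros\<close>)

lemma fiber_integral_smooth_forms:
  fixes U :: "'a::euclidean_space set"
  assumes U: "open U" and \<eta>: "\<eta> \<in> smooth_forms (Suc k) (U \<times> UNIV)"
  shows "fiber_integral U \<eta> \<in> smooth_forms k U"
  unfolding smooth_forms_iff
proof (intro conjI allI impI)
  show "fiber_integral U \<eta> x = (\<lambda>_. 0)" if "x \<notin> U" for x using that by (auto simp: fiber_integral_def)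
next
  fix vs
  have "smooth_on U (\<lambda>x. integral {0..1} (\<lambda>t. \<eta> (x, t) ((0, 1) # map (\<lambda>v. (v, 0)) vs)))"
    by (rule smooth_on_integral[OF U smooth_forms_smooth[OF \<eta>]])
  then show "smooth_on U (\<lambda>x. fiber_integral U \<eta> x vs)"
    by (subst smooth_on_cong[OF U]) (auto simp: fiber_integral_def)
next
  fix x
  let ?E = "map (\<lambda>v::'a. (v, 0::real))"
  note a = smooth_forms_alt[OF \<eta>]
  show "alt_form k (fiber_integral U \<eta> x)"
  proof (cases "x \<in> U")
    case False
    then show ?thesis by (simp add: fiber_integral_def alt_form_zero)
  next
    case x: True
    show ?thesis unfolding alt_form_def
    proof (intro conjI allI impI)
      fix vs :: "'a list" assume "length vs \<noteq> k"
      then have "\<eta> (x, t) ((0, 1) # ?E vs) = 0" for t by (intro alt_form_length[OF a]) auto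
      then show "fiber_integral U \<eta> x vs = 0" by (simp add: fiber_integral_def)
    next
      fix vs :: "'a list" assume "\<not> distinct vs"
      then have "\<eta> (x, t) ((0, 1) # ?E vs) = 0" for t
        by (intro alt_form_distinct[OF a]) (auto simp: distinct_map)
      then show "fiber_integral U \<eta> x vs = 0" by (simp add: fiber_integral_def)
    next
      fix vs :: "'a list" and i assume "length vs = k" "i < k"
      then have eq: "(0, 1) # ?E (vs[i := w]) = ((0, 1) # take i (?E vs)) @ (w, 0) # drop (Suc i) (?E vs)" for w
        by (simp add: map_update upd_conv_take_nth_drop take_map drop_map)
      have lin: "linear (\<lambda>w. \<eta> (x, t) ((0, 1) # ?E (vs[i := w])))" for t
        unfolding eq
        using linear_compose[OF _ alt_form_linear[OF a[of "(x, t)"], of "(0, 1) # take i (?E vs)" "drop (Suc i) (?E vs)"],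
            of "\<lambda>w. (w, 0)"]
        by (simp add: o_def linear_iff)
      have int: "(\<lambda>t. \<eta> (x, t) us) integrable_on {0..1}" for us
        by (rule smooth_on_slice_integrable[OF smooth_forms_smooth[OF \<eta>] x])
      show "linear (\<lambda>w. fiber_integral U \<eta> x (vs[i := w]))"
        by (rule linearI) (use x in \<open>simp_all add: fiber_integral_def linear_add[OF lin] linear_scale[OF lin]
            integral_add int\<close>)
    qed
  qed
qed

text \<open>In the derivative on the product, omitting the leading fibre vector gives a
  t-derivative, whose integral is the boundary term. Every other omission is shifted by one position
  and so has the sign opposite to its counterpart in the derivative of the fibre integral.\<close>

lemma fiber_integral_ext_deriv:
  fixes U :: "'a::euclidean_space set"
  assumes U: "open U" and \<eta>: "\<eta> \<in> smooth_forms k (U \<times> UNIV)"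
  shows "ext_deriv U (fiber_integral U \<eta>) + fiber_integral U (ext_deriv (U \<times> UNIV) \<eta>) =
    pull U (\<lambda>x. (x, 1)) \<eta> - pull U (\<lambda>x. (x, 0)) \<eta>"
proof (intro ext)
  fix x :: 'a and vs :: "'a list"
  let ?E = "map (\<lambda>v::'a. (v, 0::real))"
  show "(ext_deriv U (fiber_integral U \<eta>) + fiber_integral U (ext_deriv (U \<times> UNIV) \<eta>)) x vs =
    (pull U (\<lambda>x. (x, 1)) \<eta> - pull U (\<lambda>x. (x, 0)) \<eta>) x vs"
  proof (cases "x \<in> U")
    case False
    then show ?thesis by (simp add: ext_deriv_def fiber_integral_def pull_def)
  next
    case x: True
    let ?D = "\<lambda>us t v. frechet_derivative (\<lambda>y. \<eta> y us) (at (x, t)) v"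
    note sm = smooth_forms_smooth[OF \<eta>]
    have int: "(\<lambda>t. ?D us t v) integrable_on {0..1}" for us v
      by (rule smooth_on_slice_integrable[OF smooth_on_frechet[OF sm] x])
    have "frechet_derivative (\<lambda>x. (x, c)) (at x) = (\<lambda>v. (v, 0))" for c :: real
      by (intro frechet_derivative_eqI) (auto intro!: derivative_eq_intros)
    then have pull: "pull U (\<lambda>x. (x, c)) \<eta> x vs = \<eta> (x, c) (?E vs)" for c
      using x by (simp add: pull_def)
    have d: "frechet_derivative (\<lambda>y. fiber_integral U \<eta> y us) (at x) v =
        integral {0..1} (\<lambda>t. ?D ((0, 1) # ?E us) t (v, 0))" for us v
    proof -
      have "frechet_derivative (\<lambda>y. fiber_integral U \<eta> y us) (at x) =
         frechet_derivative (\<lambda>y. integral {0..1} (\<lambda>t. \<eta> (y, t) ((0, 1) # ?E us))) (at x)"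
        by (rule frechet_derivative_cong_open[OF U x]) (simp add: fiber_integral_def)
      also have "\<dots> = (\<lambda>v. integral {0..1} (\<lambda>t. ?D ((0, 1) # ?E us) t (v, 0)))"
        by (rule frechet_derivative_eqI[OF has_derivative_integral[OF U sm x]])
      finally show ?thesis by simp
    qed
    have hv: "((\<lambda>t. \<eta> (x, t) (?E vs)) has_vector_derivative ?D (?E vs) t (0, 1)) (at t)" for t
    proof -
      have D: "((\<lambda>y. \<eta> y (?E vs)) has_derivative ?D (?E vs) t) (at (x, t))"
        by (rule smooth_on_has_derivative[OF sm]) (use x in auto)
      have "((\<lambda>t. (x, t)) has_derivative (\<lambda>h. (0, h))) (at t)" by (auto intro!: derivative_eq_intros)
      from has_derivative_compose[OF this D]
      have "((\<lambda>t. \<eta> (x, t) (?E vs)) has_derivative (\<lambda>h. ?D (?E vs) t (0, h))) (at t)" .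
      moreover have "?D (?E vs) t (0, h) = h *\<^sub>R ?D (?E vs) t (0, 1)" for h
        using linear_scale[OF has_derivative_linear[OF D], of h "(0, 1)"] by simp
      then have "(\<lambda>h. ?D (?E vs) t (0, h)) = (\<lambda>h. h *\<^sub>R ?D (?E vs) t (0, 1))" by blast
      ultimately show ?thesis unfolding has_vector_derivative_def by metis
    qed
    have "((\<lambda>t. ?D (?E vs) t (0, 1)) has_integral \<eta> (x, 1) (?E vs) - \<eta> (x, 0) (?E vs)) {0..1}"
      by (rule fundamental_theorem_of_calculus[OF _ has_vector_derivative_at_within[OF hv]]) simp
    then have ftc: "integral {0..1} (\<lambda>t. ?D (?E vs) t (0, 1)) = \<eta> (x, 1) (?E vs) - \<eta> (x, 0) (?E vs)"
      by (rule integral_unique)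
    have "fiber_integral U (ext_deriv (U \<times> UNIV) \<eta>) x vs =
       integral {0..1} (\<lambda>t. ?D (?E vs) t (0, 1) - (\<Sum>i<length vs. (-1) ^ i * ?D ((0, 1) # ?E (omit i vs)) t (vs ! i, 0)))"
      using x by (simp add: fiber_integral_def ext_deriv_apply sum.lessThan_Suc_shift omit_0 omit_Suc map_omit
          sum_negf del: sum.lessThan_Suc)
    also have "\<dots> = (\<eta> (x, 1) (?E vs) - \<eta> (x, 0) (?E vs)) -
       (\<Sum>i<length vs. (-1) ^ i * integral {0..1} (\<lambda>t. ?D ((0, 1) # ?E (omit i vs)) t (vs ! i, 0)))"
      by (simp add: integral_diff integral_sum integrable_sum int integrable_on_cmult_left ftc
          integral_mult_right)
    finally show ?thesis using x by (simp add: pull ext_deriv_apply d)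
  qed
qed

lemma homotopy_exact:
  fixes H :: "'a::euclidean_space \<times> real \<Rightarrow> 'b::euclidean_space"
  assumes U: "open U" and W: "open W" and H: "smooth_on (U \<times> UNIV) H" "\<And>x t. x \<in> U \<Longrightarrow> H (x, t) \<in> W"
    and \<omega>: "\<omega> \<in> closed_forms k W"
  shows "pull U (\<lambda>x. H (x, 1)) \<omega> - pull U (\<lambda>x. H (x, 0)) \<omega> \<in> exact_forms k U"
proof -
  define \<eta> where "\<eta> = pull (U \<times> UNIV) H \<omega>"
  have o: "open (U \<times> (UNIV :: real set))" using U by (simp add: open_Times)
  have \<eta>: "\<eta> \<in> closed_forms k (U \<times> UNIV)"
    unfolding \<eta>_def by (rule pull_closed[OF o W H(1) _ \<omega>]) (auto intro: H(2))
  have "pull U (\<lambda>x. (x, c)) \<eta> = pull U (\<lambda>x. H (x, c)) \<omega>" for c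
    unfolding \<eta>_def
    by (rule pull_pull) (auto intro: U H smooth_on_Pair smooth_on_id smooth_on_const)
  moreover have "fiber_integral U 0 = 0" by (auto simp: fiber_integral_def fun_eq_iff)
  ultimately have eq: "pull U (\<lambda>x. H (x, 1)) \<omega> - pull U (\<lambda>x. H (x, 0)) \<omega> = ext_deriv U (fiber_integral U \<eta>)"
    using fiber_integral_ext_deriv[OF U closed_forms_smooth[OF \<eta>]] closed_forms_ext_deriv[OF \<eta>]
    by (simp only: add_0_right)
  show ?thesis
  proof (cases k)
    case 0
    \<comment> \<open>In degree 0 the zero form alone is exact. The fibre integral evaluates a
      0-form on a nonempty list, hence is 0, and the two pullbacks coincide.\<close>
    have "\<eta> (x, t) (v # vs) = 0" for x t v vs
      using alt_form_length[OF smooth_forms_alt[OF closed_forms_smooth[OF \<eta>]]] 0 by auto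
    then have "fiber_integral U \<eta> = 0" by (auto simp: fiber_integral_def fun_eq_iff)
    then show ?thesis using 0 by (simp add: eq ext_deriv_zero exact_forms_def)
  next
    case (Suc l)
    then show ?thesis
      using fiber_integral_smooth_forms[OF U, of \<eta> l] closed_forms_smooth[OF \<eta>]
      by (auto simp: eq exact_forms_def)
  qed
qed

section \<open>Gluing and the Mayer-Vietoris decomposition\<close>

lemma form_subspace_cancel: "form_subspace W \<Longrightarrow> x \<in> W \<Longrightarrow> x - y \<in> W \<Longrightarrow> y \<in> W"
  using form_subspace_diff[of W x "x - y"] by simp

lemma ext_deriv_diff:
  assumes "open U" "\<omega> \<in> smooth_forms k U" "\<eta> \<in> smooth_forms k U"
  shows "ext_deriv U (\<omega> - \<eta>) = ext_deriv U \<omega> - ext_deriv U \<eta>"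
  unfolding scale_form_minus ext_deriv_add[OF assms(2) smooth_forms_scale[OF assms(1,3)]]
    ext_deriv_scale[OF assms(3)] ..

lemma ext_deriv_sum:
  assumes U: "open U" and "\<And>i. i \<in> I \<Longrightarrow> f i \<in> smooth_forms k U"
  shows "ext_deriv U (\<Sum>i\<in>I. scale_form (c i) (f i)) = (\<Sum>i\<in>I. scale_form (c i) (ext_deriv U (f i)))"
  using assms(2)
proof (induction I rule: infinite_finite_induct)
  case (insert i I)
  have fi: "f i \<in> smooth_forms k U" using insert by blast
  have "(\<Sum>i\<in>I. scale_form (c i) (f i)) \<in> smooth_forms k U"
    using insert by (intro form_subspace_sum[OF subspace_smooth_forms[OF U]] smooth_forms_scale U) auto
  then have *: "ext_deriv U (scale_form (c i) (f i) + (\<Sum>i\<in>I. scale_form (c i) (f i))) =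
      scale_form (c i) (ext_deriv U (f i)) + ext_deriv U (\<Sum>i\<in>I. scale_form (c i) (f i))"
    by (simp only: ext_deriv_add[OF smooth_forms_scale[OF U fi]] ext_deriv_scale[OF fi])
  have IH: "ext_deriv U (\<Sum>i\<in>I. scale_form (c i) (f i)) = (\<Sum>i\<in>I. scale_form (c i) (ext_deriv U (f i)))"
    using insert by blast
  show ?case by (simp only: sum.insert[OF insert(1,2)] * IH)
qed (simp_all only: sum.infinite sum.empty not_False_eq_True ext_deriv_zero)

lemma forms_eqI:
  assumes "\<omega> \<in> smooth_forms k (A \<union> B)" "\<eta> \<in> smooth_forms k (A \<union> B)"
    and "res A \<omega> = res A \<eta>" "res B \<omega> = res B \<eta>"
  shows "\<omega> = \<eta>"
proof (intro ext)
  fix x vs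
  have "\<omega> x vs = \<eta> x vs" if "x \<in> A" using fun_cong[OF fun_cong[OF assms(3)], of x vs] that by (simp add: res_def)
  moreover have "\<omega> x vs = \<eta> x vs" if "x \<in> B" using fun_cong[OF fun_cong[OF assms(4)], of x vs] that by (simp add: res_def)
  moreover have "\<omega> x vs = \<eta> x vs" if "x \<notin> A \<union> B"
    using smooth_forms_outside[OF assms(1) that] smooth_forms_outside[OF assms(2) that] by simp
  ultimately show "\<omega> x vs = \<eta> x vs" by blast
qed

lemma glue_smooth:
  assumes A: "open A" and B: "open B" and \<alpha>: "\<alpha> \<in> smooth_forms k A" and \<beta>: "\<beta> \<in> smooth_forms k B"
    and eq: "res (A \<inter> B) \<alpha> = res (A \<inter> B) \<beta>"
  obtains \<omega> where "\<omega> \<in> smooth_forms k (A \<union> B)" "res A \<omega> = \<alpha>" "res B \<omega> = \<beta>"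
proof -
  define \<omega> where "\<omega> = (\<lambda>x vs. if x \<in> A then \<alpha> x vs else \<beta> x vs)"
  have a: "\<omega> x = \<alpha> x" if "x \<in> A" for x using that by (simp add: \<omega>_def)
  have b: "\<omega> x = \<beta> x" if "x \<in> B" for x
  proof (cases "x \<in> A")
    case True
    then show ?thesis using fun_cong[OF eq, of x] that by (simp add: \<omega>_def res_def)
  qed (simp add: \<omega>_def)
  have "\<omega> \<in> smooth_forms k (A \<union> B)"
    unfolding smooth_forms_iff
  proof (intro conjI allI impI)
    show "\<omega> x = (\<lambda>_. 0)" if "x \<notin> A \<union> B" for x
      using that smooth_forms_outside[OF \<beta>] by (auto simp: \<omega>_def)
    show "alt_form k (\<omega> x)" for x
      using smooth_forms_alt[OF \<alpha>, of x] smooth_forms_alt[OF \<beta>, of x] by (cases "x \<in> A") (simp_all add: \<omega>_def)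
    show "smooth_on (A \<union> B) (\<lambda>x. \<omega> x vs)" for vs
      by (rule smooth_on_Un[OF A B])
         (use smooth_forms_smooth[OF \<alpha>, of vs] smooth_forms_smooth[OF \<beta>, of vs] in
           \<open>simp_all add: smooth_on_cong[OF A, of "\<lambda>x. \<omega> x vs" "\<lambda>x. \<alpha> x vs"]
              smooth_on_cong[OF B, of "\<lambda>x. \<omega> x vs" "\<lambda>x. \<beta> x vs"] a b\<close>)
  qed
  moreover have "res A \<omega> = \<alpha>"
    by (auto simp: res_def fun_eq_iff a smooth_forms_outside[OF \<alpha>])
  moreover have "res B \<omega> = \<beta>"
    by (auto simp: res_def fun_eq_iff b smooth_forms_outside[OF \<beta>])
  ultimately show thesis by (rule that)
qed

lemma glue_closed:
  assumes A: "open A" and B: "open B" and \<alpha>: "\<alpha> \<in> closed_forms k A" and \<beta>: "\<beta> \<in> closed_forms k B"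
    and eq: "res (A \<inter> B) \<alpha> = res (A \<inter> B) \<beta>"
  obtains \<omega> where "\<omega> \<in> closed_forms k (A \<union> B)" "res A \<omega> = \<alpha>" "res B \<omega> = \<beta>"
proof -
  obtain \<omega> where \<omega>: "\<omega> \<in> smooth_forms k (A \<union> B)" "res A \<omega> = \<alpha>" "res B \<omega> = \<beta>"
    using glue_smooth[OF A B closed_forms_smooth[OF \<alpha>] closed_forms_smooth[OF \<beta>] eq] by metis
  have "res A (ext_deriv (A \<union> B) \<omega>) = 0" "res B (ext_deriv (A \<union> B) \<omega>) = 0"
    using ext_deriv_res[OF _ _ _ \<omega>(1), of A] ext_deriv_res[OF _ _ _ \<omega>(1), of B] A B
      closed_forms_ext_deriv[OF \<alpha>] closed_forms_ext_deriv[OF \<beta>] \<omega> by (simp_all add: open_Un)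
  then have "ext_deriv (A \<union> B) \<omega> = 0"
    by (intro forms_eqI[OF ext_deriv_smooth_forms[OF open_Un[OF A B] \<omega>(1)] smooth_forms_zero])
       (simp_all only: res_zero)
  then show thesis using that \<omega> closed_formsI by blast
qed

text \<open>Sign data for \<open>smooth_cutoff\<close> on the cover by A and B. Strict negativity
  makes the set b < 0 an open neighbourhood of A - B, so a form on A \<inter> B multiplied by a
  factor vanishing on that set extends by 0 to a smooth form on A; likewise with a and B.\<close>

definition cutoff :: "'a::euclidean_space set \<Rightarrow> 'a set \<Rightarrow> bool" where
  "cutoff A B \<longleftrightarrow> (\<exists>(a :: 'a \<Rightarrow> real) (b :: 'a \<Rightarrow> real). smooth_on (A \<union> B) a \<and> smooth_on (A \<union> B) b \<and>
     (\<forall>x\<in>A \<union> B. a x > 0 \<or> b x > 0) \<and> (\<forall>x\<in>B - A. a x < 0) \<and> (\<forall>x\<in>A - B. b x < 0))"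

lemma smooth_form_times:
  assumes A: "open A" and B: "open B" and \<gamma>: "\<gamma> \<in> smooth_forms k (A \<inter> B)"
    and \<psi>: "smooth_on A \<psi>" and b: "smooth_on A (b :: 'a::euclidean_space \<Rightarrow> real)"
    and "\<And>x. x \<in> A - B \<Longrightarrow> b x < 0" and z: "\<And>x. x \<in> A \<Longrightarrow> b x \<le> 0 \<Longrightarrow> \<psi> x = 0"
  shows "(\<lambda>x vs. \<psi> x * \<gamma> x vs) \<in> smooth_forms k A"
  unfolding smooth_forms_iff
proof (intro conjI allI impI)
  show "(\<lambda>vs. \<psi> x * \<gamma> x vs) = (\<lambda>_. 0)" if "x \<notin> A" for x
    using that smooth_forms_outside[OF \<gamma>] by auto
  show "alt_form k (\<lambda>vs. \<psi> x * \<gamma> x vs)" for x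
    by (rule alt_form_times[OF smooth_forms_alt[OF \<gamma>]])
  fix vs
  let ?N = "{x \<in> A. b x < 0}"
  have N: "open ?N"
    using continuous_open_preimage[OF smooth_on_continuous[OF b] A, of "{..<0}"] by (simp add: vimage_def Int_def)
  have "smooth_on ((A \<inter> B) \<union> ?N) (\<lambda>x. \<psi> x * \<gamma> x vs)"
  proof (rule smooth_on_Un[OF open_Int[OF A B] N])
    show "smooth_on (A \<inter> B) (\<lambda>x. \<psi> x * \<gamma> x vs)"
      using smooth_on_subset[OF \<psi>, of "A \<inter> B"]
      by (intro smooth_on_mult open_Int A B smooth_forms_smooth[OF \<gamma>]) auto
    show "smooth_on ?N (\<lambda>x. \<psi> x * \<gamma> x vs)"
      by (subst smooth_on_cong[OF N, of _ "\<lambda>x. 0"]) (auto simp: z smooth_on_const)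
  qed
  moreover have "(A \<inter> B) \<union> ?N = A" using assms(6) by auto
  ultimately show "smooth_on A (\<lambda>x. \<psi> x * \<gamma> x vs)" by simp
qed

text \<open>Surjectivity in the Mayer-Vietoris sequence: \<phi> is 0 near B - A and 1 near A - B, so
  (1 - \<phi>) \<gamma> extends to A and - \<phi> \<gamma> to B.\<close>

lemma mv_split:
  assumes A: "open A" and B: "open B" and c: "cutoff A B" and \<gamma>: "\<gamma> \<in> smooth_forms k (A \<inter> B)"
  obtains \<alpha> \<beta> where "\<alpha> \<in> smooth_forms k A" "\<beta> \<in> smooth_forms k B" "\<gamma> = res (A \<inter> B) \<alpha> - res (A \<inter> B) \<beta>"
proof -
  from c obtain a :: "'a \<Rightarrow> real" and b :: "'a \<Rightarrow> real" where ab: "smooth_on (A \<union> B) a" "smooth_on (A \<union> B) b"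
     "\<And>x. x \<in> A \<union> B \<Longrightarrow> a x > 0 \<or> b x > 0" "\<And>x. x \<in> B - A \<Longrightarrow> a x < 0" "\<And>x. x \<in> A - B \<Longrightarrow> b x < 0"
    unfolding cutoff_def by blast
  obtain \<phi> :: "'a \<Rightarrow> real" where \<phi>: "smooth_on (A \<union> B) \<phi>" "\<And>x. x \<in> A \<union> B \<Longrightarrow> a x \<le> 0 \<Longrightarrow> \<phi> x = 0"
    "\<And>x. x \<in> A \<union> B \<Longrightarrow> b x \<le> 0 \<Longrightarrow> \<phi> x = 1"
    using smooth_cutoff[OF open_Un[OF A B] ab(1-3)] by metis
  have s: "smooth_on A \<phi>" "smooth_on B \<phi>" "smooth_on A b" "smooth_on B a"
    using \<phi>(1) ab smooth_on_subset by blast+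
  show thesis
  proof (rule that)
    show "(\<lambda>x vs. complex_of_real (1 - \<phi> x) * \<gamma> x vs) \<in> smooth_forms k A"
      by (rule smooth_form_times[OF A B \<gamma> _ s(3) ab(5)])
         (use s \<phi> A in \<open>auto intro!: smooth_intros\<close>)
    have \<gamma>': "\<gamma> \<in> smooth_forms k (B \<inter> A)" using \<gamma> by (simp add: Int_commute)
    show "(\<lambda>x vs. complex_of_real (- \<phi> x) * \<gamma> x vs) \<in> smooth_forms k B"
      by (rule smooth_form_times[OF B A \<gamma>' _ s(4) ab(4)])
         (use s \<phi> B in \<open>auto intro!: smooth_on_of_real smooth_on_minus\<close>)
    show "\<gamma> = res (A \<inter> B) (\<lambda>x vs. complex_of_real (1 - \<phi> x) * \<gamma> x vs) -
        res (A \<inter> B) (\<lambda>x vs. complex_of_real (- \<phi> x) * \<gamma> x vs)"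
      using smooth_forms_outside[OF \<gamma>] by (auto simp: fun_eq_iff res_def algebra_simps)
  qed
qed

text \<open>A primitive is split and the pieces are differentiated. This is how forms that agree on
  A \<inter> B only up to an exact form are corrected by exact forms until they agree there and can
  be glued.\<close>

lemma mv_split_exact:
  assumes A: "open A" and B: "open B" and c: "cutoff A B" and \<gamma>: "\<gamma> \<in> exact_forms k (A \<inter> B)"
  obtains \<alpha> \<beta> where "\<alpha> \<in> exact_forms k A" "\<beta> \<in> exact_forms k B" "\<gamma> = res (A \<inter> B) \<alpha> - res (A \<inter> B) \<beta>"
proof (cases k)
  case 0
  then have "\<gamma> = res (A \<inter> B) 0 - res (A \<inter> B) 0" using \<gamma> by (simp add: exact_forms_def)
  then show thesis
    using that[of 0 0] form_subspace_0[OF subspace_exact_forms] A B by blast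
next
  case (Suc l)
  then obtain \<eta> where \<eta>: "\<eta> \<in> smooth_forms l (A \<inter> B)" "\<gamma> = ext_deriv (A \<inter> B) \<eta>"
    using \<gamma> by (auto simp: exact_forms_def)
  obtain \<alpha> \<beta> where s: "\<alpha> \<in> smooth_forms l A" "\<beta> \<in> smooth_forms l B" "\<eta> = res (A \<inter> B) \<alpha> - res (A \<inter> B) \<beta>"
    using mv_split[OF A B c \<eta>(1)] by metis
  have "\<gamma> = ext_deriv (A \<inter> B) (res (A \<inter> B) \<alpha>) - ext_deriv (A \<inter> B) (res (A \<inter> B) \<beta>)"
    unfolding \<eta>(2) s(3) using A B
    by (intro ext_deriv_diff[of _ _ l] res_smooth_forms[OF _ _ _ s(1)] res_smooth_forms[OF _ _ _ s(2)]) auto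
  also have "\<dots> = res (A \<inter> B) (ext_deriv A \<alpha>) - res (A \<inter> B) (ext_deriv B \<beta>)"
    using ext_deriv_res[OF _ A _ s(1), of "A \<inter> B"] ext_deriv_res[OF _ B _ s(2), of "A \<inter> B"] A B
    by (simp add: open_Int)
  finally show thesis using that s Suc by (auto simp: exact_forms_def)
qed

lemma exact_disjoint_Un:
  assumes A: "open A" and B: "open B" and dis: "A \<inter> B = {}" and \<gamma>: "\<gamma> \<in> smooth_forms k (A \<union> B)"
    and eA: "res A \<gamma> \<in> exact_forms k A" and eB: "res B \<gamma> \<in> exact_forms k B"
  shows "\<gamma> \<in> exact_forms k (A \<union> B)"
proof (cases k)
  case 0
  then have "res A \<gamma> = res A 0" "res B \<gamma> = res B 0" using eA eB by (simp_all add: exact_forms_def res_zero)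
  from forms_eqI[OF \<gamma> smooth_forms_zero this] show ?thesis using 0 by (simp add: exact_forms_def)
next
  case (Suc l)
  then obtain \<alpha> \<beta> where s: "\<alpha> \<in> smooth_forms l A" "res A \<gamma> = ext_deriv A \<alpha>"
    "\<beta> \<in> smooth_forms l B" "res B \<gamma> = ext_deriv B \<beta>"
    using eA eB by (auto simp: exact_forms_def)
  have "res (A \<inter> B) \<alpha> = res (A \<inter> B) \<beta>" by (simp add: dis res_def)
  from glue_smooth[OF A B s(1,3) this] obtain \<omega> where
    \<omega>: "\<omega> \<in> smooth_forms l (A \<union> B)" "res A \<omega> = \<alpha>" "res B \<omega> = \<beta>" by metis
  have "\<gamma> = ext_deriv (A \<union> B) \<omega>"
  proof (rule forms_eqI[OF \<gamma>])
    show "ext_deriv (A \<union> B) \<omega> \<in> smooth_forms k (A \<union> B)"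
      unfolding Suc by (rule ext_deriv_smooth_forms[OF open_Un[OF A B] \<omega>(1)])
    show "res A \<gamma> = res A (ext_deriv (A \<union> B) \<omega>)"
      using ext_deriv_res[OF A open_Un[OF A B] Un_upper1 \<omega>(1)] \<omega>(2) s(2) by metis
    show "res B \<gamma> = res B (ext_deriv (A \<union> B) \<omega>)"
      using ext_deriv_res[OF B open_Un[OF A B] Un_upper2 \<omega>(1)] \<omega>(3) s(4) by metis
  qed
  then show ?thesis using \<omega>(1) Suc by (auto simp: exact_forms_def)
qed

text \<open>U is invariant for all times, so the time-one map from T to U is inverse to the
  inclusion up to homotopy both in T and in U. Points of U may move, which suits open pieces that do
  not contain the centre of the disc.\<close>

definition deform :: "'a::euclidean_space set \<Rightarrow> 'a set \<Rightarrow> bool" where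
  "deform U T \<longleftrightarrow> open U \<and> open T \<and> U \<subseteq> T \<and> (\<exists>H :: 'a \<times> real \<Rightarrow> 'a. smooth_on (T \<times> UNIV) H \<and>
     (\<forall>x\<in>T. H (x, 0) = x \<and> H (x, 1) \<in> U \<and> (\<forall>t. H (x, t) \<in> T)) \<and> (\<forall>x\<in>U. \<forall>t. H (x, t) \<in> U))"

text \<open>The inverse of restriction is pullback along the time-one map. Surjectivity uses the
  homotopy inside U, injectivity the one inside T.\<close>

lemma deform_res_bij:
  fixes U T :: "'a::euclidean_space set"
  assumes "deform U T"
  shows deform_surj: "\<omega> \<in> closed_forms k U \<Longrightarrow> \<exists>\<beta>\<in>closed_forms k T. \<omega> - res U \<beta> \<in> exact_forms k U"
    and deform_inj: "\<beta> \<in> closed_forms k T \<Longrightarrow> res U \<beta> \<in> exact_forms k U \<Longrightarrow> \<beta> \<in> exact_forms k T"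
proof -
  from assms have U: "open U" and T: "open T" and UT: "U \<subseteq> T" unfolding deform_def by auto
  from assms obtain H :: "'a \<times> real \<Rightarrow> 'a" where H: "smooth_on (T \<times> UNIV) H"
    "\<And>x. x \<in> T \<Longrightarrow> H (x, 0) = x" "\<And>x. x \<in> T \<Longrightarrow> H (x, 1) \<in> U" "\<And>x t. x \<in> T \<Longrightarrow> H (x, t) \<in> T"
    "\<And>x t. x \<in> U \<Longrightarrow> H (x, t) \<in> U"
    unfolding deform_def by blast
  have HU: "smooth_on (U \<times> UNIV) H" by (rule smooth_on_subset[OF H(1)]) (use UT in auto)
  define s where "s = (\<lambda>x. H (x, 1))"
  have "open (T \<times> (UNIV :: real set))" using T by (simp add: open_Times)
  then have s: "smooth_on T s"
    unfolding s_def by (intro smooth_on_compose[OF T _ _ H(1)] smooth_on_Pair smooth_on_id smooth_on_const T) auto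
  have sU: "s x \<in> U" if "x \<in> T" for x using H(3) that by (simp add: s_def)
  show "\<exists>\<beta>\<in>closed_forms k T. \<omega> - res U \<beta> \<in> exact_forms k U" if \<omega>: "\<omega> \<in> closed_forms k U"
  proof
    show "pull T s \<omega> \<in> closed_forms k T" by (rule pull_closed[OF T U s sU \<omega>])
    have "pull U (\<lambda>x. H (x, 1)) \<omega> - pull U (\<lambda>x. H (x, 0)) \<omega> \<in> exact_forms k U"
      by (rule homotopy_exact[OF U U HU H(5) \<omega>])
    moreover have "pull U (\<lambda>x. H (x, 0)) \<omega> = res U \<omega>"
      unfolding res_eq_pull by (rule pull_cong[OF U]) (use H(2) UT in auto)
    moreover have "res U (pull T s \<omega>) = pull U (\<lambda>x. H (x, 1)) \<omega>"
      unfolding res_eq_pull s_def[symmetric]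
      by (rule pull_pull[OF U smooth_on_id _ s]) (use UT in auto)
    ultimately have "scale_form (-1) (res U (pull T s \<omega>) - \<omega>) \<in> exact_forms k U"
      using res_id[OF closed_forms_smooth[OF \<omega>]]
      by (intro form_subspace_scale[OF subspace_exact_forms[OF U]]) simp
    then show "\<omega> - res U (pull T s \<omega>) \<in> exact_forms k U"
      by (simp add: scale_form_def fun_diff_def)
  qed
  show "\<beta> \<in> exact_forms k T" if \<beta>: "\<beta> \<in> closed_forms k T" and e: "res U \<beta> \<in> exact_forms k U"
  proof -
    have "pull T s (res U \<beta>) \<in> exact_forms k T" by (rule pull_exact[OF T U s sU e])
    moreover have "pull T s (res U \<beta>) = pull T (\<lambda>x. H (x, 1)) \<beta>"
      unfolding res_eq_pull s_def[symmetric]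
      by (rule pull_pull[OF T s sU smooth_on_id])
    moreover have "pull T (\<lambda>x. H (x, 1)) \<beta> - pull T (\<lambda>x. H (x, 0)) \<beta> \<in> exact_forms k T"
      by (rule homotopy_exact[OF T T H(1) H(4) \<beta>])
    moreover have "pull T (\<lambda>x. H (x, 0)) \<beta> = res T \<beta>"
      unfolding res_eq_pull by (rule pull_cong[OF T H(2)])
    ultimately show ?thesis
      using res_id[OF closed_forms_smooth[OF \<beta>]]
      by (metis form_subspace_cancel[OF subspace_exact_forms[OF T]])
  qed
qed

definition betti_le :: "nat \<Rightarrow> nat \<Rightarrow> 'a::euclidean_space set \<Rightarrow> bool" where
  "betti_le r k U \<longleftrightarrow> (\<exists>f. (\<forall>i<r. f i \<in> closed_forms k U) \<and>
     (\<forall>\<omega>\<in>closed_forms k U. \<exists>c. \<omega> - (\<Sum>i<r. scale_form (c i) (f i)) \<in> exact_forms k U))"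

lemma betti_le_deform:
  assumes d: "deform T U" and b: "betti_le r k U"
  shows "betti_le r k T"
proof -
  from d have T: "open T" and U: "open U" and TU: "T \<subseteq> U" unfolding deform_def by auto
  from b obtain f where f: "\<And>i. i < r \<Longrightarrow> f i \<in> closed_forms k U"
    "\<And>\<omega>. \<omega> \<in> closed_forms k U \<Longrightarrow> \<exists>c. \<omega> - (\<Sum>i<r. scale_form (c i) (f i)) \<in> exact_forms k U"
    unfolding betti_le_def by blast
  show ?thesis unfolding betti_le_def
  proof (intro exI[of _ "\<lambda>i. res T (f i)"] conjI ballI allI impI)
    show "res T (f i) \<in> closed_forms k T" if "i < r" for i by (rule res_closed[OF T U TU f(1)[OF that]])
    fix \<omega> assume "\<omega> \<in> closed_forms k T"
    then obtain \<beta> where \<beta>: "\<beta> \<in> closed_forms k U" "\<omega> - res T \<beta> \<in> exact_forms k T"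
      using deform_surj[OF d] by blast
    from f(2)[OF \<beta>(1)] obtain c where c: "\<beta> - (\<Sum>i<r. scale_form (c i) (f i)) \<in> exact_forms k U" by blast
    have "(\<omega> - res T \<beta>) + res T (\<beta> - (\<Sum>i<r. scale_form (c i) (f i))) \<in> exact_forms k T"
      by (intro form_subspace_add[OF subspace_exact_forms[OF T]] \<beta> res_exact[OF T U TU c])
    then show "\<exists>c. \<omega> - (\<Sum>i<r. scale_form (c i) (res T (f i))) \<in> exact_forms k T"
      by (intro exI[of _ c]) (simp add: res_diff res_sum res_scale)
  qed
qed

section \<open>Removing a hyperplane: the abstract inequality\<close>

text \<open>Otherwise the simplifier eta-expands the terms of an equation between forms.\<close>

declare plus_fun_apply [simp del] zero_fun_apply [simp del] minus_apply [simp del] uminus_apply [simp del]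

text \<open>The connecting homomorphism applied to the class that is \<alpha> on P and 0 on Q: that
  class is the difference a - b on the overlap, and the derivatives of a and b agree there and glue
  to \<Theta>. The primitives a and b are returned as well because later corrections are made with
  them.\<close>

lemma connecting_form:
  assumes T1: "open T1" and T2: "open T2" and c: "cutoff T1 T2"
    and P: "open P" and Q: "open Q" and PQ: "P \<inter> Q = {}" "T1 \<inter> T2 = P \<union> Q"
    and \<alpha>: "\<alpha> \<in> closed_forms k P"
  obtains a b \<Theta> where "a \<in> smooth_forms k T1" "b \<in> smooth_forms k T2" "\<Theta> \<in> closed_forms (Suc k) (T1 \<union> T2)"
    "res T1 \<Theta> = ext_deriv T1 a" "res T2 \<Theta> = ext_deriv T2 b"
    "res P (a - b) = \<alpha>" "res Q (a - b) = 0"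
proof -
  have "res (P \<inter> Q) \<alpha> = res (P \<inter> Q) 0" by (simp add: PQ res_def)
  then obtain \<xi> where \<xi>: "\<xi> \<in> closed_forms k (P \<union> Q)" "res P \<xi> = \<alpha>" "res Q \<xi> = 0"
    using glue_closed[OF P Q \<alpha> form_subspace_0[OF subspace_closed_forms[OF Q]]] by metis
  let ?I = "T1 \<inter> T2"
  have I: "open ?I" using T1 T2 by (rule open_Int)
  have \<xi>s: "\<xi> \<in> smooth_forms k ?I" using closed_forms_smooth[OF \<xi>(1)] PQ by simp
  obtain a b where ab: "a \<in> smooth_forms k T1" "b \<in> smooth_forms k T2" "\<xi> = res ?I a - res ?I b"
    using mv_split[OF T1 T2 c \<xi>s] by metis
  have ea: "ext_deriv T1 a \<in> closed_forms (Suc k) T1" "ext_deriv T2 b \<in> closed_forms (Suc k) T2"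
    using ab by (auto intro!: closed_formsI ext_deriv_smooth_forms ext_deriv_ext_deriv T1 T2)
  have "ext_deriv ?I \<xi> = 0" using closed_forms_ext_deriv[OF \<xi>(1)] PQ by simp
  then have "res ?I (ext_deriv T1 a) - res ?I (ext_deriv T2 b) = 0"
    unfolding ab(3) ext_deriv_diff[OF I res_smooth_forms[OF I T1 Int_lower1 ab(1)] res_smooth_forms[OF I T2 Int_lower2 ab(2)]]
      ext_deriv_res[OF I T1 Int_lower1 ab(1)] ext_deriv_res[OF I T2 Int_lower2 ab(2)] .
  then have "res ?I (ext_deriv T1 a) = res ?I (ext_deriv T2 b)" by simp
  then obtain \<Theta> where \<Theta>: "\<Theta> \<in> closed_forms (Suc k) (T1 \<union> T2)"
    "res T1 \<Theta> = ext_deriv T1 a" "res T2 \<Theta> = ext_deriv T2 b"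
    using glue_closed[OF T1 T2 ea] by metis
  have \<xi>': "\<xi> = res ?I (a - b)" by (simp only: res_diff ab(3))
  have "res P (a - b) = \<alpha>" "res Q (a - b) = 0"
    using \<xi>(2,3) PQ(2) res_res[of P ?I "a - b"] res_res[of Q ?I "a - b"] unfolding \<xi>' by auto
  then show thesis using that ab \<Theta> by blast
qed

lemma res_sum_scale: "res U (\<Sum>i\<in>I. scale_form (c i) (f i)) = (\<Sum>i\<in>I. scale_form (c i) (res U (f i)))"
  by (simp only: res_sum res_scale)

text \<open>When X lies in T this bounds the cokernel of the restriction from T to X: its generators
  are the classes of the forms \<Theta> i.\<close>

definition relative_le :: "nat \<Rightarrow> nat \<Rightarrow> 'a::euclidean_space set \<Rightarrow> 'a set \<Rightarrow> bool" where
  "relative_le q k X T \<longleftrightarrow> (\<exists>\<Theta>. (\<forall>i<q. \<Theta> i \<in> closed_forms k X) \<and>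
     (\<forall>\<omega>\<in>closed_forms k X. \<exists>c. \<exists>\<beta>\<in>closed_forms k T.
        \<omega> - (\<Sum>i<q. scale_form (c i) (\<Theta> i)) - res X \<beta> \<in> exact_forms k X))"

text \<open>
  In the application \<open>T\<close> is a disc bundle, \<open>T1\<close> and \<open>T2\<close> are bundles of slit discs and \<open>P\<close> and \<open>Q\<close> the
  bundles of upper and lower half discs, so \<open>T1 \<union> T2\<close> is the punctured disc bundle. The forms \<open>\<Theta> i\<close>
  are the images under the connecting map of the classes \<open>\<alpha> i\<close> on \<open>P\<close>, extended by \<open>0\<close> to \<open>Q\<close>.
\<close>

lemma sectors_relative_le:
  fixes T T1 T2 P Q :: "'a::euclidean_space set"
  assumes d1: "deform T1 T" and d2: "deform T2 T" and dP: "deform P T" and dQ: "deform Q T"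
    and c: "cutoff T1 T2" and PQ: "P \<inter> Q = {}" "T1 \<inter> T2 = P \<union> Q" and b: "betti_le q k T"
  shows "relative_le q (Suc k) (T1 \<union> T2) T"
proof -
  let ?X = "T1 \<union> T2" and ?I = "T1 \<inter> T2"
  have o: "open T" "open T1" "open T2" "open P" "open Q" and
    s: "T1 \<subseteq> T" "T2 \<subseteq> T" "P \<subseteq> T" "Q \<subseteq> T"
    using d1 d2 dP dQ unfolding deform_def by auto
  have oX: "open ?X" and oI: "open ?I" and sX: "?X \<subseteq> T" using o s by auto
  have sP: "P \<subseteq> T1" "P \<subseteq> T2" "Q \<subseteq> T1" "Q \<subseteq> T2" using PQ by auto
  note sub = subspace_closed_forms subspace_exact_forms subspace_smooth_forms
  obtain \<alpha> where \<alpha>: "\<And>i. i < q \<Longrightarrow> \<alpha> i \<in> closed_forms k T"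
    "\<And>\<omega>. \<omega> \<in> closed_forms k T \<Longrightarrow> \<exists>c. \<omega> - (\<Sum>i<q. scale_form (c i) (\<alpha> i)) \<in> exact_forms k T"
    using b unfolding betti_le_def by blast
  have "\<forall>i. \<exists>a b \<Theta>. i < q \<longrightarrow> a \<in> smooth_forms k T1 \<and> b \<in> smooth_forms k T2 \<and>
     \<Theta> \<in> closed_forms (Suc k) ?X \<and> res T1 \<Theta> = ext_deriv T1 a \<and> res T2 \<Theta> = ext_deriv T2 b \<and>
     res P (a - b) = res P (\<alpha> i) \<and> res Q (a - b) = 0"
  proof
    fix i
    show "\<exists>a b \<Theta>. i < q \<longrightarrow> a \<in> smooth_forms k T1 \<and> b \<in> smooth_forms k T2 \<and>
     \<Theta> \<in> closed_forms (Suc k) ?X \<and> res T1 \<Theta> = ext_deriv T1 a \<and> res T2 \<Theta> = ext_deriv T2 b \<and>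
     res P (a - b) = res P (\<alpha> i) \<and> res Q (a - b) = 0"
    proof (cases "i < q")
      case True
      obtain a b \<Theta> where "a \<in> smooth_forms k T1" "b \<in> smooth_forms k T2" "\<Theta> \<in> closed_forms (Suc k) (T1 \<union> T2)"
        "res T1 \<Theta> = ext_deriv T1 a" "res T2 \<Theta> = ext_deriv T2 b"
        "res P (a - b) = res P (\<alpha> i)" "res Q (a - b) = 0"
        using connecting_form[OF o(2,3) c o(4,5) PQ res_closed[OF o(4,1) s(3) \<alpha>(1)[OF True]]] by metis
      then show ?thesis by blast
    qed simp
  qed
  then obtain a b \<Theta> where "\<And>i. i < q \<longrightarrow> a i \<in> smooth_forms k T1 \<and> b i \<in> smooth_forms k T2 \<and>
     \<Theta> i \<in> closed_forms (Suc k) ?X \<and> res T1 (\<Theta> i) = ext_deriv T1 (a i) \<and> res T2 (\<Theta> i) = ext_deriv T2 (b i) \<and>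
     res P (a i - b i) = res P (\<alpha> i) \<and> res Q (a i - b i) = 0"
    unfolding choice_iff by blast
  then have \<Theta>: "\<And>i. i < q \<Longrightarrow> a i \<in> smooth_forms k T1" "\<And>i. i < q \<Longrightarrow> b i \<in> smooth_forms k T2"
     "\<And>i. i < q \<Longrightarrow> \<Theta> i \<in> closed_forms (Suc k) ?X" "\<And>i. i < q \<Longrightarrow> res T1 (\<Theta> i) = ext_deriv T1 (a i)"
     "\<And>i. i < q \<Longrightarrow> res T2 (\<Theta> i) = ext_deriv T2 (b i)"
     "\<And>i. i < q \<Longrightarrow> res P (a i - b i) = res P (\<alpha> i)" "\<And>i. i < q \<Longrightarrow> res Q (a i - b i) = 0"
    by blast+
  show ?thesis unfolding relative_le_def
  proof (intro exI[of _ \<Theta>] conjI allI impI ballI \<Theta>(3))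
    fix \<omega> assume \<omega>: "\<omega> \<in> closed_forms (Suc k) ?X"
    obtain \<beta> where \<beta>: "\<beta> \<in> closed_forms (Suc k) T" "res T1 \<omega> - res T1 \<beta> \<in> exact_forms (Suc k) T1"
      using deform_surj[OF d1 res_closed[OF o(2) oX _ \<omega>]] by auto
    obtain \<beta>' where \<beta>': "\<beta>' \<in> closed_forms (Suc k) T" "res T2 \<omega> - res T2 \<beta>' \<in> exact_forms (Suc k) T2"
      using deform_surj[OF d2 res_closed[OF o(3) oX _ \<omega>]] by auto
    \<comment> \<open>Both \<open>\<beta>\<close> and \<open>\<beta>'\<close> restrict on P to the
      class of \<omega>, and restriction from T to P is injective in cohomology. Hence one class on
      T serves both sectors.\<close>
    have "res P (res T2 \<omega> - res T2 \<beta>') - res P (res T1 \<omega> - res T1 \<beta>) \<in> exact_forms (Suc k) P"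
      by (intro form_subspace_diff[OF sub(2)[OF o(4)]] res_exact[OF o(4) _ _ \<beta>(2)] res_exact[OF o(4) _ _ \<beta>'(2)] o sP)
    then have "res P (\<beta> - \<beta>') \<in> exact_forms (Suc k) P"
      by (simp add: res_diff res_res sP)
    then have bb: "\<beta> - \<beta>' \<in> exact_forms (Suc k) T"
      by (intro deform_inj[OF dP] form_subspace_diff[OF sub(1)[OF o(1)]] \<beta> \<beta>')
    have "(res T2 \<omega> - res T2 \<beta>') - res T2 (\<beta> - \<beta>') \<in> exact_forms (Suc k) T2"
      by (intro form_subspace_diff[OF sub(2)[OF o(3)]] \<beta>' res_exact[OF o(3,1) s(2) bb])
    then have b2: "res T2 \<omega> - res T2 \<beta> \<in> exact_forms (Suc k) T2" by (simp add: res_diff)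
    \<comment> \<open>What remains is exact on each sector; the obstruction to a common primitive is
      the difference of the two primitives on the overlap.\<close>
    define \<mu> where "\<mu> = \<omega> - res ?X \<beta>"
    have \<mu>: "\<mu> \<in> closed_forms (Suc k) ?X"
      unfolding \<mu>_def by (intro form_subspace_diff[OF sub(1)[OF oX]] \<omega> res_closed[OF oX o(1) sX \<beta>(1)])
    have \<mu>1: "res T1 \<mu> \<in> exact_forms (Suc k) T1" and \<mu>2: "res T2 \<mu> \<in> exact_forms (Suc k) T2"
      using \<beta>(2) b2 by (simp_all add: \<mu>_def res_diff res_res)
    then obtain \<gamma>1 \<gamma>2 where \<gamma>: "\<gamma>1 \<in> smooth_forms k T1" "res T1 \<mu> = ext_deriv T1 \<gamma>1"
      "\<gamma>2 \<in> smooth_forms k T2" "res T2 \<mu> = ext_deriv T2 \<gamma>2"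
      by (auto simp: exact_forms_def)
    define \<gamma> where "\<gamma> = res ?I \<gamma>1 - res ?I \<gamma>2"
    have r\<gamma>: "res ?I \<gamma>1 \<in> smooth_forms k ?I" "res ?I \<gamma>2 \<in> smooth_forms k ?I"
      by (rule res_smooth_forms[OF oI o(2) _ \<gamma>(1)], blast, rule res_smooth_forms[OF oI o(3) _ \<gamma>(3)], blast)
    have "ext_deriv ?I \<gamma> = res ?I (res T1 \<mu>) - res ?I (res T2 \<mu>)"
      unfolding \<gamma>_def ext_deriv_diff[OF oI r\<gamma>] \<gamma>(2,4)
        ext_deriv_res[OF oI o(2) Int_lower1 \<gamma>(1)] ext_deriv_res[OF oI o(3) Int_lower2 \<gamma>(3)] ..
    then have \<gamma>c: "\<gamma> \<in> closed_forms k ?I"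
      using form_subspace_diff[OF sub(3)[OF oI] r\<gamma>] by (intro closed_formsI) (simp_all add: res_res \<gamma>_def)
    obtain e where e: "e \<in> closed_forms k T" "res P \<gamma> - res P e \<in> exact_forms k P"
      using deform_surj[OF dP res_closed[OF o(4) oI _ \<gamma>c]] PQ by auto
    obtain e' where e': "e' \<in> closed_forms k T" "res Q \<gamma> - res Q e' \<in> exact_forms k Q"
      using deform_surj[OF dQ res_closed[OF o(5) oI _ \<gamma>c]] PQ by auto
    \<comment> \<open>Subtracting \<open>e'\<close> from the first primitive clears the class on Q
      and leaves e - e' on P. That is what the forms \<Theta> i, whose overlap classes live on P,
      can absorb.\<close>
    obtain c where c': "(e - e') - (\<Sum>i<q. scale_form (c i) (\<alpha> i)) \<in> exact_forms k T"
      using \<alpha>(2)[OF form_subspace_diff[OF sub(1)[OF o(1)] e(1) e'(1)]] by blast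
    let ?a = "\<Sum>i<q. scale_form (c i) (a i)" and ?b = "\<Sum>i<q. scale_form (c i) (b i)"
    let ?\<Theta> = "\<Sum>i<q. scale_form (c i) (\<Theta> i)"
    have sa: "?a \<in> smooth_forms k T1" and sb: "?b \<in> smooth_forms k T2"
      using \<Theta>(1,2) by (auto intro!: form_subspace_sum[OF sub(3)] form_subspace_scale[OF sub(3)] o)
    have re': "res T1 e' \<in> closed_forms k T1" by (rule res_closed[OF o(2,1) s(1) e'(1)])
    define \<delta>1 where "\<delta>1 = \<gamma>1 - res T1 e' - ?a"
    define \<delta>2 where "\<delta>2 = \<gamma>2 - ?b"
    have \<delta>s: "\<delta>1 \<in> smooth_forms k T1" "\<delta>2 \<in> smooth_forms k T2"
      unfolding \<delta>1_def \<delta>2_def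
      by (intro form_subspace_diff[OF sub(3)] \<gamma> sa sb o closed_forms_smooth[OF re'])+
    have d\<delta>1: "ext_deriv T1 \<delta>1 = res T1 (\<mu> - ?\<Theta>)"
    proof -
      have "ext_deriv T1 ?a = res T1 ?\<Theta>"
        using \<Theta>(1,4) by (subst ext_deriv_sum[OF o(2)]) (auto simp only: res_sum_scale lessThan_iff intro!: sum.cong)
      then show ?thesis
        unfolding \<delta>1_def ext_deriv_diff[OF o(2) form_subspace_diff[OF sub(3)[OF o(2)] \<gamma>(1) closed_forms_smooth[OF re']] sa]
          ext_deriv_diff[OF o(2) \<gamma>(1) closed_forms_smooth[OF re']] closed_forms_ext_deriv[OF re']
        by (simp only: res_diff \<gamma>(2) diff_zero)
    qed
    have d\<delta>2: "ext_deriv T2 \<delta>2 = res T2 (\<mu> - ?\<Theta>)"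
    proof -
      have "ext_deriv T2 ?b = res T2 ?\<Theta>"
        using \<Theta>(2,5) by (subst ext_deriv_sum[OF o(3)]) (auto simp only: res_sum_scale lessThan_iff intro!: sum.cong)
      then show ?thesis
        unfolding \<delta>2_def ext_deriv_diff[OF o(3) \<gamma>(3) sb] by (simp only: res_diff \<gamma>(4))
    qed
    \<comment> \<open>By the choice of e' and c, the corrected primitives differ by a form that is
      exact on P and on Q; splitting it lets them be glued after one more exact correction.\<close>
    define \<delta> where "\<delta> = res ?I \<delta>1 - res ?I \<delta>2"
    have \<delta>: "\<delta> \<in> smooth_forms k (P \<union> Q)"
      unfolding \<delta>_def PQ(2)[symmetric]
      by (intro form_subspace_diff[OF sub(3)[OF oI]] res_smooth_forms[OF oI o(2) _ \<delta>s(1)] res_smooth_forms[OF oI o(3) _ \<delta>s(2)]) auto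
    have ab: "res Y (?a - ?b) = (\<Sum>i<q. scale_form (c i) (res Y (a i - b i)))" for Y
      by (simp only: res_diff res_sum_scale scale_form_diff_right sum_subtractf)
    have "res P ?a - res P ?b = (\<Sum>i<q. scale_form (c i) (res P (\<alpha> i)))"
      using ab[of P] \<Theta>(6) by (simp add: res_diff)
    then have abP: "res P ?a - res P ?b = res P (\<Sum>i<q. scale_form (c i) (\<alpha> i))"
      by (simp only: res_sum_scale)
    have abQ: "res Q ?a - res Q ?b = 0"
      using ab[of Q] \<Theta>(7) by (simp add: res_diff scale_form_zero)
    have r\<delta>: "res Y \<delta> = res Y \<gamma> - res Y e' - (res Y ?a - res Y ?b)" if "Y \<subseteq> ?I" for Y
    proof -
      have "Y \<subseteq> T1" using that by auto
      then show ?thesis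
        by (simp only: \<delta>_def \<gamma>_def \<delta>1_def \<delta>2_def res_diff res_res[OF that] res_res) simp
    qed
    have "res P \<delta> = (res P \<gamma> - res P e) + res P ((e - e') - (\<Sum>i<q. scale_form (c i) (\<alpha> i)))"
      using PQ(2) by (subst r\<delta>) (auto simp only: abP res_diff, simp_all)
    then have eP: "res P \<delta> \<in> exact_forms k P"
      using form_subspace_add[OF sub(2)[OF o(4)] e(2) res_exact[OF o(4,1) s(3) c']] by simp
    have "res Q \<delta> = res Q \<gamma> - res Q e'"
      using PQ(2) by (subst r\<delta>) (auto simp only: abQ, simp_all)
    then have eQ: "res Q \<delta> \<in> exact_forms k Q" using e'(2) by simp
    have "\<delta> \<in> exact_forms k ?I"
      unfolding PQ(2) by (rule exact_disjoint_Un[OF o(4,5) PQ(1) \<delta> eP eQ])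
    then obtain p r where pr: "p \<in> exact_forms k T1" "r \<in> exact_forms k T2" "\<delta> = res ?I p - res ?I r"
      using mv_split_exact[OF o(2,3) c] by metis
    have pc: "p \<in> closed_forms k T1" "r \<in> closed_forms k T2" using pr exact_forms_closed o by auto
    have "res ?I (\<delta>1 - p) = res ?I (\<delta>2 - r)"
      using pr(3) unfolding \<delta>_def res_diff by (simp add: algebra_simps)
    moreover have ds: "\<delta>1 - p \<in> smooth_forms k T1" "\<delta>2 - r \<in> smooth_forms k T2"
      by (intro form_subspace_diff[OF sub(3)] o \<delta>s closed_forms_smooth[OF pc(1)] closed_forms_smooth[OF pc(2)])+
    ultimately obtain g where g: "g \<in> smooth_forms k ?X" "res T1 g = \<delta>1 - p" "res T2 g = \<delta>2 - r"
      using glue_smooth[OF o(2,3), of "\<delta>1 - p" k "\<delta>2 - r"] by metis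
    have "?\<Theta> \<in> closed_forms (Suc k) ?X"
      using \<Theta>(3) by (auto intro!: form_subspace_sum[OF sub(1)] form_subspace_scale[OF sub(1)] oX)
    then have "\<mu> - ?\<Theta> \<in> closed_forms (Suc k) ?X" by (rule form_subspace_diff[OF sub(1)[OF oX] \<mu>])
    then have "\<mu> - ?\<Theta> = ext_deriv ?X g"
    proof (rule forms_eqI[OF closed_forms_smooth ext_deriv_smooth_forms[OF oX g(1)]])
      show "res T1 (\<mu> - ?\<Theta>) = res T1 (ext_deriv ?X g)"
        unfolding ext_deriv_res[OF o(2) oX Un_upper1 g(1), symmetric] g(2)
          ext_deriv_diff[OF o(2) \<delta>s(1) closed_forms_smooth[OF pc(1)]] closed_forms_ext_deriv[OF pc(1)] d\<delta>1
        by (simp only: diff_zero)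
      show "res T2 (\<mu> - ?\<Theta>) = res T2 (ext_deriv ?X g)"
        unfolding ext_deriv_res[OF o(3) oX Un_upper2 g(1), symmetric] g(3)
          ext_deriv_diff[OF o(3) \<delta>s(2) closed_forms_smooth[OF pc(2)]] closed_forms_ext_deriv[OF pc(2)] d\<delta>2
        by (simp only: diff_zero)
    qed
    then have "\<mu> - ?\<Theta> \<in> exact_forms (Suc k) ?X" using g(1) by (simp add: exact_forms_def)
    moreover have "\<mu> - ?\<Theta> = \<omega> - ?\<Theta> - res ?X \<beta>" by (simp only: \<mu>_def diff_diff_eq add.commute)
    ultimately have "\<omega> - ?\<Theta> - res ?X \<beta> \<in> exact_forms (Suc k) ?X" by (simp only:)
    then show "\<exists>c. \<exists>\<beta>\<in>closed_forms (Suc k) T.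
        \<omega> - (\<Sum>i<q. scale_form (c i) (\<Theta> i)) - res ?X \<beta> \<in> exact_forms (Suc k) ?X"
      using \<beta>(1) by blast
  qed
qed

lemma form_scale_sum: "scale_form c (\<Sum>i\<in>I. f i) = (\<Sum>i\<in>I. scale_form c (f i))"
  by (induction I rule: infinite_finite_induct)
     (simp_all only: sum.infinite sum.empty sum.insert not_False_eq_True scale_form_zero scale_form_add_right)

lemma sum_scale_form_diff:
  fixes n :: nat
  shows "(\<Sum>i<n. scale_form (c i - s * d i) (f i)) =
     (\<Sum>i<n. scale_form (c i) (f i)) - scale_form s (\<Sum>i<n. scale_form (d i) (f i))"
  by (subst form_scale_sum, subst sum_subtractf[symmetric], rule sum.cong[OF refl],
      subst scale_form_diff_left, subst scale_form_scale, rule refl)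

text \<open>The inequality dim \<le> dim of kernel + rank, for a linear relation R instead of a map
  because the coefficient vector of a form is not unique. Each coordinate costs at most one further
  generator, a pivot for it.\<close>

lemma relation_span:
  fixes W :: "'a form set" and n p :: nat
  assumes V: "form_subspace V" and W: "form_subspace W"
    and lin: "\<And>\<omega> \<omega>' c c' s. R \<omega> c \<Longrightarrow> R \<omega>' c' \<Longrightarrow> R (\<omega> - scale_form s \<omega>') (\<lambda>i. c i - s * c' i)"
    and g: "\<And>i. i < p \<Longrightarrow> g i \<in> V"
    and base: "\<And>\<omega> c. \<omega> \<in> V \<Longrightarrow> R \<omega> c \<Longrightarrow> (\<And>i. c i = 0) \<Longrightarrow> \<exists>d. \<omega> - (\<Sum>i<p. scale_form (d i) (g i)) \<in> W"
  shows "\<exists>f. (\<forall>i<p + n. f i \<in> V) \<and> (\<forall>\<omega>\<in>V. \<forall>c. R \<omega> c \<longrightarrow> (\<forall>i\<ge>n. c i = 0) \<longrightarrow>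
     (\<exists>d. \<omega> - (\<Sum>i<p + n. scale_form (d i) (f i)) \<in> W))"
proof (induction n)
  case 0
  show ?case by (rule exI[of _ g]) (use g base in auto)
next
  case (Suc n)
  then obtain f where f: "\<And>i. i < p + n \<Longrightarrow> f i \<in> V"
    "\<And>\<omega> c. \<omega> \<in> V \<Longrightarrow> R \<omega> c \<Longrightarrow> (\<And>i. i \<ge> n \<Longrightarrow> c i = 0) \<Longrightarrow>
       \<exists>d. \<omega> - (\<Sum>i<p + n. scale_form (d i) (f i)) \<in> W" by blast
  show ?case
  proof (cases "\<exists>\<omega>\<in>V. \<exists>c. R \<omega> c \<and> (\<forall>i\<ge>Suc n. c i = 0) \<and> c n \<noteq> 0")
    case False
    \<comment> \<open>Without a pivot in coordinate n the old generators suffice; the zero form pads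
      the list.\<close>
    show ?thesis
    proof (intro exI[of _ "f(p + n := 0)"] conjI allI impI ballI)
      show "(f(p + n := 0)) i \<in> V" if "i < p + Suc n" for i
        using that f(1)[of i] form_subspace_0[OF V] by auto
      fix \<omega> c assume \<omega>: "\<omega> \<in> V" "R \<omega> c" "\<forall>i\<ge>Suc n. c i = 0"
      then have "c n = 0" using False by blast
      then have "c i = 0" if "i \<ge> n" for i using \<omega>(3) that by (metis Suc_leI le_neq_implies_less)
      from f(2)[OF \<omega>(1,2) this] obtain d where "\<omega> - (\<Sum>i<p + n. scale_form (d i) (f i)) \<in> W" by blast
      moreover have "(\<Sum>i<p + Suc n. scale_form (d i) ((f(p + n := 0)) i)) = (\<Sum>i<p + n. scale_form (d i) (f i))"
        by (simp add: scale_form_zero)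
      ultimately show "\<exists>d. \<omega> - (\<Sum>i<p + Suc n. scale_form (d i) ((f(p + n := 0)) i)) \<in> W" by metis
    qed
  next
    case True
    then obtain \<omega>0 c0 where \<omega>0: "\<omega>0 \<in> V" "R \<omega>0 c0" "\<And>i. i \<ge> Suc n \<Longrightarrow> c0 i = 0" "c0 n \<noteq> 0" by blast
    show ?thesis
    proof (intro exI[of _ "f(p + n := \<omega>0)"] conjI allI impI ballI)
      show "(f(p + n := \<omega>0)) i \<in> V" if "i < p + Suc n" for i
        using that f(1)[of i] \<omega>0(1) by auto
      fix \<omega> c assume \<omega>: "\<omega> \<in> V" "R \<omega> c" "\<forall>i\<ge>Suc n. c i = 0"
      define s where "s = c n / c0 n"
      have h1: "\<omega> - scale_form s \<omega>0 \<in> V" by (intro form_subspace_diff[OF V] form_subspace_scale[OF V] \<omega> \<omega>0)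
      have h2: "c i - s * c0 i = 0" if "i \<ge> n" for i
        using \<omega>(3) \<omega>0(3)[of i] \<omega>0(4) that by (cases "i = n") (auto simp: s_def)
      obtain d where d: "(\<omega> - scale_form s \<omega>0) - (\<Sum>i<p + n. scale_form (d i) (f i)) \<in> W"
        using f(2)[OF h1 lin[OF \<omega>(2) \<omega>0(2)] h2] by blast
      have eq: "(\<Sum>i<p + Suc n. scale_form ((d(p + n := s)) i) ((f(p + n := \<omega>0)) i)) =
         (\<Sum>i<p + n. scale_form (d i) (f i)) + scale_form s \<omega>0"
        unfolding add_Suc_right sum.lessThan_Suc fun_upd_same
        by (intro arg_cong2[where f = "(+)"] sum.cong refl) auto
      have eq': "\<omega> - (\<Sum>i<p + Suc n. scale_form ((d(p + n := s)) i) ((f(p + n := \<omega>0)) i)) =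
         (\<omega> - scale_form s \<omega>0) - (\<Sum>i<p + n. scale_form (d i) (f i))"
        unfolding eq by (simp add: algebra_simps)
      show "\<exists>d. \<omega> - (\<Sum>i<p + Suc n. scale_form (d i) ((f(p + n := \<omega>0)) i)) \<in> W"
        by (rule exI[of _ "d(p + n := s)"]) (use d in \<open>simp only: eq'\<close>)
    qed
  qed
qed

text \<open>A form on M whose coefficients on M \<inter> T are 0 agrees there, up to exact forms,
  with a form on T; after correction the two glue to M \<union> T. Such forms are thus generated by
  p classes, and the q coefficients add at most q more.\<close>

lemma betti_le_gysin:
  assumes M: "open M" and T: "open T" and c: "cutoff M T"
    and rel: "relative_le q k (M \<inter> T) T" and b: "betti_le p k (M \<union> T)"
  shows "betti_le (p + q) k M"
proof -
  let ?X = "M \<inter> T"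
  have X: "open ?X" and MT: "open (M \<union> T)" using M T by auto
  note sub = subspace_closed_forms subspace_exact_forms
  obtain \<Theta> where \<Theta>: "\<And>i. i < q \<Longrightarrow> \<Theta> i \<in> closed_forms k ?X"
    "\<And>\<omega>. \<omega> \<in> closed_forms k ?X \<Longrightarrow> \<exists>c. \<exists>\<beta>\<in>closed_forms k T.
        \<omega> - (\<Sum>i<q. scale_form (c i) (\<Theta> i)) - res ?X \<beta> \<in> exact_forms k ?X"
    using rel unfolding relative_le_def by blast
  obtain g where g: "\<And>i. i < p \<Longrightarrow> g i \<in> closed_forms k (M \<union> T)"
    "\<And>\<omega>. \<omega> \<in> closed_forms k (M \<union> T) \<Longrightarrow> \<exists>c. \<omega> - (\<Sum>i<p. scale_form (c i) (g i)) \<in> exact_forms k (M \<union> T)"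
    using b unfolding betti_le_def by blast
  define R where "R = (\<lambda>\<omega> c. \<exists>\<beta>\<in>closed_forms k T.
     res ?X \<omega> - (\<Sum>i<q. scale_form (c i) (\<Theta> i)) - res ?X \<beta> \<in> exact_forms k ?X)"
  have "\<exists>f. (\<forall>i<p + q. f i \<in> closed_forms k M) \<and> (\<forall>\<omega>\<in>closed_forms k M. \<forall>c. R \<omega> c \<longrightarrow> (\<forall>i\<ge>q. c i = 0) \<longrightarrow>
     (\<exists>d. \<omega> - (\<Sum>i<p + q. scale_form (d i) (f i)) \<in> exact_forms k M))"
  proof (rule relation_span[OF sub(1)[OF M] sub(2)[OF M]])
    fix \<omega> \<omega>' c c' s assume "R \<omega> c" "R \<omega>' c'"
    then obtain \<beta> \<beta>' where \<beta>: "\<beta> \<in> closed_forms k T" "\<beta>' \<in> closed_forms k T"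
       "res ?X \<omega> - (\<Sum>i<q. scale_form (c i) (\<Theta> i)) - res ?X \<beta> \<in> exact_forms k ?X"
       "res ?X \<omega>' - (\<Sum>i<q. scale_form (c' i) (\<Theta> i)) - res ?X \<beta>' \<in> exact_forms k ?X"
      unfolding R_def by blast
    have a1: "\<beta> - scale_form s \<beta>' \<in> closed_forms k T"
      by (intro form_subspace_diff[OF sub(1)[OF T]] form_subspace_scale[OF sub(1)[OF T]] \<beta>)
    have a2: "(res ?X \<omega> - (\<Sum>i<q. scale_form (c i) (\<Theta> i)) - res ?X \<beta>) -
       scale_form s (res ?X \<omega>' - (\<Sum>i<q. scale_form (c' i) (\<Theta> i)) - res ?X \<beta>') \<in> exact_forms k ?X"
      by (rule form_subspace_diff[OF sub(2)[OF X] \<beta>(3) form_subspace_scale[OF sub(2)[OF X] \<beta>(4)]])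
    have a3: "(res ?X \<omega> - (\<Sum>i<q. scale_form (c i) (\<Theta> i)) - res ?X \<beta>) -
       scale_form s (res ?X \<omega>' - (\<Sum>i<q. scale_form (c' i) (\<Theta> i)) - res ?X \<beta>') =
       res ?X (\<omega> - scale_form s \<omega>') - (\<Sum>i<q. scale_form (c i - s * c' i) (\<Theta> i)) - res ?X (\<beta> - scale_form s \<beta>')"
      by (simp only: sum_scale_form_diff scale_form_diff_right res_diff res_scale) (simp add: algebra_simps)
    show "R (\<omega> - scale_form s \<omega>') (\<lambda>i. c i - s * c' i)"
      unfolding R_def by (rule bexI[where x = "\<beta> - scale_form s \<beta>'"], rule a2[unfolded a3], rule a1)
  next
    show "res M (g i) \<in> closed_forms k M" if "i < p" for i
      by (rule res_closed[OF M MT Un_upper1 g(1)[OF that]])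
    fix \<omega> and cc :: "nat \<Rightarrow> complex"
    assume \<omega>: "\<omega> \<in> closed_forms k M" "R \<omega> cc" and "\<And>i. cc i = 0"
    then obtain \<beta> where \<beta>: "\<beta> \<in> closed_forms k T" "res ?X \<omega> - res ?X \<beta> \<in> exact_forms k ?X"
      unfolding R_def by (auto simp: scale_form_0)
    then obtain \<xi> \<eta> where \<xi>: "\<xi> \<in> exact_forms k M" "\<eta> \<in> exact_forms k T"
      "res ?X \<omega> - res ?X \<beta> = res ?X \<xi> - res ?X \<eta>"
      using mv_split_exact[OF M T c] by metis
    have "\<omega> - \<xi> \<in> closed_forms k M" "\<beta> - \<eta> \<in> closed_forms k T"
      by (intro form_subspace_diff[OF sub(1)] M T \<omega> \<beta> exact_forms_closed[OF _ \<xi>(1)] exact_forms_closed[OF _ \<xi>(2)])+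
    moreover have "res ?X (\<omega> - \<xi>) = res ?X (\<beta> - \<eta>)"
      using \<xi>(3) by (simp add: res_diff algebra_simps)
    ultimately obtain \<mu> where \<mu>: "\<mu> \<in> closed_forms k (M \<union> T)" "res M \<mu> = \<omega> - \<xi>"
      using glue_closed[OF M T] by metis
    from g(2)[OF \<mu>(1)] obtain d where d: "\<mu> - (\<Sum>i<p. scale_form (d i) (g i)) \<in> exact_forms k (M \<union> T)" by blast
    have "\<xi> + res M (\<mu> - (\<Sum>i<p. scale_form (d i) (g i))) \<in> exact_forms k M"
      by (intro form_subspace_add[OF sub(2)[OF M]] \<xi> res_exact[OF M MT Un_upper1 d])
    then have "\<omega> - (\<Sum>i<p. scale_form (d i) (res M (g i))) \<in> exact_forms k M"
      by (simp add: res_diff res_sum_scale \<mu>(2))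
    then show "\<exists>d. \<omega> - (\<Sum>i<p. scale_form (d i) (res M (g i))) \<in> exact_forms k M" by blast
  qed
  then obtain f where f: "\<And>i. i < p + q \<Longrightarrow> f i \<in> closed_forms k M"
    "\<And>\<omega> c. \<omega> \<in> closed_forms k M \<Longrightarrow> R \<omega> c \<Longrightarrow> (\<And>i. i \<ge> q \<Longrightarrow> c i = 0) \<Longrightarrow>
     \<exists>d. \<omega> - (\<Sum>i<p + q. scale_form (d i) (f i)) \<in> exact_forms k M" by blast
  show ?thesis unfolding betti_le_def
  proof (intro exI[of _ f] conjI ballI allI impI f(1))
    fix \<omega> assume \<omega>: "\<omega> \<in> closed_forms k M"
    obtain c \<beta> where c: "\<beta> \<in> closed_forms k T"
      "res ?X \<omega> - (\<Sum>i<q. scale_form (c i) (\<Theta> i)) - res ?X \<beta> \<in> exact_forms k ?X"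
      using \<Theta>(2)[OF res_closed[OF X M Int_lower1 \<omega>]] by blast
    \<comment> \<open>\<open>relation_span\<close> asks for coefficients that vanish from index q
      on.\<close>
    have "(\<Sum>i<q. scale_form (if i < q then c i else 0) (\<Theta> i)) = (\<Sum>i<q. scale_form (c i) (\<Theta> i))"
      by (rule sum.cong) auto
    then have "R \<omega> (\<lambda>i. if i < q then c i else 0)" unfolding R_def using c by metis
    then show "\<exists>d. \<omega> - (\<Sum>i<p + q. scale_form (d i) (f i)) \<in> exact_forms k M"
      by (rule f(2)[OF \<omega>]) auto
  qed
qed

section \<open>From generating families to the dimension of a quotient\<close>

lemma homogeneous_system:
  fixes a :: "'s \<Rightarrow> nat \<Rightarrow> 'k::field"
  assumes "finite S" "card S > r"
  shows "\<exists>c. (\<exists>s\<in>S. c s \<noteq> 0) \<and> (\<forall>i<r. (\<Sum>s\<in>S. c s * a s i) = 0)"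
  using assms
proof (induction r arbitrary: S a)
  case 0
  then obtain s where "s \<in> S" by fastforce
  then show ?case by (intro exI[of _ "\<lambda>_. 1"]) auto
next
  case (Suc r)
  show ?case
  proof (cases "\<forall>s\<in>S. a s r = 0")
    case True
    obtain c where c: "\<exists>s\<in>S. c s \<noteq> 0" "\<forall>i<r. (\<Sum>s\<in>S. c s * a s i) = 0"
      using Suc.IH[of S a] Suc.prems by auto
    have "(\<Sum>s\<in>S. c s * a s r) = 0" using True by simp
    then show ?thesis using c by (auto simp: less_Suc_eq)
  next
    case False
    then obtain t where t: "t \<in> S" "a t r \<noteq> 0" by blast
    \<comment> \<open>Equation r is solved for the unknown belonging to t, and the solution
      substituted into the others.\<close>
    define a' where "a' = (\<lambda>s i. a s i - a s r / a t r * a t i)"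
    have "card (S - {t}) > r" using Suc.prems t by simp
    then obtain c where c: "\<exists>s\<in>S - {t}. c s \<noteq> 0" "\<And>i. i < r \<Longrightarrow> (\<Sum>s\<in>S - {t}. c s * a' s i) = 0"
      using Suc.IH[of "S - {t}" a'] Suc.prems by auto
    define d where "d = c(t := - (\<Sum>s\<in>S - {t}. c s * a s r / a t r))"
    have e: "(\<Sum>s\<in>S. d s * a s i) = (\<Sum>s\<in>S - {t}. c s * a' s i)" for i
    proof -
      have "(\<Sum>s\<in>S. d s * a s i) = d t * a t i + (\<Sum>s\<in>S - {t}. d s * a s i)"
        using Suc.prems t by (simp add: sum.remove)
      also have "(\<Sum>s\<in>S - {t}. d s * a s i) = (\<Sum>s\<in>S - {t}. c s * a s i)"
        by (rule sum.cong) (auto simp: d_def)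
      also have "d t * a t i = - (\<Sum>s\<in>S - {t}. c s * a s r / a t r * a t i)"
        by (simp add: d_def sum_distrib_right)
      finally show ?thesis by (simp add: a'_def algebra_simps sum_subtractf)
    qed
    have "(\<Sum>s\<in>S - {t}. c s * a' s r) = 0" using t by (simp add: a'_def)
    then have "\<forall>i<Suc r. (\<Sum>s\<in>S. d s * a s i) = 0" using c(2) by (auto simp: e less_Suc_eq)
    moreover have "\<exists>s\<in>S. d s \<noteq> 0" using c(1) by (auto simp: d_def)
    ultimately show ?thesis by blast
  qed
qed

lemma scale_form_sum_left: "scale_form (\<Sum>i\<in>I. c i) f = (\<Sum>i\<in>I. scale_form (c i) f)"
  by (induction I rule: infinite_finite_induct)
     (simp_all only: sum.infinite sum.empty sum.insert not_False_eq_True scale_form_0 scale_form_add_left)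

text \<open>If S had more than r elements, writing them through the generators would give a
  homogeneous system with fewer equations than unknowns. A nonzero solution is a relation in S
  modulo W.\<close>

lemma quotient_basis_card_le:
  fixes r :: nat
  assumes V: "form_subspace V" and W: "form_subspace W"
    and span: "\<And>\<omega>. \<omega> \<in> V \<Longrightarrow> \<exists>c. \<omega> - (\<Sum>i<r. scale_form (c i) (f i)) \<in> W"
    and S: "quotient_basis scale_form V W S"
  shows "card S \<le> r"
proof (rule ccontr)
  assume "\<not> card S \<le> r"
  then have r: "card S > r" by simp
  from S have fin: "finite S" and SV: "S \<subseteq> V"
    and ind: "\<And>c. (\<Sum>s\<in>S. scale_form (c s) s) \<in> W \<Longrightarrow> \<forall>s\<in>S. c s = 0"
    unfolding quotient_basis_def by auto
  have "\<forall>s. \<exists>c. s \<in> S \<longrightarrow> s - (\<Sum>i<r. scale_form (c i) (f i)) \<in> W" using span SV by blast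
  then obtain a where a: "\<And>s. s \<in> S \<Longrightarrow> s - (\<Sum>i<r. scale_form (a s i) (f i)) \<in> W" by metis
  obtain c where c: "\<exists>s\<in>S. c s \<noteq> 0" "\<And>i. i < r \<Longrightarrow> (\<Sum>s\<in>S. c s * a s i) = 0"
    using homogeneous_system[OF fin r, of a] by blast
  have "(\<Sum>s\<in>S. scale_form (c s) (s - (\<Sum>i<r. scale_form (a s i) (f i)))) \<in> W"
    by (intro form_subspace_sum[OF W] form_subspace_scale[OF W] a)
  moreover have "(\<Sum>s\<in>S. scale_form (c s) (s - (\<Sum>i<r. scale_form (a s i) (f i)))) =
      (\<Sum>s\<in>S. scale_form (c s) s) - (\<Sum>s\<in>S. \<Sum>i<r. scale_form (c s * a s i) (f i))"
    by (simp only: scale_form_diff_right sum_subtractf form_scale_sum scale_form_scale)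
  moreover have "(\<Sum>s\<in>S. \<Sum>i<r. scale_form (c s * a s i) (f i)) = (\<Sum>i<r. scale_form (\<Sum>s\<in>S. c s * a s i) (f i))"
    by (subst sum.swap) (simp only: scale_form_sum_left)
  moreover have "\<dots> = 0" using c(2) by (simp add: scale_form_0)
  ultimately have "(\<Sum>s\<in>S. scale_form (c s) s) \<in> W" by simp
  then show False using ind c(1) by blast
qed

text \<open>A generating set of least cardinality is independent modulo W. Existence matters because
  \<open>quotient_dim\<close> is infinite when there is no finite basis.\<close>

lemma quotient_basis_exists:
  fixes r :: nat
  assumes V: "form_subspace V" and W: "form_subspace W"
    and "\<And>i. i < r \<Longrightarrow> f i \<in> V" "\<And>\<omega>. \<omega> \<in> V \<Longrightarrow> \<exists>c. \<omega> - (\<Sum>i<r. scale_form (c i) (f i)) \<in> W"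
  shows "\<exists>S. quotient_basis scale_form V W S"
proof -
  let ?P = "\<lambda>S. finite S \<and> S \<subseteq> V \<and> (\<forall>v\<in>V. \<exists>c. v - (\<Sum>s\<in>S. scale_form (c s) s) \<in> W)"
  have "?P (f ` {..<r})"
  proof (intro conjI ballI)
    fix v assume "v \<in> V"
    then obtain c where c: "v - (\<Sum>i<r. scale_form (c i) (f i)) \<in> W" using assms(4) by blast
    \<comment> \<open>The family f may repeat a form, so the coefficients of equal forms are
      collected.\<close>
    have "(\<Sum>i<r. scale_form (c i) (f i)) = (\<Sum>s\<in>f ` {..<r}. \<Sum>i\<in>{i \<in> {..<r}. f i = s}. scale_form (c i) (f i))"
      by (rule sum.image_gen) simp
    also have "\<dots> = (\<Sum>s\<in>f ` {..<r}. scale_form (\<Sum>i\<in>{i \<in> {..<r}. f i = s}. c i) s)"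
      by (intro sum.cong refl) (simp add: scale_form_sum_left)
    finally show "\<exists>c. v - (\<Sum>s\<in>f ` {..<r}. scale_form (c s) s) \<in> W"
      using c by (intro exI[of _ "\<lambda>s. \<Sum>i\<in>{i \<in> {..<r}. f i = s}. c i"]) simp
  qed (use assms(3) in auto)
  from ex_has_least_nat[of ?P, OF this, of card]
  obtain S where "?P S" and min: "\<And>S'. ?P S' \<Longrightarrow> card S \<le> card S'" by blast
  then have S: "finite S" "S \<subseteq> V" "\<And>v. v \<in> V \<Longrightarrow> \<exists>c. v - (\<Sum>s\<in>S. scale_form (c s) s) \<in> W"
    by blast+
  have ind: "\<forall>s\<in>S. c s = 0" if c: "(\<Sum>s\<in>S. scale_form (c s) s) \<in> W" for c
  proof (rule ccontr)
    assume "\<not> (\<forall>s\<in>S. c s = 0)"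
    then obtain t where t: "t \<in> S" "c t \<noteq> 0" by blast
    have "\<exists>d. v - (\<Sum>s\<in>S - {t}. scale_form (d s) s) \<in> W" if v: "v \<in> V" for v
    proof -
      obtain d where d: "v - (\<Sum>s\<in>S. scale_form (d s) s) \<in> W" using S(3)[OF v] by blast
      have "(v - (\<Sum>s\<in>S. scale_form (d s) s)) + scale_form (d t / c t) (\<Sum>s\<in>S. scale_form (c s) s) \<in> W"
        by (intro form_subspace_add[OF W] form_subspace_scale[OF W] d c)
      moreover have "(v - (\<Sum>s\<in>S. scale_form (d s) s)) + scale_form (d t / c t) (\<Sum>s\<in>S. scale_form (c s) s) =
         v - (\<Sum>s\<in>S. scale_form (d s - d t / c t * c s) s)"
        by (simp add: form_scale_sum scale_form_scale scale_form_diff_left sum_subtractf)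
      moreover have "(\<Sum>s\<in>S. scale_form (d s - d t / c t * c s) s) = (\<Sum>s\<in>S - {t}. scale_form (d s - d t / c t * c s) s)"
        using t by (simp add: sum.remove[OF S(1) t(1)] scale_form_0)
      ultimately have "v - (\<Sum>s\<in>S - {t}. scale_form (d s - d t / c t * c s) s) \<in> W" by simp
      then show ?thesis by (rule exI[of _ "\<lambda>s. d s - d t / c t * c s"])
    qed
    then have "card S \<le> card (S - {t})" using S by (intro min) auto
    then show False using t S(1) by (metis card_Diff1_less not_less)
  qed
  show ?thesis unfolding quotient_basis_def
    by (rule exI[of _ S], intro conjI S(1,2) allI impI ballI) (erule ind[THEN bspec], assumption, erule S(3))
qed

text \<open>The basis picked by \<open>SOME\<close> is arbitrary, but every basis obeys the
  bound.\<close>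

lemma de_rham_betti_le:
  assumes U: "open U" and b: "betti_le r k U"
  shows "de_rham_betti k U \<le> enat r"
proof -
  obtain f where f: "\<And>i. i < r \<Longrightarrow> f i \<in> closed_forms k U"
    "\<And>\<omega>. \<omega> \<in> closed_forms k U \<Longrightarrow> \<exists>c. \<omega> - (\<Sum>i<r. scale_form (c i) (f i)) \<in> exact_forms k U"
    using b unfolding betti_le_def by blast
  note sub = subspace_closed_forms[OF U] subspace_exact_forms[OF U]
  have ex: "\<exists>S. quotient_basis scale_form (closed_forms k U) (exact_forms k U) S"
    by (rule quotient_basis_exists[OF sub f])
  have "card (SOME S. quotient_basis scale_form (closed_forms k U) (exact_forms k U) S) \<le> r"
    by (rule quotient_basis_card_le[OF sub f(2) someI_ex[OF ex]])
  then show ?thesis unfolding de_rham_betti_def quotient_dim_def using ex by simp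
qed

section \<open>Complements of hyperplane arrangements\<close>

text \<open>The complex bilinear pairing; the inner product on \<open>complex ^ 'm\<close> is
  real-valued.\<close>

definition lin_form :: "complex ^ 'm \<Rightarrow> complex ^ 'm \<Rightarrow> complex" where
  "lin_form a x = (\<Sum>i\<in>UNIV. a $ i * x $ i)"

lemma lin_form_add: "lin_form a (x + y) = lin_form a x + lin_form a y"
  and lin_form_scale: "lin_form a (c *s x) = c * lin_form a x"
  and lin_form_diff: "lin_form a (x - y) = lin_form a x - lin_form a y"
  and lin_form_diff_left: "lin_form (a - b) x = lin_form a x - lin_form b x"
  and lin_form_scale_left: "lin_form (c *s a) x = c * lin_form a x"
  by (simp_all add: lin_form_def algebra_simps sum.distrib sum_subtractf sum_distrib_left)

lemma bounded_linear_lin_form: "bounded_linear (lin_form a)"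
proof -
  have "linear (lin_form a)"
    by (rule linearI, rule lin_form_add) (simp add: lin_form_def scaleR_sum_right)
  then show ?thesis by (rule linear_conv_bounded_linear[THEN iffD1])
qed

lemma bounded_linear_scale_vec: "bounded_linear (\<lambda>z::complex. z *s (e :: complex ^ 'm))"
proof -
  have "linear (\<lambda>z::complex. z *s e)"
    by (rule linearI) (simp_all add: vec_eq_iff algebra_simps)
  then show ?thesis by (rule linear_conv_bounded_linear[THEN iffD1])
qed

lemma smooth_on_lin_form: "open U \<Longrightarrow> smooth_on U g \<Longrightarrow> smooth_on U (\<lambda>x. lin_form a (g x))"
  by (rule smooth_on_linear[OF bounded_linear_lin_form])

lemma smooth_on_scale_vec: "open U \<Longrightarrow> smooth_on U g \<Longrightarrow> smooth_on U (\<lambda>x. g x *s (e :: complex ^ 'm))"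
  by (rule smooth_on_linear[OF bounded_linear_scale_vec])

definition arrangement :: "(complex ^ 'm) list \<Rightarrow> (complex ^ 'm) set" where
  "arrangement as = {x. \<forall>a\<in>set as. lin_form a x \<noteq> 0}"

lemma continuous_lin_form: "continuous_on S (lin_form a)"
  by (rule linear_continuous_on[OF bounded_linear_lin_form])

lemma open_arrangement: "open (arrangement as)"
proof -
  have "arrangement as = (\<Inter>a\<in>set as. {x. lin_form a x \<noteq> 0})" by (auto simp: arrangement_def)
  moreover have "open {x. lin_form a x \<noteq> 0}" for a :: "complex ^ 'm"
    by (intro open_Collect_neq continuous_lin_form continuous_on_const)
  ultimately show ?thesis by auto
qed

lemma betti_le_empty: "betti_le r k ({} :: 'a::euclidean_space set)"
proof -
  have "\<omega> = 0" if "\<omega> \<in> closed_forms k {}" for \<omega> :: "'a form"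
    using smooth_forms_outside[OF closed_forms_smooth[OF that]] by (auto simp: fun_eq_iff zero_fun_apply)
  then have "closed_forms k {} = {0 :: 'a form}" using form_subspace_0[OF subspace_closed_forms] by blast
  then show ?thesis unfolding betti_le_def
    using form_subspace_0[OF subspace_exact_forms[OF open_empty]]
    by (intro exI[of _ "\<lambda>_. 0"]) (simp add: scale_form_zero)
qed

text \<open>The scaling homotopy joins the constant map 0 to the identity. The derivative of a
  constant map is 0, so pullback along it kills every form of positive degree.\<close>

lemma betti_le_UNIV: "betti_le 0 (Suc k) (UNIV :: 'a::euclidean_space set)"
proof -
  have "\<omega> \<in> exact_forms (Suc k) UNIV" if \<omega>: "\<omega> \<in> closed_forms (Suc k) UNIV" for \<omega> :: "'a form"
  proof -
    let ?H = "\<lambda>z :: 'a \<times> real. snd z *\<^sub>R fst z"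
    have H: "smooth_on (UNIV \<times> UNIV) ?H"
      by (intro smooth_intros smooth_on_id open_Times open_UNIV)
    have "pull UNIV (\<lambda>x. ?H (x, 1)) \<omega> - pull UNIV (\<lambda>x. ?H (x, 0)) \<omega> \<in> exact_forms (Suc k) UNIV"
      by (rule homotopy_exact[OF open_UNIV open_UNIV H _ \<omega>]) simp
    moreover have "pull UNIV (\<lambda>x. ?H (x, 1)) \<omega> = \<omega>"
      using res_id[OF closed_forms_smooth[OF \<omega>]] by (simp add: res_eq_pull)
    moreover have "pull UNIV (\<lambda>x. ?H (x, 0)) \<omega> = 0"
    proof (intro ext)
      fix x and vs :: "'a list"
      note a = smooth_forms_alt[OF closed_forms_smooth[OF \<omega>], of 0]
      have "\<omega> 0 (map (\<lambda>_. 0) vs) = 0"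
      proof (cases vs)
        case Nil
        then show ?thesis using alt_form_length[OF a] by simp
      next
        case (Cons v ws)
        then show ?thesis using linear_0[OF alt_form_linear[OF a, of "[]"]] by simp
      qed
      then show "pull UNIV (\<lambda>x. ?H (x, 0)) \<omega> x vs = 0 x vs" by (simp add: pull_def zero_fun_apply)
    qed
    ultimately show ?thesis by simp
  qed
  then show ?thesis unfolding betti_le_def by (intro exI[of _ "\<lambda>_. 0"]) auto
qed

text \<open>Each form of the arrangement is affine in the parameter z and nonzero at z = 0, so it
  has at most one zero on the complex line through a and b.\<close>

lemma finite_params_off_arrangement:
  assumes "a \<in> arrangement as" "b \<in> arrangement as"
  shows "finite {z. a + z *s (b - a) \<notin> arrangement as}"
proof -
  have "{z. a + z *s (b - a) \<notin> arrangement as} \<subseteq> (\<lambda>h. - lin_form h a / lin_form h (b - a)) ` set as"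
  proof
    fix z assume "z \<in> {z. a + z *s (b - a) \<notin> arrangement as}"
    then obtain h where h: "h \<in> set as" "lin_form h (a + z *s (b - a)) = 0"
      unfolding arrangement_def by blast
    from h(2) have h2: "lin_form h a + z * lin_form h (b - a) = 0"
      by (simp only: lin_form_add lin_form_scale)
    have "lin_form h a \<noteq> 0" using h(1) assms by (auto simp: arrangement_def)
    then have "lin_form h (b - a) \<noteq> 0" using h2 by auto
    then have "z = - lin_form h a / lin_form h (b - a)"
      using h2 by (simp add: field_simps add_eq_0_iff)
    then show "z \<in> (\<lambda>h. - lin_form h a / lin_form h (b - a)) ` set as" using h(1) by blast
  qed
  then show ?thesis by (rule finite_subset) simp
qed

text \<open>Any two points lie on a complex line that leaves the complement at finitely many
  parameters, and the plane minus a finite set is connected; so a closed 0-form is constant. Degree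
  0 is treated apart because the connecting map ends in positive degrees.\<close>

lemma betti_le_arrangement_0: "betti_le 1 0 (arrangement as)"
proof -
  let ?U = "arrangement as"
  define u :: "(complex ^ 'a) form" where "u = (\<lambda>x vs. if x \<in> ?U \<and> vs = [] then 1 else 0)"
  have us: "u \<in> smooth_forms 0 ?U"
    unfolding smooth_forms_iff
  proof (intro conjI allI impI)
    show "u x = (\<lambda>_. 0)" if "x \<notin> ?U" for x using that by (simp add: u_def)
    show "alt_form 0 (u x)" for x by (auto simp: alt_form_def u_def)
    show "smooth_on ?U (\<lambda>x. u x vs)" for vs
      by (subst smooth_on_cong[OF open_arrangement, of _ _ "\<lambda>x. if vs = [] then 1 else 0"])
         (auto simp: u_def smooth_on_const)
  qed
  have "ext_deriv ?U u = 0"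
  proof (intro ext)
    fix x vs
    show "ext_deriv ?U u x vs = 0 x vs"
    proof (cases "x \<in> ?U")
      case True
      have "frechet_derivative (\<lambda>y. u y us) (at x) = frechet_derivative (\<lambda>y. if us = [] then 1 else 0) (at x)" for us
        by (rule frechet_derivative_cong_open[OF open_arrangement True]) (simp add: u_def)
      then show ?thesis using True by (simp add: ext_deriv_apply zero_fun_apply)
    qed (simp add: ext_deriv_def zero_fun_apply)
  qed
  then have uc: "u \<in> closed_forms 0 ?U" by (rule closed_formsI[OF us])
  have span: "\<exists>c. \<omega> - scale_form c u \<in> exact_forms 0 ?U" if \<omega>: "\<omega> \<in> closed_forms 0 ?U" for \<omega>
  proof -
    note sm = closed_forms_smooth[OF \<omega>]
    have d: "((\<lambda>y. \<omega> y []) has_derivative (\<lambda>v. 0)) (at x)" if x: "x \<in> ?U" for x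
    proof -
      have "frechet_derivative (\<lambda>y. \<omega> y []) (at x) v = 0" for v
        using fun_cong[OF fun_cong[OF closed_forms_ext_deriv[OF \<omega>]], of x "[v]"] x
        by (simp add: ext_deriv_apply omit_0 zero_fun_apply)
      then have "frechet_derivative (\<lambda>y. \<omega> y []) (at x) = (\<lambda>v. 0)" by blast
      then show ?thesis using smooth_forms_has_derivative[OF sm x, of "[]"] by metis
    qed
    have const: "\<omega> a [] = \<omega> b []" if ab: "a \<in> ?U" "b \<in> ?U" for a b
    proof -
      let ?\<gamma> = "\<lambda>z. a + z *s (b - a)"
      let ?Z = "- {z. ?\<gamma> z \<notin> ?U}"
      have fin: "finite {z. ?\<gamma> z \<notin> ?U}" by (rule finite_params_off_arrangement[OF ab])
      have "open ?Z" using fin by (simp add: finite_imp_closed open_Compl)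
      moreover have "connected ?Z"
        using connected_open_delete_finite[OF open_UNIV connected_UNIV _ fin] by (simp add: Compl_eq_Diff_UNIV)
      moreover have "((\<lambda>z. \<omega> (?\<gamma> z) []) has_derivative (\<lambda>v. 0)) (at z)" if "z \<in> ?Z" for z
      proof -
        have "(?\<gamma> has_derivative (\<lambda>v. v *s (b - a))) (at z)"
          using has_derivative_add[OF has_derivative_const bounded_linear_imp_has_derivative[OF bounded_linear_scale_vec]]
          by (simp only: add_0)
        from has_derivative_compose[OF this d] that show ?thesis by auto
      qed
      moreover have "?\<gamma> 0 = a" "?\<gamma> 1 = b" by (simp_all add: vec_eq_iff)
      then have "0 \<in> ?Z" "1 \<in> ?Z" using ab by auto
      ultimately have "\<omega> (?\<gamma> 0) [] = \<omega> (?\<gamma> 1) []"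
        using has_derivative_zero_unique_connected[of ?Z "\<lambda>z. \<omega> (?\<gamma> z) []" 0 1] by blast
      then show ?thesis using \<open>?\<gamma> 0 = a\<close> \<open>?\<gamma> 1 = b\<close> by simp
    qed
    obtain c where c: "\<And>x. x \<in> ?U \<Longrightarrow> \<omega> x [] = c" using const by metis
    have "\<omega> = scale_form c u"
    proof (intro ext)
      fix x vs
      show "\<omega> x vs = scale_form c u x vs"
        using smooth_forms_outside[OF sm, of x vs] alt_form_length[OF smooth_forms_alt[OF sm], of vs x] c[of x]
        by (auto simp: scale_form_def u_def)
    qed
    then show ?thesis by (intro exI[of _ c]) (simp add: exact_forms_def)
  qed
  then show ?thesis unfolding betti_le_def
  proof (intro exI[of _ "\<lambda>_. u"] conjI ballI allI impI uc)
    fix \<omega> assume "\<omega> \<in> closed_forms 0 ?U"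
    then obtain c where "\<omega> - scale_form c u \<in> exact_forms 0 ?U" using span by blast
    then show "\<exists>c. \<omega> - (\<Sum>i<1::nat. scale_form (c i) u) \<in> exact_forms 0 ?U"
      by (intro exI[of _ "\<lambda>_. c"]) (simp only: One_nat_def sum.lessThan_Suc lessThan_0 sum.empty add_0)
  qed
qed

section \<open>Geometry of a tube around a hyperplane\<close>

context
  fixes l e :: "complex ^ 'm" and as :: "(complex ^ 'm) list"
  assumes le: "lin_form l e = 1"
begin

text \<open>Projection to the hyperplane along e. It gives the base point in the disc bundle, while
  \<open>lin_form l x\<close> is the coordinate in the fibre.\<close>

definition "proj x = x - lin_form l x *s e"

text \<open>
  A smooth radius depending only on \<open>proj x\<close>, zero where some other form vanishes at \<open>proj x\<close> and
  otherwise so small that no other form vanishes within that distance of the hyperplane.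
\<close>

definition "radius x = (\<Prod>a\<in>set as. (cmod (lin_form a (proj x)))\<^sup>2 /
   (1 + (cmod (lin_form a (proj x)))\<^sup>2 + (cmod (lin_form a e))\<^sup>2))"

definition "tube = {x. cmod (lin_form l x) < radius x}"

text \<open>
  The preimage under \<open>proj\<close> of the restricted arrangement: it stands for the restriction itself, so
  that the induction never leaves the ambient space.
\<close>

definition "cylinder = arrangement (map (\<lambda>a. a - lin_form a e *s l) as)"

lemma lin_form_proj: "lin_form a (proj x + z *s e) = lin_form a (proj x) + z * lin_form a e"
  by (simp only: lin_form_add lin_form_scale)

lemma proj_add: "proj (proj x + z *s e) = proj x"
  and lin_form_l_proj: "lin_form l (proj x) = 0"
  by (simp_all add: proj_def lin_form_add lin_form_scale lin_form_diff le vec_eq_iff algebra_simps)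

lemma proj_decomp: "x = proj x + lin_form l x *s e"
  by (simp add: proj_def)

lemma radius_proj: "radius (proj x + z *s e) = radius x"
  by (simp only: radius_def proj_add)

lemma lin_form_l: "lin_form l (proj x + z *s e) = z"
  by (simp only: lin_form_proj lin_form_l_proj le) simp

lemma cylinder_iff: "x \<in> cylinder \<longleftrightarrow> (\<forall>a\<in>set as. lin_form a (proj x) \<noteq> 0)"
  by (simp add: cylinder_def arrangement_def proj_def lin_form_diff lin_form_diff_left
      lin_form_scale lin_form_scale_left algebra_simps)

lemma radius_nonneg: "radius x \<ge> 0"
  unfolding radius_def by (intro prod_nonneg divide_nonneg_nonneg) (auto intro: add_nonneg_nonneg)

lemma denom_pos: "1 + (cmod u)\<^sup>2 + (cmod v)\<^sup>2 > 0"
  by (intro add_pos_nonneg) auto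

lemma radius_pos_iff: "radius x > 0 \<longleftrightarrow> x \<in> cylinder"
proof -
  have "radius x \<noteq> 0 \<longleftrightarrow> x \<in> cylinder"
    using less_imp_neq[OF denom_pos, symmetric] by (auto simp: radius_def cylinder_iff)
  then show ?thesis using radius_nonneg[of x] by auto
qed

text \<open>Let A and B be the absolute values of a at e and at \<open>proj x\<close>. Every factor
  of the radius is at most 1, so the radius is at most B^2 / (1 + A^2 + B^2), and A B \<le> (A^2 +
  B^2) / 2 < 1 + A^2 + B^2. This explains the denominator.\<close>

lemma radius_le:
  assumes x: "x \<in> cylinder" and a: "a \<in> set as"
  shows "radius x * cmod (lin_form a e) < cmod (lin_form a (proj x))"
proof -
  let ?B = "\<lambda>a. cmod (lin_form a (proj x))" and ?A = "\<lambda>a. cmod (lin_form a e)"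
  let ?g = "\<lambda>a. (?B a)\<^sup>2 / (1 + (?B a)\<^sup>2 + (?A a)\<^sup>2)"
  have g: "0 \<le> ?g a" "?g a \<le> 1" for a
    using denom_pos[of "lin_form a (proj x)" "lin_form a e"] by (auto simp: divide_simps)
  have "radius x = ?g a * (\<Prod>a\<in>set as - {a}. ?g a)"
    unfolding radius_def using a by (simp add: prod.remove)
  also have "\<dots> \<le> ?g a * 1"
    by (intro mult_left_mono prod_le_1 g conjI)
  finally have r: "radius x \<le> ?g a" by simp
  have B: "?B a > 0" using x a by (simp add: cylinder_iff)
  have "?B a * ?A a \<le> ((?B a)\<^sup>2 + (?A a)\<^sup>2) / 2"
    using sum_squares_bound[of "?B a" "?A a"] by simp
  also have "\<dots> < 1 + (?B a)\<^sup>2 + (?A a)\<^sup>2"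
    by (simp add: field_simps add_pos_nonneg)
  finally have AB: "?B a * ?A a < 1 + (?B a)\<^sup>2 + (?A a)\<^sup>2" .
  have "radius x * ?A a \<le> ?g a * ?A a" by (intro mult_right_mono r) simp
  also have "\<dots> = ?B a * ((?B a * ?A a) / (1 + (?B a)\<^sup>2 + (?A a)\<^sup>2))"
    by (simp add: power2_eq_square)
  also have "\<dots> < ?B a * 1"
    using AB B denom_pos[of "lin_form a (proj x)" "lin_form a e"] by (intro mult_strict_left_mono) (simp_all add: divide_simps)
  finally show ?thesis by simp
qed

lemma smooth_on_proj: "open U \<Longrightarrow> smooth_on U g \<Longrightarrow> smooth_on U (\<lambda>x. proj (g x))"
  unfolding proj_def by (intro smooth_on_diff smooth_on_scale_vec smooth_on_lin_form)

lemma smooth_on_norm_square: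
  fixes g :: "'b::real_normed_vector \<Rightarrow> complex"
  shows "open U \<Longrightarrow> smooth_on U g \<Longrightarrow> smooth_on U (\<lambda>x. (cmod (g x))\<^sup>2)"
  unfolding cmod_power2 by (intro smooth_intros)

lemma smooth_on_radius: "open U \<Longrightarrow> smooth_on U g \<Longrightarrow> smooth_on U (\<lambda>x. radius (g x))"
  unfolding radius_def
  by (intro smooth_on_prod smooth_on_divide smooth_on_add smooth_on_norm_square smooth_on_const
      smooth_on_lin_form smooth_on_proj less_imp_neq[OF denom_pos, symmetric])

lemma open_tube: "open tube"
proof -
  have "continuous_on UNIV radius"
    using smooth_on_continuous[OF smooth_on_radius[OF open_UNIV smooth_on_id]] .
  then show ?thesis unfolding tube_def
    by (intro open_Collect_less continuous_on_norm continuous_lin_form)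
qed

lemma tube_cylinder: "x \<in> tube \<Longrightarrow> x \<in> cylinder"
  unfolding tube_def radius_pos_iff[symmetric] by (auto intro: le_less_trans[OF norm_ge_zero])

lemma tube_arrangement: "x \<in> tube \<Longrightarrow> x \<in> arrangement as"
  unfolding arrangement_def
proof safe
  fix a assume x: "x \<in> tube" and a: "a \<in> set as" and "lin_form a x = 0"
  then have "lin_form a (proj x + lin_form l x *s e) = 0" using proj_decomp[of x] by simp
  then have "lin_form a (proj x) + lin_form l x * lin_form a e = 0" unfolding lin_form_proj .
  then have "cmod (lin_form a (proj x)) = cmod (lin_form l x) * cmod (lin_form a e)"
    by (metis add_eq_0_iff norm_minus_cancel norm_mult)
  also have "\<dots> \<le> radius x * cmod (lin_form a e)"
    using x by (intro mult_right_mono) (auto simp: tube_def)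
  also have "\<dots> < cmod (lin_form a (proj x))" by (rule radius_le[OF tube_cylinder[OF x] a])
  finally show False by simp
qed

lemma arrangement_tube:
  assumes "x \<in> arrangement as" "lin_form l x = 0" shows "radius x > 0" "x \<in> tube"
proof -
  have "proj x = x" using assms(2) by (simp add: proj_def)
  then show "radius x > 0" using assms(1) by (simp add: radius_pos_iff cylinder_iff arrangement_def)
  then show "x \<in> tube" using assms(2) by (simp add: tube_def)
qed

text \<open>Homotopies have the whole real line as time, whereas convex combinations need weights
  between 0 and 1.\<close>

lemma unit_step:
  obtains \<tau> :: "real \<Rightarrow> real" where "smooth_on UNIV \<tau>" "\<tau> 0 = 0" "\<tau> 1 = 1" "\<And>t. 0 \<le> \<tau> t \<and> \<tau> t \<le> 1"
proof -
  have s: "smooth_on UNIV (\<lambda>t::real. t)" "smooth_on UNIV (\<lambda>t::real. 1 - t)"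
    by (intro smooth_intros open_UNIV)+
  show thesis
    by (rule smooth_cutoff[OF open_UNIV s]) (auto intro: that)
qed

text \<open>A straight-line homotopy in each fibre towards the point radius * c. Since c has norm
  below 1, convexity keeps it in the disc, and \<open>star\<close> keeps it in the sector; \<rho> is
  arbitrary there because the radius varies with the base point.\<close>

lemma deform_sector:
  assumes S: "open S" and c: "cmod c < 1"
    and star: "\<And>z s \<rho>. z \<in> S \<Longrightarrow> 0 \<le> s \<Longrightarrow> s \<le> 1 \<Longrightarrow> \<rho> > 0 \<Longrightarrow> (1 - of_real s) * z + of_real s * (of_real \<rho> * c) \<in> S"
    and ray: "\<And>\<rho>. \<rho> > 0 \<Longrightarrow> of_real \<rho> * c \<in> S"
  shows "deform {x \<in> tube. lin_form l x \<in> S} tube"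
proof -
  obtain \<tau> :: "real \<Rightarrow> real" where \<tau>: "smooth_on UNIV \<tau>" "\<tau> 0 = 0" "\<tau> 1 = 1" "\<And>t. 0 \<le> \<tau> t \<and> \<tau> t \<le> 1"
    using unit_step by metis
  define z where "z = (\<lambda>p :: (complex ^ 'm) \<times> real.
     (1 - of_real (\<tau> (snd p))) * lin_form l (fst p) + of_real (\<tau> (snd p)) * (of_real (radius (fst p)) * c))"
  define H where "H = (\<lambda>p. proj (fst p) + z p *s e)"
  have o: "open (tube \<times> (UNIV :: real set))" by (intro open_Times open_tube open_UNIV)
  have z_tube: "cmod (z (x, t)) < radius x" if "x \<in> tube" for x t
  proof -
    have x: "cmod (lin_form l x) < radius x" using that by (simp add: tube_def)
    then have r: "radius x > 0" by (metis norm_ge_zero le_less_trans)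
    have t: "0 \<le> \<tau> t" "\<tau> t \<le> 1" using \<tau>(4) by auto
    have "z (x, t) = (1 - \<tau> t) *\<^sub>R lin_form l x + \<tau> t *\<^sub>R (radius x *\<^sub>R c)"
      by (simp add: z_def scaleR_conv_of_real)
    also have "cmod \<dots> < radius x"
      using convexD[OF convex_ball[of 0 "radius x"], of "lin_form l x" "radius x *\<^sub>R c" "1 - \<tau> t" "\<tau> t"]
        x r t c by (simp add: abs_of_pos)
    finally show ?thesis .
  qed
  have H_tube: "H (x, t) \<in> tube" if "x \<in> tube" for x t
    using z_tube[OF that, of t] by (simp only: H_def tube_def mem_Collect_eq fst_conv lin_form_l radius_proj)
  have H_S: "lin_form l (H (x, t)) \<in> S" if "x \<in> tube" "lin_form l x \<in> S" for x t
  proof -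
    have "radius x > 0" using tube_cylinder[OF that(1)] by (simp add: radius_pos_iff)
    then have "z (x, t) \<in> S" using star[OF that(2), of "\<tau> t" "radius x"] \<tau>(4)[of t] by (simp add: z_def)
    then show ?thesis by (simp only: H_def lin_form_l)
  qed
  have "smooth_on (tube \<times> UNIV) (\<lambda>p :: (complex ^ 'm) \<times> real. \<tau> (snd p))"
    by (rule smooth_on_compose[OF o open_UNIV _ \<tau>(1)]) (auto intro: smooth_on_snd smooth_on_id o)
  then have "smooth_on (tube \<times> UNIV) H"
    unfolding H_def z_def
    by (intro smooth_on_add smooth_on_scale_vec smooth_on_proj smooth_on_mult smooth_on_diff smooth_on_const
        smooth_on_of_real smooth_on_lin_form smooth_on_radius smooth_on_fst smooth_on_id o)
  moreover have "H (x, 0) = x" for x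
    using proj_decomp[of x] by (simp add: H_def z_def \<tau>)
  moreover have "lin_form l (H (x, 1)) \<in> S" if "x \<in> tube" for x
  proof -
    have "radius x > 0" using tube_cylinder[OF that(1)] by (simp add: radius_pos_iff)
    then have "z (x, 1) \<in> S" using ray by (simp add: z_def \<tau>)
    then show ?thesis by (simp only: H_def lin_form_l)
  qed
  moreover have "open {x \<in> tube. lin_form l x \<in> S}"
    using continuous_open_preimage[OF continuous_lin_form open_tube S] by (simp add: vimage_def Int_def)
  ultimately show ?thesis
    unfolding deform_def using open_tube H_tube H_S by (intro conjI exI[of _ H]) auto
qed

text \<open>Shrinking the fibre coordinate to 0 leaves \<open>proj x\<close> unchanged, hence also
  the radius and the condition defining the cylinder.\<close>

lemma deform_tube_cylinder: "deform tube cylinder"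
proof -
  obtain \<tau> :: "real \<Rightarrow> real" where \<tau>: "smooth_on UNIV \<tau>" "\<tau> 0 = 0" "\<tau> 1 = 1" "\<And>t. 0 \<le> \<tau> t \<and> \<tau> t \<le> 1"
    using unit_step by metis
  define z where "z = (\<lambda>p :: (complex ^ 'm) \<times> real. of_real (1 - \<tau> (snd p)) * lin_form l (fst p))"
  define H where "H = (\<lambda>p. proj (fst p) + z p *s e)"
  have o: "open (cylinder \<times> (UNIV :: real set))"
    unfolding cylinder_def by (intro open_Times open_arrangement open_UNIV)
  have H_cyl: "H (x, t) \<in> cylinder" if "x \<in> cylinder" for x t
    using that by (simp only: H_def cylinder_iff proj_add fst_conv)
  have H_tube: "H (x, t) \<in> tube" if "x \<in> tube" for x t
  proof -
    have "cmod (of_real (1 - \<tau> t)) \<le> 1" unfolding norm_of_real using \<tau>(4)[of t] by auto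
    then have "cmod (z (x, t)) \<le> 1 * cmod (lin_form l x)"
      unfolding z_def norm_mult fst_conv snd_conv by (intro mult_right_mono) auto
    then show ?thesis using that by (simp only: H_def tube_def mem_Collect_eq fst_conv lin_form_l radius_proj)
  qed
  have H1: "H (x, 1) \<in> tube" if "x \<in> cylinder" for x
  proof -
    have "z (x, 1) = 0" by (simp add: z_def \<tau>)
    moreover have "radius x > 0" using that by (simp add: radius_pos_iff)
    ultimately show ?thesis by (simp only: H_def tube_def mem_Collect_eq fst_conv lin_form_l radius_proj norm_zero)
  qed
  have "smooth_on (cylinder \<times> UNIV) (\<lambda>p :: (complex ^ 'm) \<times> real. \<tau> (snd p))"
    by (rule smooth_on_compose[OF o open_UNIV _ \<tau>(1)]) (auto intro: smooth_on_snd smooth_on_id o)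
  then have "smooth_on (cylinder \<times> UNIV) H"
    unfolding H_def z_def
    by (intro smooth_on_add smooth_on_scale_vec smooth_on_proj smooth_on_mult smooth_on_diff smooth_on_const
        smooth_on_of_real smooth_on_lin_form smooth_on_fst smooth_on_id o)
  moreover have "H (x, 0) = x" for x
    using proj_decomp[of x] by (simp add: H_def z_def \<tau>)
  ultimately show ?thesis
    unfolding deform_def using open_tube H_cyl H_tube H1 tube_cylinder open_arrangement[folded cylinder_def]
    by (intro conjI exI[of _ H]) (auto simp: cylinder_def open_arrangement)
qed

lemma betti_le_arrangement_Cons:
  assumes p: "betti_le p (Suc k) (arrangement as)" and q: "betti_le q k cylinder"
  shows "betti_le (p + q) (Suc k) (arrangement (l # as))"
proof -
  let ?sec = "\<lambda>S. {x \<in> tube. lin_form l x \<in> S}"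
  \<comment> \<open>T1 omits the ray Re \<le> 0 of the real axis from each disc and T2 the ray Re
    \<ge> 0, so the overlap consists of the two open half discs. The four sectors are contracted
    towards the points 1/2, -1/2, i/2 and -i/2 of the unit disc, scaled by the radius.\<close>
  let ?T1 = "?sec {z. Re z > 0 \<or> Im z \<noteq> 0}" and ?T2 = "?sec {z. Re z < 0 \<or> Im z \<noteq> 0}"
  let ?P = "?sec {z. Im z > 0}" and ?Q = "?sec {z. Im z < 0}"
  have o: "open {z. Re z > 0 \<or> Im z \<noteq> 0}" "open {z. Re z < 0 \<or> Im z \<noteq> 0}"
    by (auto intro!: open_Collect_disj open_Collect_less open_Collect_neq continuous_intros)
  have d1: "deform ?T1 tube"
    by (rule deform_sector[OF o(1), of "1/2"]) (auto simp: add_nonneg_pos less_eq_real_def)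
  have d2: "deform ?T2 tube"
  proof (rule deform_sector[OF o(2), of "-1/2"])
    fix z :: complex and s \<rho> :: real
    assume a: "z \<in> {z. Re z < 0 \<or> Im z \<noteq> 0}" "0 \<le> s" "s \<le> 1" "\<rho> > 0"
    have "(1 - s) * Re z * 2 < s * \<rho>" if "Re z < 0"
    proof (cases "s = 0")
      case False
      then have "0 < s * \<rho>" "(1 - s) * Re z \<le> 0"
        using a that by (auto intro: mult_nonneg_nonpos)
      then show ?thesis by linarith
    qed (use that in simp)
    then show "(1 - of_real s) * z + of_real s * (of_real \<rho> * (-1/2)) \<in> {z. Re z < 0 \<or> Im z \<noteq> 0}"
      using a by (auto simp: less_eq_real_def)
  qed auto
  have dP: "deform ?P tube"
  proof (rule deform_sector[of _ "\<i>/2"])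
    fix z :: complex and s \<rho> :: real
    assume a: "z \<in> {z. Im z > 0}" "0 \<le> s" "s \<le> 1" "\<rho> > 0"
    have "(1 - s) * Im z + s * \<rho> / 2 > 0"
    proof (cases "s = 0")
      case False
      then have "0 < s * \<rho>" "(1 - s) * Im z \<ge> 0" using a by auto
      then show ?thesis by linarith
    qed (use a in simp)
    then show "(1 - of_real s) * z + of_real s * (of_real \<rho> * (\<i>/2)) \<in> {z. Im z > 0}"
      by simp
  qed (auto simp: open_halfspace_Im_gt norm_divide)
  have dQ: "deform ?Q tube"
  proof (rule deform_sector[of _ "-\<i>/2"])
    fix z :: complex and s \<rho> :: real
    assume a: "z \<in> {z. Im z < 0}" "0 \<le> s" "s \<le> 1" "\<rho> > 0"
    have "(1 - s) * Im z - s * \<rho> / 2 < 0"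
    proof (cases "s = 0")
      case False
      then have "0 < s * \<rho>" "(1 - s) * Im z \<le> 0" using a by (auto intro: mult_nonneg_nonpos)
      then show ?thesis by linarith
    qed (use a in simp)
    then show "(1 - of_real s) * z + of_real s * (of_real \<rho> * (-\<i>/2)) \<in> {z. Im z < 0}"
      by simp
  qed (auto simp: open_halfspace_Im_lt norm_divide)
  let ?M = "arrangement (l # as)"
  have M: "x \<in> ?M \<longleftrightarrow> lin_form l x \<noteq> 0 \<and> x \<in> arrangement as" for x by (simp add: arrangement_def)
  have nz: "z \<noteq> 0 \<longleftrightarrow> (Re z > 0 \<or> Im z \<noteq> 0) \<or> (Re z < 0 \<or> Im z \<noteq> 0)" for z
    by (auto simp: complex_eq_iff)
  have X: "?T1 \<union> ?T2 = ?M \<inter> tube"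
    using tube_arrangement M nz by blast
  have MT: "?M \<union> tube = arrangement as"
    using tube_arrangement arrangement_tube(2) M by blast
  have oX: "open (?T1 \<union> ?T2)" unfolding X by (intro open_Int open_arrangement open_tube)
  have lX: "lin_form l x \<noteq> 0" if "x \<in> ?T1 \<union> ?T2" for x using that unfolding X by (simp add: arrangement_def)
  have "cutoff ?T1 ?T2"
    unfolding cutoff_def
  proof (intro exI conjI ballI)
    \<comment> \<open>\<open>Im\<^sup>2 + Re\<^sup>3\<close> is negative on the negative real axis and \<open>Im\<^sup>2 - Re\<^sup>3\<close> on the positive one, and
        they add up to \<open>2 Im\<^sup>2\<close>.\<close>
    let ?a = "\<lambda>x. (Im (lin_form l x))\<^sup>2 + Re (lin_form l x) ^ 3"
    let ?b = "\<lambda>x. (Im (lin_form l x))\<^sup>2 - Re (lin_form l x) ^ 3"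
    show "smooth_on (?T1 \<union> ?T2) ?a" "smooth_on (?T1 \<union> ?T2) ?b"
      by (intro smooth_on_add smooth_on_diff smooth_on_power smooth_on_Im smooth_on_Re smooth_on_lin_form smooth_on_id oX)+
    show "?a x > 0 \<or> ?b x > 0" if "x \<in> ?T1 \<union> ?T2" for x
    proof (rule ccontr)
      assume n: "\<not> (?a x > 0 \<or> ?b x > 0)"
      then have "(Im (lin_form l x))\<^sup>2 \<le> 0" by linarith
      then have i: "Im (lin_form l x) = 0" by simp
      then have "Re (lin_form l x) ^ 3 = 0" using n by auto
      then show False using lX[OF that] i by (simp add: complex_eq_iff)
    qed
    show "?a x < 0" if "x \<in> ?T2 - ?T1" for x using that by (auto simp: power_less_zero_eq)
    show "?b x < 0" if "x \<in> ?T1 - ?T2" for x using that by auto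
  qed
  then have "relative_le q (Suc k) (?T1 \<union> ?T2) tube"
    by (rule sectors_relative_le[OF d1 d2 dP dQ _ _ _ betti_le_deform[OF deform_tube_cylinder q]]) auto
  then have rel: "relative_le q (Suc k) (?M \<inter> tube) tube" unfolding X .
  have "cutoff ?M tube"
    unfolding cutoff_def MT
  proof (intro exI conjI ballI)
    \<comment> \<open>The two functions add up to the squared absolute value of l x, so both are
      nonpositive only if l x = 0, where the radius is positive. The factor 2 makes the second one
      negative even where the absolute value of l x equals the radius, and 3 exceeds 2.\<close>
    let ?a = "\<lambda>x. 3 * (cmod (lin_form l x))\<^sup>2 - (radius x)\<^sup>2"
    let ?b = "\<lambda>x. (radius x)\<^sup>2 - 2 * (cmod (lin_form l x))\<^sup>2"
    show "smooth_on (arrangement as) ?a" "smooth_on (arrangement as) ?b"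
      by (intro smooth_on_diff smooth_on_mult smooth_on_const smooth_on_power smooth_on_norm_square smooth_on_lin_form
          smooth_on_radius smooth_on_id open_arrangement)+
    show "?a x > 0 \<or> ?b x > 0" if "x \<in> arrangement as" for x
    proof (rule ccontr)
      assume n: "\<not> (?a x > 0 \<or> ?b x > 0)"
      then have "(cmod (lin_form l x))\<^sup>2 \<le> 0" by linarith
      then have "lin_form l x = 0" by simp
      then show False using n arrangement_tube[OF that] by simp
    qed
    show "?a x < 0" if "x \<in> tube - ?M" for x
    proof -
      have "lin_form l x = 0" using that tube_arrangement by (auto simp: arrangement_def)
      then show ?thesis using arrangement_tube(1)[of x] that tube_arrangement by simp
    qed
    show "?b x < 0" if "x \<in> ?M - tube" for x
    proof -
      have l: "lin_form l x \<noteq> 0" "radius x \<le> cmod (lin_form l x)"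
        using that by (auto simp: arrangement_def tube_def)
      then have "(radius x)\<^sup>2 \<le> (cmod (lin_form l x))\<^sup>2" using radius_nonneg by (intro power_mono) auto
      moreover have "(cmod (lin_form l x))\<^sup>2 > 0" using l by simp
      ultimately show ?thesis by linarith
    qed
  qed
  then show ?thesis
    by (rule betti_le_gysin[OF open_arrangement open_tube _ rel]) (simp only: MT p)
qed

end

text \<open>Pascal's rule: deletion contributes m choose k + 1 and restriction m choose k. The
  induction runs over lists whose forms may be repeated, proportional or zero, since restriction can
  produce such forms from distinct ones.\<close>

theorem betti_le_arrangement: "betti_le (length as choose j) j (arrangement as)"
proof (induction "length as" arbitrary: as j)
  case 0
  then show ?case
    using betti_le_arrangement_0[of "[]"] betti_le_UNIV by (cases j) (auto simp: arrangement_def)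
next
  case (Suc m)
  then obtain l as' where as: "as = l # as'" "length as' = m" by (cases as) auto
  show ?case
  proof (cases j)
    case 0
    then show ?thesis using betti_le_arrangement_0 by simp
  next
    case j: (Suc k)
    show ?thesis
    proof (cases "l = 0")
      case True
      then have "arrangement as = {}" by (simp add: as arrangement_def lin_form_def)
      then show ?thesis by (simp add: betti_le_empty)
    next
      case False
      then obtain i where "l $ i \<noteq> 0" by (auto simp: vec_eq_iff)
      then have e: "lin_form l (axis i (1 / l $ i)) = 1"
        by (simp add: lin_form_def axis_def if_distrib cong: if_cong)
      have "betti_le (m choose Suc k) (Suc k) (arrangement as')" using Suc(1) as by metis
      moreover have "betti_le (m choose k) k (cylinder l (axis i (1 / l $ i)) as')"
        unfolding cylinder_def[OF e] using Suc(1) as by (metis length_map)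
      ultimately have "betti_le ((m choose Suc k) + (m choose k)) (Suc k) (arrangement (l # as'))"
        by (rule betti_le_arrangement_Cons[OF e])
      then show ?thesis by (simp add: as j add.commute)
    qed
  qed
qed

section \<open>Polynomials with linear factors\<close>

lemma poly_mapping_add_induct [case_names single add]:
  fixes p :: "'a \<Rightarrow>\<^sub>0 'b::comm_monoid_add"
  assumes s: "\<And>m c. P (Poly_Mapping.single m c)" and a: "\<And>p q. P p \<Longrightarrow> P q \<Longrightarrow> P (p + q)"
  shows "P p"
proof -
  have z: "P 0" using s[of undefined 0] by simp
  have "P (\<Sum>m\<in>K. Poly_Mapping.single m (Poly_Mapping.lookup p m))" for K
    by (induction K rule: infinite_finite_induct) (auto intro: z s a)
  moreover have "p = (\<Sum>m\<in>Poly_Mapping.keys p. Poly_Mapping.single m (Poly_Mapping.lookup p m))"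
    by (rule poly_mapping_eqI)
       (simp add: lookup_sum lookup_single when_def sum.delta' in_keys_iff cong: if_cong)
  ultimately show ?thesis by metis
qed

lemma const_poly_hom:
  "const_poly 0 = 0" "const_poly 1 = 1" "const_poly (c + d) = const_poly c + const_poly d"
  "const_poly (c * d) = const_poly c * const_poly d" "const_poly (- c) = - const_poly c"
  by (simp_all add: const_poly_def single_add mult_single single_uminus)

lemma polynomial_induct [case_names const var add mult]:
  fixes p :: "'n polynomial"
  assumes c: "\<And>c. P (const_poly c)" and v: "\<And>i. P (var_poly i)"
    and a: "\<And>p q. P p \<Longrightarrow> P q \<Longrightarrow> P (p + q)" and m: "\<And>p q. P p \<Longrightarrow> P q \<Longrightarrow> P (p * q)"
  shows "P p"
proof (induction p rule: poly_mapping_add_induct)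
  case (single t d)
  show ?case
  proof (induction t arbitrary: d rule: poly_mapping_add_induct)
    case (single i k)
    show ?case
    proof (induction k)
      case 0
      show ?case using c[of d] by (simp add: const_poly_def)
    next
      case (Suc k)
      have "Poly_Mapping.single (Poly_Mapping.single i (Suc k)) d = Poly_Mapping.single (Poly_Mapping.single i k) d * var_poly i"
        by (simp add: var_poly_def mult_single single_add[symmetric])
      then show ?case using m[OF Suc v] by metis
    qed
  next
    case (add s t)
    have "Poly_Mapping.single (s + t) d = Poly_Mapping.single s d * Poly_Mapping.single t 1"
      by (simp add: mult_single)
    then show ?case using m add by metis
  qed
qed (rule a)

definition monom_eval :: "('n option \<Rightarrow>\<^sub>0 nat) \<Rightarrow> complex ^ 'n::finite option \<Rightarrow> complex" where
  "monom_eval m z = (\<Prod>i\<in>UNIV. (z $ i) ^ Poly_Mapping.lookup m i)"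

lemma eval_poly_superset:
  "finite K \<Longrightarrow> Poly_Mapping.keys p \<subseteq> K \<Longrightarrow> eval_poly p z = (\<Sum>m\<in>K. Poly_Mapping.lookup p m * monom_eval m z)"
  unfolding eval_poly_def monom_eval_def
  by (rule sum.mono_neutral_left) (auto simp: in_keys_iff)

lemma eval_poly_add: "eval_poly (p + q) z = eval_poly p z + eval_poly q z"
proof -
  let ?K = "Poly_Mapping.keys p \<union> Poly_Mapping.keys q"
  have "Poly_Mapping.keys (p + q) \<subseteq> ?K" by (rule keys_add)
  then show ?thesis
    by (simp add: eval_poly_superset[of ?K] lookup_add algebra_simps sum.distrib)
qed

lemma eval_poly_single: "eval_poly (Poly_Mapping.single m c) z = c * monom_eval m z"
  by (subst eval_poly_superset[of "{m}"]) auto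

lemma eval_poly_mult: "eval_poly (p * q) z = eval_poly p z * eval_poly q z"
proof (induction p rule: poly_mapping_add_induct)
  case (single m c)
  show ?case
  proof (induction q rule: poly_mapping_add_induct)
    case (single n d)
    show ?case
      by (simp add: mult_single eval_poly_single monom_eval_def lookup_add power_add prod.distrib)
  qed (simp add: algebra_simps eval_poly_add)
qed (simp add: algebra_simps eval_poly_add)

lemma eval_poly_const: "eval_poly (const_poly c) z = c"
  by (simp add: const_poly_def eval_poly_single monom_eval_def)

lemma eval_poly_var: "eval_poly (var_poly i) z = z $ i"
proof -
  have "(\<Prod>j\<in>UNIV. (z $ j) ^ Poly_Mapping.lookup (Poly_Mapping.single i (1::nat)) j) = (\<Prod>j\<in>UNIV. if i = j then z $ j else 1)"
    by (rule prod.cong) (auto simp: lookup_single)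
  then show ?thesis by (simp add: var_poly_def eval_poly_single monom_eval_def)
qed

lemma eval_poly_0: "eval_poly 0 z = 0" and eval_poly_1: "eval_poly 1 z = 1"
  using eval_poly_const[of 0 z] eval_poly_const[of 1 z] by (simp_all add: const_poly_hom)

lemma eval_poly_uminus: "eval_poly (- p) z = - eval_poly p z"
  using eval_poly_add[of "- p" p z] by (simp add: eval_poly_0 eq_neg_iff_add_eq_0)

lemma eval_poly_diff: "eval_poly (p - q) z = eval_poly p z - eval_poly q z"
  using eval_poly_add[of p "- q" z] by (simp add: eval_poly_uminus)

lemma eval_poly_sum: "eval_poly (\<Sum>i\<in>I. f i) z = (\<Sum>i\<in>I. eval_poly (f i) z)"
  by (induction I rule: infinite_finite_induct) (auto simp: eval_poly_0 eval_poly_add)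

lemma eval_poly_prod: "eval_poly (\<Prod>i\<in>I. f i) z = (\<Prod>i\<in>I. eval_poly (f i) z)"
  by (induction I rule: infinite_finite_induct) (auto simp: eval_poly_1 eval_poly_mult)

text \<open>
  Substituting \<open>s\<^bsup>w i\<^esup>\<close> for the \<open>i\<close>-th variable then sends the monomials in \<open>K\<close> to distinct powers of \<open>s\<close>.
  The weights \<open>w i = t\<^bsup>\<iota> i\<^esup>\<close> work for all but finitely many \<open>t\<close>.
\<close>

lemma separating_weights:
  fixes K :: "('i::finite \<Rightarrow>\<^sub>0 nat) set"
  assumes "finite K"
  obtains w :: "'i \<Rightarrow> nat" where "inj_on (\<lambda>m. \<Sum>i\<in>UNIV. w i * Poly_Mapping.lookup m i) K"
proof -
  obtain \<iota> :: "'i \<Rightarrow> nat" where \<iota>: "inj \<iota>" using finite_imp_inj_to_nat_seg[of "UNIV :: 'i set"] by auto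
  define d :: "('i \<Rightarrow>\<^sub>0 nat) \<Rightarrow> ('i \<Rightarrow>\<^sub>0 nat) \<Rightarrow> real poly"
    where "d = (\<lambda>m m'. \<Sum>i\<in>UNIV. monom (real (Poly_Mapping.lookup m i) - real (Poly_Mapping.lookup m' i)) (\<iota> i))"
  have d0: "d m m' \<noteq> 0" if mm: "m \<noteq> m'" for m m'
  proof -
    obtain i where i: "Poly_Mapping.lookup m i \<noteq> Poly_Mapping.lookup m' i"
      using mm by (metis poly_mapping_eqI)
    have "coeff (d m m') (\<iota> i) = (\<Sum>j\<in>UNIV. if j = i then real (Poly_Mapping.lookup m i) - real (Poly_Mapping.lookup m' i) else 0)"
      unfolding d_def coeff_sum by (rule sum.cong) (use \<iota> in \<open>auto simp: inj_eq\<close>)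
    then have "coeff (d m m') (\<iota> i) \<noteq> 0" using i by simp
    then show ?thesis by auto
  qed
  have "finite (\<Union>(m, m')\<in>{(m, m') \<in> K \<times> K. m \<noteq> m'}. {t. poly (d m m') t = 0})"
    by (rule finite_UN_I[OF finite_subset[OF _ finite_cartesian_product[OF assms assms]]])
       (auto intro: poly_roots_finite[OF d0])
  moreover have "infinite (range real)" using infinite_UNIV_nat finite_imageD inj_of_nat by blast
  ultimately obtain t where t: "real t \<notin> (\<Union>(m, m')\<in>{(m, m') \<in> K \<times> K. m \<noteq> m'}. {t. poly (d m m') t = 0})"
    by (metis (no_types, lifting) finite_subset image_subsetI)
  show thesis
  proof (rule that[of "\<lambda>i. t ^ \<iota> i"], rule inj_onI, rule ccontr)
    fix m m' assume m: "m \<in> K" "m' \<in> K" "m \<noteq> m'"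
      and eq: "(\<Sum>i\<in>UNIV. t ^ \<iota> i * Poly_Mapping.lookup m i) = (\<Sum>i\<in>UNIV. t ^ \<iota> i * Poly_Mapping.lookup m' i)"
    have "poly (d m m') (real t) = real (\<Sum>i\<in>UNIV. t ^ \<iota> i * Poly_Mapping.lookup m i) - real (\<Sum>i\<in>UNIV. t ^ \<iota> i * Poly_Mapping.lookup m' i)"
      by (simp add: d_def poly_sum poly_monom algebra_simps sum_subtractf)
    then have "poly (d m m') (real t) = 0" using eq by simp
    then show False using t m by blast
  qed
qed

text \<open>Kronecker substitution: powers of one variable with separating exponents turn p into a
  nonzero univariate polynomial with the same coefficients, which has to vanish identically.\<close>

lemma eval_poly_eq_0:
  fixes p :: "'n::finite polynomial"
  assumes "\<And>z. eval_poly p z = 0" shows "p = 0"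
proof (rule ccontr)
  assume "p \<noteq> 0"
  then obtain m0 where m0: "m0 \<in> Poly_Mapping.keys p" by (metis ex_in_conv keys_eq_empty)
  let ?K = "Poly_Mapping.keys p"
  obtain w :: "'n option \<Rightarrow> nat" where w: "inj_on (\<lambda>m. \<Sum>i\<in>UNIV. w i * Poly_Mapping.lookup m i) ?K"
    using separating_weights[OF finite_keys] by metis
  let ?wt = "\<lambda>m. \<Sum>i\<in>UNIV. w i * Poly_Mapping.lookup m i"
  define q where "q = (\<Sum>m\<in>?K. monom (Poly_Mapping.lookup p m) (?wt m))"
  have "coeff q (?wt m0) = (\<Sum>m\<in>?K. if m = m0 then Poly_Mapping.lookup p m0 else 0)"
    unfolding q_def coeff_sum by (rule sum.cong) (use w m0 in \<open>auto dest: inj_onD\<close>)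
  then have "coeff q (?wt m0) \<noteq> 0" using m0 by (simp add: in_keys_iff)
  then have "q \<noteq> 0" by auto
  moreover have "poly q s = eval_poly p (\<chi> i. s ^ w i)" for s
    by (simp add: q_def poly_sum poly_monom eval_poly_def power_mult power_sum)
  ultimately show False using assms poly_all_0_iff_0[of q] by simp
qed

lemma eval_poly_line: "\<exists>q. \<forall>t. eval_poly p (a + t *s (b - a)) = poly q t"
proof (induction p rule: polynomial_induct)
  case (const c)
  show ?case by (rule exI[of _ "[:c:]"]) (simp add: eval_poly_const)
next
  case (var i)
  show ?case by (rule exI[of _ "[:a $ i, b $ i - a $ i:]"]) (simp add: eval_poly_var algebra_simps)
next
  case (add p q)
  then obtain f g where "\<And>t. eval_poly p (a + t *s (b - a)) = poly f t" "\<And>t. eval_poly q (a + t *s (b - a)) = poly g t"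
    by blast
  then show ?case by (intro exI[of _ "f + g"]) (simp only: eval_poly_add poly_add simp_thms)
next
  case (mult p q)
  then obtain f g where "\<And>t. eval_poly p (a + t *s (b - a)) = poly f t" "\<And>t. eval_poly q (a + t *s (b - a)) = poly g t"
    by blast
  then show ?case by (intro exI[of _ "f * g"]) (simp only: eval_poly_mult poly_mult simp_thms)
qed

text \<open>On the line through a and b both polynomials become univariate and nonzero. The point is
  provided on this line because the line stays in every hyperplane that contains a and b.\<close>

lemma eval_poly_common_nonzero:
  assumes "eval_poly p a \<noteq> 0" "eval_poly q b \<noteq> 0"
  obtains t where "eval_poly p (a + t *s (b - a)) \<noteq> 0" "eval_poly q (a + t *s (b - a)) \<noteq> 0"
proof -
  obtain f g where fg: "\<And>t. eval_poly p (a + t *s (b - a)) = poly f t" "\<And>t. eval_poly q (a + t *s (b - a)) = poly g t"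
    using eval_poly_line by metis
  have "a + 0 *s (b - a) = a" "a + 1 *s (b - a) = b" by (simp_all add: vec_eq_iff)
  then have "poly f 0 \<noteq> 0" "poly g 1 \<noteq> 0" using assms fg by metis+
  then have "f * g \<noteq> 0" by auto
  then obtain t where "poly (f * g) t \<noteq> 0" using poly_all_0_iff_0 by blast
  then show thesis using that[of t] fg by simp
qed

section \<open>Divisibility by linear forms\<close>

lemma polynomial_no_zero_divisors:
  fixes p q :: "'n::finite polynomial"
  assumes "p * q = 0" shows "p = 0 \<or> q = 0"
proof (rule ccontr)
  assume "\<not> (p = 0 \<or> q = 0)"
  then obtain a b where "eval_poly p a \<noteq> 0" "eval_poly q b \<noteq> 0" using eval_poly_eq_0 by metis
  then obtain t where "eval_poly p (a + t *s (b - a)) * eval_poly q (a + t *s (b - a)) \<noteq> 0"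
    using eval_poly_common_nonzero by (metis mult_eq_0_iff)
  then show False using assms by (simp add: eval_poly_mult[symmetric] eval_poly_0)
qed

lemma polynomial_mult_cancel:
  fixes p q r :: "'n::finite polynomial"
  assumes "r \<noteq> 0" "r * p = r * q" shows "p = q"
  using polynomial_no_zero_divisors[of r "p - q"] assms by (simp add: algebra_simps)

text \<open>With the coefficient of \<open>z_0\<close> normalised to 1, associated factors of this
  kind are equal, so they can be counted by \<open>lam\<close>.\<close>

definition lin_poly :: "('n::finite \<Rightarrow> complex) \<Rightarrow> 'n polynomial" where
  "lin_poly lam = var_poly None + (\<Sum>i\<in>UNIV. var_poly (Some i) * const_poly (lam i))"

lemma eval_lin_poly: "eval_poly (lin_poly lam) z = z $ None + (\<Sum>i\<in>UNIV. z $ Some i * lam i)"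
  by (simp add: lin_poly_def eval_poly_add eval_poly_sum eval_poly_mult eval_poly_var eval_poly_const)

text \<open>Division by a polynomial that is monic of degree 1 in \<open>z_0\<close>. That the
  remainder is free of \<open>z_0\<close> is expressed through its values, the form in which it is
  used.\<close>

lemma lin_poly_remainder:
  "\<exists>r. lin_poly lam dvd p - r \<and> (\<forall>z z'. (\<forall>i. z $ Some i = z' $ Some i) \<longrightarrow> eval_poly r z = eval_poly r z')"
proof (induction p rule: polynomial_induct)
  case (const c)
  show ?case by (rule exI[of _ "const_poly c"]) (simp add: eval_poly_const)
next
  case (var i)
  show ?case
  proof (cases i)
    case None
    show ?thesis
      by (rule exI[of _ "var_poly i - lin_poly lam"])
         (simp add: None lin_poly_def eval_poly_uminus eval_poly_diff eval_poly_add eval_poly_sum eval_poly_mult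
           eval_poly_var eval_poly_const)
  next
    case (Some j)
    show ?thesis by (rule exI[of _ "var_poly i"]) (simp add: Some eval_poly_var)
  qed
next
  case (add p q)
  then obtain r s where r: "lin_poly lam dvd p - r" "lin_poly lam dvd q - s"
    "\<forall>z z'. (\<forall>i. z $ Some i = z' $ Some i) \<longrightarrow> eval_poly r z = eval_poly r z'"
    "\<forall>z z'. (\<forall>i. z $ Some i = z' $ Some i) \<longrightarrow> eval_poly s z = eval_poly s z'" by blast
  have "p + q - (r + s) = (p - r) + (q - s)" by (simp add: algebra_simps)
  then have "lin_poly lam dvd p + q - (r + s)" using r dvd_add by metis
  moreover have "\<forall>z z'. (\<forall>i. z $ Some i = z' $ Some i) \<longrightarrow> eval_poly (r + s) z = eval_poly (r + s) z'"
    using r(3,4) unfolding eval_poly_add by metis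
  ultimately show ?case by blast
next
  case (mult p q)
  then obtain r s where r: "lin_poly lam dvd p - r" "lin_poly lam dvd q - s"
    "\<forall>z z'. (\<forall>i. z $ Some i = z' $ Some i) \<longrightarrow> eval_poly r z = eval_poly r z'"
    "\<forall>z z'. (\<forall>i. z $ Some i = z' $ Some i) \<longrightarrow> eval_poly s z = eval_poly s z'" by blast
  have "p * q - r * s = (p - r) * q + r * (q - s)" by (simp add: algebra_simps)
  then have "lin_poly lam dvd p * q - r * s" using r by (metis dvd_add dvd_mult dvd_mult2)
  moreover have "\<forall>z z'. (\<forall>i. z $ Some i = z' $ Some i) \<longrightarrow> eval_poly (r * s) z = eval_poly (r * s) z'"
    using r(3,4) unfolding eval_poly_mult by metis
  ultimately show ?case by blast
qed

text \<open>Every choice of the coordinates other than \<open>z_0\<close> extends to a point of the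
  hyperplane, and the remainder depends on these coordinates alone. If p vanishes on the hyperplane,
  the remainder therefore vanishes everywhere.\<close>

lemma lin_poly_dvd_iff: "lin_poly lam dvd p \<longleftrightarrow> (\<forall>z. eval_poly (lin_poly lam) z = 0 \<longrightarrow> eval_poly p z = 0)"
proof
  assume "lin_poly lam dvd p"
  then show "\<forall>z. eval_poly (lin_poly lam) z = 0 \<longrightarrow> eval_poly p z = 0"
    by (auto simp: dvd_def eval_poly_mult)
next
  assume v: "\<forall>z. eval_poly (lin_poly lam) z = 0 \<longrightarrow> eval_poly p z = 0"
  obtain r where r: "lin_poly lam dvd p - r"
    "\<And>z z'. (\<forall>i. z $ Some i = z' $ Some i) \<Longrightarrow> eval_poly r z = eval_poly r z'"
    using lin_poly_remainder by blast
  have "eval_poly r z = 0" for z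
  proof -
    define z' where "z' = (\<chi> i. case i of None \<Rightarrow> - (\<Sum>i\<in>UNIV. z $ Some i * lam i) | Some j \<Rightarrow> z $ Some j)"
    have "eval_poly (lin_poly lam) z' = 0" by (simp add: eval_lin_poly z'_def)
    moreover from this have "eval_poly (p - r) z' = 0" using r(1) by (auto simp: dvd_def eval_poly_mult)
    ultimately have "eval_poly r z' = 0" using v by (simp add: eval_poly_diff)
    then show ?thesis using r(2)[of z z'] by (simp add: z'_def)
  qed
  then have "r = 0" by (rule eval_poly_eq_0)
  then show "lin_poly lam dvd p" using r(1) by simp
qed

text \<open>A hyperplane is irreducible: points of it where p, respectively q, is nonzero are joined
  by a line inside it, and on that line some point makes both nonzero.\<close>

lemma lin_poly_prime:
  assumes "lin_poly lam dvd p * q" shows "lin_poly lam dvd p \<or> lin_poly lam dvd q"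
proof (rule ccontr)
  assume "\<not> (lin_poly lam dvd p \<or> lin_poly lam dvd q)"
  then obtain a b where ab: "eval_poly (lin_poly lam) a = 0" "eval_poly p a \<noteq> 0"
    "eval_poly (lin_poly lam) b = 0" "eval_poly q b \<noteq> 0"
    using lin_poly_dvd_iff by metis
  obtain t where t: "eval_poly p (a + t *s (b - a)) \<noteq> 0" "eval_poly q (a + t *s (b - a)) \<noteq> 0"
    using eval_poly_common_nonzero[OF ab(2,4)] by metis
  have "eval_poly (lin_poly lam) (a + t *s (b - a)) =
     (1 - t) * eval_poly (lin_poly lam) a + t * eval_poly (lin_poly lam) b"
    by (simp add: eval_lin_poly algebra_simps sum.distrib sum_subtractf sum_distrib_left)
  then have "eval_poly (lin_poly lam) (a + t *s (b - a)) = 0" using ab by simp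
  then have "eval_poly (p * q) (a + t *s (b - a)) = 0" using assms lin_poly_dvd_iff by blast
  then show False using t by (simp add: eval_poly_mult)
qed

lemma lin_poly_not_unit: "\<not> lin_poly lam dvd 1"
proof -
  have "eval_poly (lin_poly lam) 0 = 0" by (simp add: eval_lin_poly)
  then show ?thesis using lin_poly_dvd_iff[of lam 1] by (metis eval_poly_1 zero_neq_one)
qed

lemma lin_poly_nonzero: "lin_poly lam \<noteq> 0"
proof
  assume "lin_poly lam = 0"
  then have "eval_poly (lin_poly lam) (axis None 1) = 0" by (simp add: eval_poly_0)
  then show False by (simp add: eval_lin_poly axis_def)
qed

lemma irreducible_lin_poly: "irreducible (lin_poly lam)"
proof (rule irreducibleI[OF lin_poly_nonzero lin_poly_not_unit])
  fix a b assume ab: "lin_poly lam = a * b"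
  have unit: "y dvd 1" if xy: "lin_poly lam = x * y" "lin_poly lam dvd x" for x y
  proof -
    obtain c where c: "x = lin_poly lam * c" using xy(2) by (elim dvdE)
    have "lin_poly lam * (c * y) = lin_poly lam * 1" using xy(1) c by (simp add: mult.assoc)
    then have "c * y = 1" using polynomial_mult_cancel[OF lin_poly_nonzero] by blast
    then show ?thesis by (metis dvd_triv_right)
  qed
  have "lin_poly lam dvd a \<or> lin_poly lam dvd b" using lin_poly_prime[of lam a b] ab by simp
  then show "a dvd 1 \<or> b dvd 1" using unit[of a b] unit[of b a] ab by (auto simp: mult.commute)
qed

lemma lin_poly_dvd_lin_poly:
  assumes "lin_poly lam dvd lin_poly mu" shows "lam = mu"
proof
  fix i
  \<comment> \<open>A point of the hyperplane of \<open>lam\<close> whose coordinates other than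
    \<open>z_0\<close> are those of a unit vector; the form of \<open>mu\<close> takes the value mu
    i - lam i there.\<close>
  define z where "z = (\<chi> j. case j of None \<Rightarrow> - lam i | Some k \<Rightarrow> if k = i then 1 else 0)"
  have e: "eval_poly (lin_poly nu) z = - lam i + nu i" for nu
    by (simp add: eval_lin_poly z_def if_distrib[of "\<lambda>x. x * _"] cong: if_cong)
  have "eval_poly (lin_poly mu) z = 0" using assms lin_poly_dvd_iff e[of lam] by fastforce
  then show "lam i = mu i" using e[of mu] by simp
qed

text \<open>Primality is known for the linear factors, not for f. So they are cancelled from the
  equation with f * g one at a time until one of them divides f, and irreducibility of f then makes
  the two associated.\<close>

lemma irreducible_dvd_prod_lin_poly:
  assumes "finite I" "irreducible f" "f dvd (\<Prod>k\<in>I. lin_poly (lam k))"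
  shows "\<exists>k\<in>I. f dvd lin_poly (lam k) \<and> lin_poly (lam k) dvd f"
  using assms(1,3)
proof (induction I rule: finite_induct)
  case empty
  then show ?case using assms(2) by (auto simp: irreducible_def)
next
  case (insert i I)
  then obtain g where g: "lin_poly (lam i) * (\<Prod>k\<in>I. lin_poly (lam k)) = f * g" by (auto elim!: dvdE)
  then have "lin_poly (lam i) dvd f * g" by (metis dvd_triv_left)
  then consider "lin_poly (lam i) dvd f" | "lin_poly (lam i) dvd g" using lin_poly_prime by blast
  then show ?case
  proof cases
    case 1
    then obtain c where c: "f = lin_poly (lam i) * c" by (elim dvdE)
    then have "c dvd 1" using assms(2) lin_poly_not_unit by (auto simp: irreducible_def)
    then obtain d where "1 = c * d" by (elim dvdE)
    then have "lin_poly (lam i) = f * d" using c by (simp add: mult.assoc)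
    then have "f dvd lin_poly (lam i)" by (metis dvd_triv_left)
    then show ?thesis using 1 by blast
  next
    case 2
    then obtain h where "g = lin_poly (lam i) * h" by (elim dvdE)
    then have "lin_poly (lam i) * (\<Prod>k\<in>I. lin_poly (lam k)) = lin_poly (lam i) * (f * h)"
      using g by (simp add: algebra_simps)
    then have "(\<Prod>k\<in>I. lin_poly (lam k)) = f * h" using polynomial_mult_cancel[OF lin_poly_nonzero] by blast
    then have "f dvd (\<Prod>k\<in>I. lin_poly (lam k))" by (metis dvd_triv_left)
    then show ?thesis using insert.IH by blast
  qed
qed

lemma num_irreducible_factors_prod:
  assumes "finite I"
  shows "num_irreducible_factors (\<Prod>k\<in>I. lin_poly (lam k)) = card (lam ` I)"
proof -
  let ?q = "\<Prod>k\<in>I. lin_poly (lam k)"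
  let ?R = "{(f, g :: 'b polynomial). f dvd g \<and> g dvd f}"
  let ?S = "{f. irreducible f \<and> f dvd ?q}"
  have "?S // ?R = (\<lambda>mu. ?R `` {lin_poly mu}) ` (lam ` I)"
  proof (intro equalityI subsetI)
    fix A assume "A \<in> ?S // ?R"
    then obtain f where f: "f \<in> ?S" "A = ?R `` {f}" by (auto elim!: quotientE)
    then obtain k where k: "k \<in> I" "f dvd lin_poly (lam k)" "lin_poly (lam k) dvd f"
      using irreducible_dvd_prod_lin_poly[OF assms] by blast
    then have "?R `` {f} = ?R `` {lin_poly (lam k)}" by (auto intro: dvd_trans)
    then show "A \<in> (\<lambda>mu. ?R `` {lin_poly mu}) ` (lam ` I)" using f k by blast
  next
    fix A assume "A \<in> (\<lambda>mu. ?R `` {lin_poly mu}) ` (lam ` I)"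
    then obtain k where k: "k \<in> I" "A = ?R `` {lin_poly (lam k)}" by blast
    have "lin_poly (lam k) \<in> ?S" using irreducible_lin_poly dvd_prodI[OF assms k(1), of "\<lambda>k. lin_poly (lam k)"] by blast
    then show "A \<in> ?S // ?R" using k(2) by (simp only: quotientI)
  qed
  moreover have "inj_on (\<lambda>mu. ?R `` {lin_poly mu}) (lam ` I)"
  proof (rule inj_onI)
    fix mu nu assume "?R `` {lin_poly mu} = ?R `` {lin_poly nu}"
    moreover have "lin_poly nu \<in> ?R `` {lin_poly nu}" by simp
    ultimately have "lin_poly mu dvd lin_poly nu" by blast
    then show "mu = nu" by (rule lin_poly_dvd_lin_poly)
  qed
  ultimately show ?thesis unfolding num_irreducible_factors_def by (simp add: card_image)
qed

lemma lin_poly_zero: "lin_poly (\<lambda>_. 0) = var_poly None"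
  by (simp add: lin_poly_def const_poly_hom)

lemma var_None_dvd_prod:
  assumes "finite I" "var_poly None dvd (\<Prod>k\<in>I. lin_poly (lam k))"
  shows "\<exists>k\<in>I. lam k = (\<lambda>_. 0)"
proof -
  from irreducible_dvd_prod_lin_poly[OF assms(1) irreducible_lin_poly, of "\<lambda>_. 0" lam] assms(2)
  obtain k where "k \<in> I" "lin_poly (\<lambda>_. 0) dvd lin_poly (lam k)" unfolding lin_poly_zero by blast
  then show ?thesis using lin_poly_dvd_lin_poly by metis
qed

text \<open>The description by \<open>THE\<close> requires uniqueness: after cancelling common
  powers, \<open>z_0\<close> is left on one side at most, where it would divide the cofactor of the
  other side.\<close>

lemma z0_free_part_prod:
  assumes "finite I"
  shows "z0_free_part (\<Prod>k\<in>I. lin_poly (lam k)) = (\<Prod>k\<in>{k \<in> I. lam k \<noteq> (\<lambda>_. 0)}. lin_poly (lam k))"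
    (is "z0_free_part ?q = ?p")
  unfolding z0_free_part_def
proof (rule the_equality)
  let ?z = "var_poly None :: 'b polynomial"
  have z0: "?z \<noteq> 0" using lin_poly_nonzero[of "\<lambda>_. 0"] by (simp add: lin_poly_zero)
  have "?q = (\<Prod>k\<in>{k \<in> I. lam k = (\<lambda>_. 0)}. lin_poly (lam k)) * ?p"
    using assms by (subst prod.union_disjoint[symmetric]) (auto intro: prod.cong)
  also have "(\<Prod>k\<in>{k \<in> I. lam k = (\<lambda>_. 0)}. lin_poly (lam k)) = (\<Prod>k\<in>{k \<in> I. lam k = (\<lambda>_. 0)}. ?z)"
    by (rule prod.cong) (auto simp: lin_poly_zero)
  finally have q: "?q = ?z ^ card {k \<in> I. lam k = (\<lambda>_. 0)} * ?p" by simp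
  have p: "\<not> ?z dvd ?p" using var_None_dvd_prod[of "{k \<in> I. lam k \<noteq> (\<lambda>_. 0)}" lam] assms by auto
  show "(\<exists>a. ?q = ?z ^ a * ?p) \<and> \<not> ?z dvd ?p" using q p by blast
  have uniq: "p' = p''" if "?z ^ a * p' = ?z ^ b * p''" "\<not> ?z dvd p'" "\<not> ?z dvd p''" for a b p' p''
    using that
  proof (induction a b rule: diff_induct)
    case (1 a)
    show ?case
    proof (cases a)
      case (Suc c)
      then have "?z * (?z ^ c * p') = p''" using 1(1) by (simp add: mult.assoc)
      then show ?thesis using 1(3) by (metis dvd_triv_left)
    qed (use 1 in simp)
  next
    case (2 b)
    then have "p' = ?z * (?z ^ b * p'')" by (simp add: mult.assoc)
    then show ?case using 2(2) by (metis dvd_triv_left)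
  next
    case (3 a b)
    have "?z * (?z ^ a * p') = ?z * (?z ^ b * p'')" using 3(2) by (simp add: mult.assoc)
    then show ?case using 3 polynomial_mult_cancel[OF z0] by blast
  qed
  fix p' assume a: "(\<exists>a. ?q = ?z ^ a * p') \<and> \<not> ?z dvd p'"
  then obtain a where "?z ^ a * p' = ?q" by metis
  also note q
  finally show "p' = ?p" by (rule uniq) (use a p in blast)+
qed

section \<open>Lie's theorem for the adjoint representation\<close>

context complex_lie_algebra
begin

section \<open>Identities for the bracket\<close>

lemma bracket_add_right: "bracket x (y + z) = bracket x y + bracket x z"
  and bracket_scale_right: "bracket x (smul c y) = smul c (bracket x y)"
  using linear_bracket_right[of x] unfolding Vector_Spaces.linear_iff by auto

lemma bracket_add_left: "bracket (x + y) z = bracket x z + bracket y z"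
  and bracket_scale_left: "bracket (smul c x) z = smul c (bracket x z)"
  using linear_bracket_left[of z] unfolding Vector_Spaces.linear_iff by auto

lemma bracket_zero_right: "bracket x 0 = 0"
  using bracket_scale_right[of x 0 0] by simp

lemma bracket_zero_left: "bracket 0 x = 0"
  using bracket_scale_left[of 0 0 x] by simp

lemma bracket_diff_right: "bracket x (y - z) = bracket x y - bracket x z"
  using bracket_add_right[of x "y - z" z] by simp

lemma bracket_sum_right: "bracket x (\<Sum>i\<in>I. f i) = (\<Sum>i\<in>I. bracket x (f i))"
  by (induction I rule: infinite_finite_induct) (auto simp: bracket_zero_right bracket_add_right)

lemma bracket_sum_left: "bracket (\<Sum>i\<in>I. f i) x = (\<Sum>i\<in>I. bracket (f i) x)"
  by (induction I rule: infinite_finite_induct) (auto simp: bracket_zero_left bracket_add_left)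

lemma bracket_commute: "bracket x y = - bracket y x"
proof -
  have "bracket (x + y) (x + y) = bracket x y + bracket y x"
    by (simp only: bracket_add_left bracket_add_right) (simp add: bracket_self)
  then show ?thesis using bracket_self[of "x + y"] by (metis eq_neg_iff_add_eq_0)
qed

lemma bracket_minus_right: "bracket x (- y) = - bracket x y"
  using bracket_scale_right[of x "-1" y] by simp

lemma jacobi_bracket: "bracket x (bracket y z) = bracket y (bracket x z) + bracket (bracket x y) z"
proof -
  have 1: "bracket y (bracket z x) = - bracket y (bracket x z)"
    by (subst bracket_commute[of z x]) (rule bracket_minus_right)
  have 2: "bracket z (bracket x y) = - bracket (bracket x y) z" by (rule bracket_commute)
  have "bracket x (bracket y z) - (bracket y (bracket x z) + bracket (bracket x y) z) =
      bracket x (bracket y z) + bracket y (bracket z x) + bracket z (bracket x y)"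
    unfolding 1 2 by simp
  then show ?thesis unfolding jacobi by simp
qed

definition lie_ideal :: "'a set \<Rightarrow> bool" where
  "lie_ideal W \<longleftrightarrow> subspace W \<and> (\<forall>x. \<forall>w\<in>W. bracket x w \<in> W)"

text \<open>A chain in which each member is normalised by the vector added next, so it is an ideal
  of codimension at most 1 in its successor. Lie's theorem is proved by induction along such a
  chain.\<close>

inductive soluble_subspace :: "'a set \<Rightarrow> bool" where
  zero: "soluble_subspace {0}"
| step: "soluble_subspace L \<Longrightarrow> (\<And>x. x \<in> L \<Longrightarrow> bracket x y \<in> L) \<Longrightarrow> soluble_subspace (span (insert y L))"

lemma soluble_subspace_subspace: "soluble_subspace L \<Longrightarrow> subspace L"
  by (induction rule: soluble_subspace.induct) (auto simp: subspace_single_0)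

text \<open>The vector p(ad y) v, by Horner's scheme.\<close>

definition ad_poly :: "'a \<Rightarrow> 'a \<Rightarrow> complex poly \<Rightarrow> 'a" where
  "ad_poly y v p = fold_coeffs (\<lambda>c w. smul c v + bracket y w) p 0"

lemma ad_poly_0: "ad_poly y v 0 = 0"
  by (simp add: ad_poly_def)

lemma ad_poly_pCons: "ad_poly y v (pCons c p) = smul c v + bracket y (ad_poly y v p)"
  by (cases "c = 0 \<and> p = 0") (auto simp: ad_poly_def bracket_zero_right)

lemma ad_poly_add: "ad_poly y v (p + q) = ad_poly y v p + ad_poly y v q"
  by (induction p q rule: poly_induct2)
     (simp_all add: ad_poly_0 ad_poly_pCons bracket_add_right scale_left_distrib algebra_simps)

lemma ad_poly_smult: "ad_poly y v (smult c p) = smul c (ad_poly y v p)"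
  by (induction p)
     (simp_all add: ad_poly_0 ad_poly_pCons bracket_scale_right scale_right_distrib)

lemma ad_poly_linear_factor:
  "ad_poly y v ([:- c, 1:] * p) = bracket y (ad_poly y v p) - smul c (ad_poly y v p)"
proof -
  have "[:- c, 1:] * p = pCons 0 p + smult (- c) p" by simp
  then show ?thesis by (simp only: ad_poly_add ad_poly_smult ad_poly_pCons) simp
qed

lemma ad_poly_monom: "ad_poly y v (monom 1 n) = (bracket y ^^ n) v"
  by (induction n) (simp_all add: monom_0 monom_Suc ad_poly_pCons ad_poly_0 bracket_zero_right)

lemma ad_poly_closed:
  assumes "subspace E" "v \<in> E" "\<And>w. w \<in> E \<Longrightarrow> bracket y w \<in> E"
  shows "ad_poly y v p \<in> E"
proof (induction p)
  case (pCons c p)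
  show ?case unfolding ad_poly_pCons
    by (intro subspace_add[OF assms(1)] subspace_scale[OF assms(1)] assms(2,3) pCons)
qed (simp add: ad_poly_0 subspace_0[OF assms(1)])

text \<open>A nonzero p of least degree with p(ad y) v in W is not constant, as v is outside W, so
  it has a root c. With p = (X - c) q the vector q(ad y) v is outside W by minimality.\<close>

lemma eigenvector_mod:
  assumes E: "subspace E" "\<And>w. w \<in> E \<Longrightarrow> bracket y w \<in> E" and W: "subspace W"
    and v: "v \<in> E" "v \<notin> W" and p: "p \<noteq> 0" "ad_poly y v p \<in> W"
  obtains w c where "w \<in> E" "w \<notin> W" "bracket y w - smul c w \<in> W"
proof -
  obtain p where p: "p \<noteq> 0 \<and> ad_poly y v p \<in> W"
    and min: "\<And>q. q \<noteq> 0 \<and> ad_poly y v q \<in> W \<Longrightarrow> degree p \<le> degree q"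
    using ex_has_least_nat[of "\<lambda>q. q \<noteq> 0 \<and> ad_poly y v q \<in> W" p degree] p by blast
  have "degree p \<noteq> 0"
  proof
    assume "degree p = 0"
    then obtain c where c: "p = [:c:]" by (rule degree_eq_zeroE)
    then have "smul c v \<in> W" "c \<noteq> 0" using p by (auto simp: ad_poly_pCons ad_poly_0 bracket_zero_right)
    then have "smul (1 / c) (smul c v) \<in> W" using subspace_scale[OF W] by blast
    then show False using \<open>c \<noteq> 0\<close> v(2) by simp
  qed
  then obtain c where "poly p c = 0"
    using fundamental_theorem_of_algebra[of p] by (metis constant_degree)
  then obtain q where q: "p = [:- c, 1:] * q" by (metis dvd_def poly_eq_0_iff_dvd)
  then have q0: "q \<noteq> 0" using p by auto
  then have "degree p = Suc (degree q)" unfolding q by (subst degree_mult_eq) auto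
  then have "ad_poly y v q \<notin> W" using min[of q] q0 by auto
  moreover have "bracket y (ad_poly y v q) - smul c (ad_poly y v q) \<in> W"
    using p unfolding q ad_poly_linear_factor by blast
  ultimately show thesis using that ad_poly_closed[OF E(1) v(1) E(2)] by blast
qed

lemma subspace_diff_cancel: "subspace W \<Longrightarrow> x \<in> W \<Longrightarrow> x - y \<in> W \<Longrightarrow> y \<in> W"
  using subspace_diff[of W x "x - y"] by simp

text \<open>
  This replaces the usual trace argument. With \<open>u\<^sub>i = (ad y)\<^sup>i v\<close> and \<open>F\<^sub>n\<close> the span of \<open>W\<close> and of the \<open>u\<^sub>i\<close>
  for \<open>i < n\<close>, one has \<open>[x, u\<^sub>i] = lam x u\<^sub>i + i lam [x, y] u\<^bsub>i-1\<^esub>\<close> modulo \<open>F\<^bsub>i-1\<^esub>\<close>. For the least \<open>n\<close> with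
  \<open>u\<^sub>n \<in> F\<^sub>n\<close> this yields \<open>n lam [x, y] u\<^bsub>n-1\<^esub> \<in> F\<^bsub>n-1\<^esub>\<close>.
\<close>

lemma weight_bracket_zero:
  assumes W: "lie_ideal W" and L: "\<And>x. x \<in> L \<Longrightarrow> bracket x y \<in> L"
    and lam: "\<And>x. x \<in> L \<Longrightarrow> bracket x v - smul (lam x) v \<in> W"
    and v: "v \<notin> W" and fin: "(bracket y ^^ N) v \<in> span (W \<union> (\<lambda>i. (bracket y ^^ i) v) ` {..<N})"
    and x: "x \<in> L"
  shows "lam (bracket x y) = 0"
proof -
  have Ws: "subspace W" and Wi: "\<And>x w. w \<in> W \<Longrightarrow> bracket x w \<in> W" using W unfolding lie_ideal_def by auto
  define u where "u = (\<lambda>i. (bracket y ^^ i) v)"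
  define F where "F = (\<lambda>n. span (W \<union> u ` {..<n}))"
  have F_eq: "F n = span (W \<union> u ` {..<n})" for n by (simp add: F_def)
  have F: "subspace (F n)" for n by (simp add: F_def)
  have FW: "w \<in> W \<Longrightarrow> w \<in> F n" for w n unfolding F_def by (rule span_base) simp
  have Fu: "i < n \<Longrightarrow> u i \<in> F n" for i n unfolding F_def by (rule span_base) auto
  have Fmono: "f \<in> F m \<Longrightarrow> m \<le> n \<Longrightarrow> f \<in> F n" for f m n
  proof -
    assume f: "f \<in> F m" and "m \<le> n"
    then have "W \<union> u ` {..<m} \<subseteq> W \<union> u ` {..<n}" by (intro Un_mono image_mono) auto
    then show "f \<in> F n" using f span_mono unfolding F_def by blast
  qed
  have uS: "bracket y (u i) = u (Suc i)" for i by (simp add: u_def)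
  have Fy: "bracket y f \<in> F (Suc n)" if "f \<in> F n" for f n
    using that unfolding F_eq[of n]
  proof (induction rule: span_induct)
    case (step f)
    then show ?case using Wi FW uS Fu by auto
  next
    case base
    show ?case by (auto simp: subspace_def bracket_zero_right bracket_add_right bracket_scale_right
        intro: subspace_0[OF F] subspace_add[OF F] subspace_scale[OF F])
  qed
  \<comment> \<open>For i = 0 the truncated index i - 1 does no harm: the coefficient is 0 and
    \<open>F 0\<close> is W.\<close>
  have A: "bracket x (u i) - smul (lam x) (u i) - smul (of_nat i * lam (bracket x y)) (u (i - 1)) \<in> F (i - 1)"
    if "x \<in> L" for x i
    using that
  proof (induction i arbitrary: x)
    case 0
    have "bracket x v - smul (lam x) v \<in> F 0" by (rule FW[OF lam[OF 0]])
    then show ?case by (simp add: u_def)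
  next
    case (Suc i)
    let ?z = "bracket x y"
    have z: "?z \<in> L" by (rule L[OF Suc.prems])
    let ?f = "bracket x (u i) - smul (lam x) (u i) - smul (of_nat i * lam ?z) (u (i - 1))"
    have f: "bracket y ?f \<in> F i"
    proof (cases i)
      case 0
      have "bracket y (bracket x v - smul (lam x) v) \<in> W" by (rule Wi[OF lam[OF Suc.prems]])
      then show ?thesis using FW 0 by (simp add: u_def)
    next
      case (Suc j)
      then show ?thesis using Fy[OF Suc.IH[OF Suc.prems]] by simp
    qed
    \<comment> \<open>The induction hypothesis for [x, y], which lies in L again, in place of x;
      this is why x is generalised.\<close>
    have g: "bracket ?z (u i) - smul (lam ?z) (u i) \<in> F i"
    proof -
      have "smul (of_nat i * lam (bracket ?z y)) (u (i - 1)) \<in> F i"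
        by (cases i) (auto intro: subspace_0[OF F] subspace_scale[OF F] Fu)
      moreover have "bracket ?z (u i) - smul (lam ?z) (u i) - smul (of_nat i * lam (bracket ?z y)) (u (i - 1)) \<in> F i"
        by (rule Fmono[OF Suc.IH[OF z]]) simp
      ultimately have "(bracket ?z (u i) - smul (lam ?z) (u i) - smul (of_nat i * lam (bracket ?z y)) (u (i - 1))) +
          smul (of_nat i * lam (bracket ?z y)) (u (i - 1)) \<in> F i" using subspace_add[OF F] by blast
      then show ?thesis by simp
    qed
    have h: "smul (of_nat i * lam ?z) (bracket y (u (i - 1))) = smul (of_nat i * lam ?z) (u i)"
      by (cases i) (auto simp: uS)
    have "bracket y ?f = bracket y (bracket x (u i)) - smul (lam x) (u (Suc i)) - smul (of_nat i * lam ?z) (u i)"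
      unfolding bracket_diff_right bracket_scale_right h by (simp only: uS)
    moreover have "bracket x (u (Suc i)) = bracket y (bracket x (u i)) + bracket ?z (u i)"
      unfolding uS[symmetric] by (rule jacobi_bracket)
    ultimately have "bracket x (u (Suc i)) - smul (lam x) (u (Suc i)) - smul (of_nat (Suc i) * lam ?z) (u (Suc i - 1)) =
       bracket y ?f + (bracket ?z (u i) - smul (lam ?z) (u i))"
      by (simp add: distrib_right scale_left_distrib algebra_simps)
    then show ?case using subspace_add[OF F f g] by simp
  qed
  define n where "n = (LEAST n. u n \<in> F n)"
  have un: "u n \<in> F n" unfolding n_def by (rule LeastI[of _ N]) (use fin in \<open>simp add: F_def u_def\<close>)
  have "F 0 = W" using Ws by (simp add: F_def)
  then have "u 0 \<notin> F 0" using v by (simp add: u_def)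
  then obtain m where m: "n = Suc m" using un by (cases n) auto
  have um: "u m \<notin> F m" using not_less_Least[of m "\<lambda>n. u n \<in> F n"] m n_def by auto
  \<comment> \<open>On \<open>F n\<close> the operator ad x - lam x drops into \<open>F m\<close>.
    Applied to u n, which lies in \<open>F n\<close>, this forces the term with u m in A to lie in
    \<open>F m\<close>.\<close>
  have B: "bracket x f - smul (lam x) f \<in> F m" if "f \<in> F n" for f
    using that unfolding F_eq[of n]
  proof (induction rule: span_induct)
    case (step f)
    then consider "f \<in> W" | j where "j < n" "f = u j" by blast
    then show ?case
    proof cases
      case 1
      then show ?thesis using FW Wi subspace_diff[OF Ws] subspace_scale[OF Ws] by blast
    next
      case 2
      have "smul (of_nat j * lam (bracket x y)) (u (j - 1)) \<in> F m"
        using 2(1) m by (cases j) (auto intro: subspace_0[OF F] subspace_scale[OF F] Fu)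
      moreover have "bracket x (u j) - smul (lam x) (u j) - smul (of_nat j * lam (bracket x y)) (u (j - 1)) \<in> F m"
        by (rule Fmono[OF A[OF x]]) (use 2 m in simp)
      ultimately have "(bracket x (u j) - smul (lam x) (u j) - smul (of_nat j * lam (bracket x y)) (u (j - 1))) +
         smul (of_nat j * lam (bracket x y)) (u (j - 1)) \<in> F m" using subspace_add[OF F] by blast
      then show ?thesis using 2 by simp
    qed
  next
    case base
    have "bracket x (a + b) - smul (lam x) (a + b) = (bracket x a - smul (lam x) a) + (bracket x b - smul (lam x) b)" for a b
      by (simp add: bracket_add_right scale_right_distrib)
    moreover have "bracket x (smul c a) - smul (lam x) (smul c a) = smul c (bracket x a - smul (lam x) a)" for c a
      by (simp add: bracket_scale_right scale_right_diff_distrib mult.commute)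
    ultimately show ?case
      using subspace_0[OF F] subspace_add[OF F] subspace_scale[OF F]
      by (simp add: subspace_def bracket_zero_right)
  qed
  have "smul (of_nat n * lam (bracket x y)) (u m) \<in> F m"
    by (rule subspace_diff_cancel[OF F B[OF un]]) (use A[OF x, of n] m in simp)
  moreover have "(of_nat n :: complex) \<noteq> 0" using m by (simp del: of_nat_Suc)
  then have "smul (1 / (of_nat n * lam (bracket x y))) (smul (of_nat n * lam (bracket x y)) (u m)) = u m"
    if "lam (bracket x y) \<noteq> 0" using that by simp
  ultimately show ?thesis using um subspace_scale[OF F] by metis
qed

text \<open>Here finite dimension enters: otherwise the iterates of v would form independent
  families of every size.\<close>

lemma krylov_finite:
  assumes fd: "finite B" "span B = UNIV"
  obtains n where "(bracket y ^^ n) v \<in> span (W \<union> (\<lambda>i. (bracket y ^^ i) v) ` {..<n})"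
proof -
  define u where "u = (\<lambda>i. (bracket y ^^ i) v)"
  have "\<exists>n. u n \<in> span (u ` {..<n})"
  proof (rule ccontr)
    assume "\<nexists>n. u n \<in> span (u ` {..<n})"
    then have n: "u n \<notin> span (u ` {..<n})" for n by blast
    have "independent (u ` {..<n}) \<and> card (u ` {..<n}) = n" for n
    proof (induction n)
      case (Suc n)
      have "u n \<notin> u ` {..<n}" using n[of n] span_base[of "u n" "u ` {..<n}"] by argo
      moreover have "u ` {..<Suc n} = insert (u n) (u ` {..<n})" by (simp only: lessThan_Suc image_insert)
      ultimately show ?case using Suc independent_insertI[OF n[of n]] by simp
    qed (simp add: independent_empty)
    from this[of "Suc (card B)"] show False
      using independent_span_bound[OF fd(1), of "u ` {..<Suc (card B)}"] fd(2) by auto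
  qed
  then obtain n where "u n \<in> span (u ` {..<n})" by blast
  then have "u n \<in> span (W \<union> u ` {..<n})" using span_mono[of "u ` {..<n}" "W \<union> u ` {..<n}"] by auto
  then show thesis using that unfolding u_def by blast
qed

text \<open>Serves to turn the dependence of the n-th iterate on the earlier ones into a monic
  polynomial relation modulo W.\<close>

lemma krylov_poly:
  assumes W: "subspace W" and f: "f \<in> span (W \<union> (\<lambda>i. (bracket y ^^ i) v) ` {..<n})"
  shows "\<exists>q. (\<forall>k\<ge>n. coeff q k = 0) \<and> f - ad_poly y v q \<in> W"
  using f
proof (induction rule: span_induct)
  case (step f)
  then consider "f \<in> W" | i where "i < n" "f = (bracket y ^^ i) v" by auto
  then show ?case
  proof cases
    case 1
    then show ?thesis by (intro exI[of _ 0]) (simp add: ad_poly_0)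
  next
    case 2
    then show ?thesis by (intro exI[of _ "monom 1 i"]) (auto simp: ad_poly_monom subspace_0[OF W])
  qed
next
  case base
  show ?case unfolding subspace_def
  proof (intro conjI ballI allI)
    show "0 \<in> {f. \<exists>q. (\<forall>k\<ge>n. coeff q k = 0) \<and> f - ad_poly y v q \<in> W}"
      by (intro CollectI exI[of _ 0]) (simp add: ad_poly_0 subspace_0[OF W])
  next
    fix a b assume "a \<in> {f. \<exists>q. (\<forall>k\<ge>n. coeff q k = 0) \<and> f - ad_poly y v q \<in> W}"
      "b \<in> {f. \<exists>q. (\<forall>k\<ge>n. coeff q k = 0) \<and> f - ad_poly y v q \<in> W}"
    then obtain q r where q: "\<forall>k\<ge>n. coeff q k = 0" "a - ad_poly y v q \<in> W" "\<forall>k\<ge>n. coeff r k = 0" "b - ad_poly y v r \<in> W"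
      by blast
    have "(a + b) - ad_poly y v (q + r) = (a - ad_poly y v q) + (b - ad_poly y v r)"
      by (simp add: ad_poly_add algebra_simps)
    then have "(a + b) - ad_poly y v (q + r) \<in> W" using subspace_add[OF W q(2,4)] by (simp only:)
    then show "a + b \<in> {f. \<exists>q. (\<forall>k\<ge>n. coeff q k = 0) \<and> f - ad_poly y v q \<in> W}"
      using q by (intro CollectI exI[of _ "q + r"]) simp
  next
    fix c a assume "a \<in> {f. \<exists>q. (\<forall>k\<ge>n. coeff q k = 0) \<and> f - ad_poly y v q \<in> W}"
    then obtain q where q: "\<forall>k\<ge>n. coeff q k = 0" "a - ad_poly y v q \<in> W" by blast
    have "smul c a - ad_poly y v (smult c q) \<in> W"
      using subspace_scale[OF W q(2), of c] by (simp add: ad_poly_smult scale_right_diff_distrib)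
    then show "smul c a \<in> {f. \<exists>q. (\<forall>k\<ge>n. coeff q k = 0) \<and> f - ad_poly y v q \<in> W}"
      using q by (intro CollectI exI[of _ "smult c q"]) simp
  qed
qed

text \<open>Lie's theorem modulo the ideal W. In the inductive step the weight space E of L modulo W
  is stable under ad y because the weight vanishes on [x, y], so ad y has an eigenvector modulo W
  inside E.\<close>

lemma common_eigenvector:
  assumes fd: "finite B" "span B = UNIV" and W: "lie_ideal W" "W \<noteq> UNIV"
    and L: "soluble_subspace L"
  shows "\<exists>v. v \<notin> W \<and> (\<forall>x\<in>L. \<exists>c. bracket x v - smul c v \<in> W)"
  using L
proof (induction rule: soluble_subspace.induct)
  case zero
  obtain v where "v \<notin> W" using W by blast
  moreover have "0 \<in> W" using W subspace_0 unfolding lie_ideal_def by blast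
  ultimately show ?case by (intro exI[of _ v]) (auto simp: bracket_zero_left intro: exI[of _ 0])
next
  case (step L y)
  have Ws: "subspace W" and Wi: "\<And>x w. w \<in> W \<Longrightarrow> bracket x w \<in> W" using W unfolding lie_ideal_def by auto
  from step.IH obtain v where v: "v \<notin> W" "\<forall>x\<in>L. \<exists>c. bracket x v - smul c v \<in> W" by blast
  then obtain lam where lam: "\<And>x. x \<in> L \<Longrightarrow> bracket x v - smul (lam x) v \<in> W" by metis
  obtain n where n: "(bracket y ^^ n) v \<in> span (W \<union> (\<lambda>i. (bracket y ^^ i) v) ` {..<n})"
    using krylov_finite[OF fd] by blast
  have lam0: "lam (bracket x y) = 0" if "x \<in> L" for x
    by (rule weight_bracket_zero[OF W(1) step.hyps(2) lam v(1) n that])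
  define E where "E = {w. \<forall>x\<in>L. bracket x w - smul (lam x) w \<in> W}"
  have E: "subspace E"
  proof -
    have "bracket x (a + b) - smul (lam x) (a + b) = (bracket x a - smul (lam x) a) + (bracket x b - smul (lam x) b)" for a b x
      by (simp add: bracket_add_right scale_right_distrib)
    moreover have "bracket x (smul c a) - smul (lam x) (smul c a) = smul c (bracket x a - smul (lam x) a)" for c a x
      by (simp add: bracket_scale_right scale_right_diff_distrib mult.commute)
    ultimately show ?thesis
      using subspace_0[OF Ws] subspace_add[OF Ws] subspace_scale[OF Ws]
      by (simp add: subspace_def E_def bracket_zero_right)
  qed
  have Ey: "bracket y w \<in> E" if w: "w \<in> E" for w
    unfolding E_def
  proof (intro CollectI ballI)
    fix x assume x: "x \<in> L"
    have "bracket y (bracket x w - smul (lam x) w) \<in> W" using w x Wi by (simp add: E_def)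
    moreover have "bracket (bracket x y) w \<in> W"
      using w step.hyps(2)[OF x] lam0[OF x] by (force simp: E_def)
    ultimately have "bracket y (bracket x w - smul (lam x) w) + bracket (bracket x y) w \<in> W"
      using subspace_add[OF Ws] by blast
    then show "bracket x (bracket y w) - smul (lam x) (bracket y w) \<in> W"
      by (subst jacobi_bracket) (simp add: bracket_diff_right bracket_scale_right algebra_simps)
  qed
  obtain q where q: "\<forall>k\<ge>n. coeff q k = 0" "(bracket y ^^ n) v - ad_poly y v q \<in> W"
    using krylov_poly[OF Ws n] by blast
  define p where "p = monom 1 n + smult (- 1) q"
  have "coeff p n = 1" using q(1) by (simp add: p_def)
  then have p0: "p \<noteq> 0" by auto
  have pW: "ad_poly y v p \<in> W"
    using q(2) by (simp only: p_def ad_poly_add ad_poly_smult ad_poly_monom) simp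
  have vE: "v \<in> E" using lam by (simp add: E_def)
  obtain w c where w: "w \<in> E" "w \<notin> W" "bracket y w - smul c w \<in> W"
    using eigenvector_mod[OF E Ey Ws vE v(1) p0 pW] by blast
  show ?case
  proof (intro exI[of _ w] conjI ballI w(2))
    fix x assume "x \<in> span (insert y L)"
    then obtain k where "x - smul k y \<in> span L" by (metis span_breakdown_eq)
    then have xL: "x - smul k y \<in> L" using soluble_subspace_subspace[OF step.hyps(1)] by (metis span_eq_iff)
    define x' where "x' = x - smul k y"
    have x: "x = x' + smul k y" by (simp add: x'_def)
    have "(bracket x' w - smul (lam x') w) + smul k (bracket y w - smul c w) \<in> W"
      using w xL by (intro subspace_add[OF Ws] subspace_scale[OF Ws]) (auto simp: E_def x'_def)
    moreover have "(bracket x' w - smul (lam x') w) + smul k (bracket y w - smul c w) =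
        bracket x w - smul (lam x' + k * c) w"
      by (simp add: x bracket_add_left bracket_scale_left scale_left_distrib scale_right_diff_distrib algebra_simps)
    ultimately show "\<exists>c. bracket x w - smul c w \<in> W" by metis
  qed
qed

section \<open>From solvability to a flag of ideals\<close>

lemma subspace_derived_series: "subspace (derived_series n)"
  by (cases n) auto

lemma derived_series_Suc_subset: "derived_series (Suc n) \<subseteq> derived_series n"
proof (induction n)
  case (Suc n)
  then show ?case by (simp only: derived_series.simps(2)) (intro span_mono, blast)
qed simp

text \<open>A subspace between consecutive members of the derived series absorbs all brackets of the
  larger one, so a basis of the larger one can be added vector by vector. The induction on k starts
  at the bottom of the series.\<close>

lemma soluble_subspace_UNIV:
  assumes fd: "finite B" "span B = UNIV" and s: solvable
  shows "soluble_subspace UNIV"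
proof -
  obtain N where N: "derived_series N = {0}" using s unfolding solvable_def by blast
  have "soluble_subspace (derived_series (N - k))" if "k \<le> N" for k
    using that
  proof (induction k)
    case 0
    then show ?case using N soluble_subspace.zero by simp
  next
    case (Suc k)
    define n where "n = N - Suc k"
    have n: "N - k = Suc n" using Suc.prems by (simp add: n_def)
    let ?D = "derived_series n" and ?D' = "derived_series (Suc n)"
    obtain S where S: "S \<subseteq> ?D" "independent S" "?D \<subseteq> span S"
      using maximal_independent_subset by blast
    have "finite S" using independent_span_bound[OF fd(1) S(2)] fd(2) by simp
    then have "soluble_subspace (span (S \<union> ?D'))" using S(1)
    proof (induction S rule: finite_induct)
      case empty
      have "span ?D' = ?D'" using span_eq_iff subspace_derived_series by blast
      then show ?case using Suc.IH Suc.prems n by (metis Un_empty_left Suc_leD)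
    next
      case (insert y S)
      have "bracket x y \<in> span (S \<union> ?D')" if "x \<in> span (S \<union> ?D')" for x
      proof -
        have "span (S \<union> ?D') \<subseteq> ?D"
          using insert.prems derived_series_Suc_subset[of n] by (intro span_minimal subspace_derived_series) auto
        then have "bracket x y \<in> ?D'" using that insert.prems by (auto intro!: span_base)
        then show ?thesis by (intro span_base) simp
      qed
      then have "soluble_subspace (span (insert y (span (S \<union> ?D'))))"
        using insert by (intro soluble_subspace.step) auto
      moreover have "span (insert y (span (S \<union> ?D'))) = span (insert y S \<union> ?D')"
        using span_Un[of "{y}" "span (S \<union> ?D')"] span_Un[of "{y}" "S \<union> ?D'"] by (simp add: span_span)
      ultimately show ?case by simp
    qed
    moreover have "span (S \<union> ?D') = ?D"
    proof
      show "span (S \<union> ?D') \<subseteq> ?D"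
        using S(1) derived_series_Suc_subset[of n] by (intro span_minimal subspace_derived_series) auto
      show "?D \<subseteq> span (S \<union> ?D')" using S(3) span_mono[of S "S \<union> ?D'"] by auto
    qed
    ultimately show ?case by (simp add: n_def)
  qed
  from this[of N] show ?thesis by simp
qed

text \<open>The span of a partial flag is an ideal, and a common eigenvector modulo it is the next
  member.\<close>

lemma flag_exists:
  assumes fd: "finite B" "span B = UNIV" "independent B" and s: solvable and k: "k \<le> card B"
  shows "\<exists>b. \<forall>i<k. b i \<notin> span (b ` {..<i}) \<and> (\<forall>x. \<exists>c. bracket x (b i) - smul c (b i) \<in> span (b ` {..<i}))"
  using k
proof (induction k)
  case (Suc k)
  then obtain b where b: "\<And>i. i < k \<Longrightarrow> b i \<notin> span (b ` {..<i})"
    "\<And>i x. i < k \<Longrightarrow> \<exists>c. bracket x (b i) - smul c (b i) \<in> span (b ` {..<i})" by auto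
  let ?W = "span (b ` {..<k})"
  have "lie_ideal ?W"
    unfolding lie_ideal_def
  proof (intro conjI allI ballI subspace_span)
    fix x w assume "w \<in> ?W"
    then show "bracket x w \<in> ?W"
    proof (induction rule: span_induct)
      case (step w)
      then obtain i where i: "i < k" "w = b i" by auto
      obtain c where c: "bracket x (b i) - smul c (b i) \<in> span (b ` {..<i})" using b(2)[OF i(1)] by blast
      have "bracket x (b i) - smul c (b i) \<in> ?W"
        using c span_mono[OF image_mono, of "{..<i}" "{..<k}" b] i(1) by auto
      moreover have "smul c (b i) \<in> ?W" using i(1) by (intro span_scale span_base) auto
      ultimately have "bracket x (b i) - smul c (b i) + smul c (b i) \<in> ?W" by (rule span_add)
      then show ?case using i by simp
    next
      case base
      show ?case by (auto simp: subspace_def bracket_zero_right bracket_add_right bracket_scale_right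
            span_zero intro: span_add span_scale)
    qed
  qed
  moreover have "?W \<noteq> UNIV"
  proof
    assume "?W = UNIV"
    then have "card B \<le> card (b ` {..<k})" using independent_span_bound[OF _ fd(3), of "b ` {..<k}"] by auto
    also have "\<dots> \<le> k" using card_image_le[of "{..<k}" b] by simp
    finally show False using Suc.prems by simp
  qed
  ultimately obtain v where v: "v \<notin> ?W" "\<And>x. \<exists>c. bracket x v - smul c v \<in> ?W"
    using common_eigenvector[OF fd(1,2) _ _ soluble_subspace_UNIV[OF fd(1,2) s]] by blast
  have im: "(b(k := v)) ` {..<i} = b ` {..<i}" if "i \<le> k" for i using that by (intro image_cong) auto
  show ?case
  proof (intro exI[of _ "b(k := v)"] allI impI)
    fix i assume i: "i < Suc k"
    then have "i \<le> k" by simp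
    show "(b(k := v)) i \<notin> span ((b(k := v)) ` {..<i}) \<and>
        (\<forall>x. \<exists>c. bracket x ((b(k := v)) i) - smul c ((b(k := v)) i) \<in> span ((b(k := v)) ` {..<i}))"
      unfolding im[OF \<open>i \<le> k\<close>] using b v i by (cases "i = k") auto
  qed
qed simp

end

section \<open>The characteristic polynomial\<close>

text \<open>The index type has no order of its own, so r supplies one. A permutation preserves the
  sum of r over all indices; if it is not the identity it must lower r somewhere, and there it picks
  an entry below the diagonal.\<close>

lemma det_triangular_rank:
  fixes A :: "'b::comm_ring_1 ^ 'n ^ 'n" and r :: "'n::finite \<Rightarrow> nat"
  assumes inj: "inj r" and tri: "\<And>i j. r j < r i \<Longrightarrow> A $ i $ j = 0"
  shows "det A = (\<Prod>i\<in>UNIV. A $ i $ i)"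
proof -
  have "of_int (sign p) * (\<Prod>i\<in>UNIV. A $ i $ p i) = 0" if p: "p permutes UNIV" "p \<noteq> id" for p
  proof -
    have "\<exists>i. r (p i) < r i"
    proof (rule ccontr)
      assume "\<nexists>i. r (p i) < r i"
      then have le: "r i \<le> r (p i)" for i by (simp add: not_less)
      obtain i where "p i \<noteq> i" using p(2) by (auto simp: fun_eq_iff)
      then have "r i < r (p i)" using le[of i] inj by (metis injD le_neq_implies_less)
      then have "(\<Sum>i\<in>UNIV. r i) < (\<Sum>i\<in>UNIV. r (p i))" using le by (intro sum_strict_mono_ex1) auto
      then show False using sum.permute[OF p(1), of r] by (simp add: o_def)
    qed
    then obtain i where "A $ i $ p i = 0" using tri by blast
    then have "(\<Prod>i\<in>UNIV. A $ i $ p i) = 0" by (intro prod_zero) auto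
    then show ?thesis by simp
  qed
  then have "det A = (\<Sum>p\<in>{id}. of_int (sign p) * (\<Prod>i\<in>UNIV. A $ i $ p i))"
    unfolding det_def by (intro sum.mono_neutral_right) (auto simp: permutes_id finite_permutations)
  then show ?thesis by simp
qed

lemma det_eq_0_kernel:
  fixes A :: "complex ^ 'n ^ 'n"
  assumes "A *v v = 0" "v \<noteq> 0" shows "det A = 0"
  using assms invertible_det_nz[of A] invertible_left_inverse[of A] matrix_left_invertible_ker[of A] by blast

lemma det_nonzero_kernel:
  fixes A :: "complex ^ 'n ^ 'n"
  assumes "\<And>v. A *v v = 0 \<Longrightarrow> v = 0" shows "det A \<noteq> 0"
  using assms invertible_det_nz[of A] invertible_left_inverse[of A] matrix_left_invertible_ker[of A] by blast

lemma const_poly_sum: "const_poly (\<Sum>i\<in>I. f i) = (\<Sum>i\<in>I. const_poly (f i))"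
  by (induction I rule: infinite_finite_induct) (auto simp: const_poly_hom)

lemma const_poly_prod: "const_poly (\<Prod>i\<in>I. f i) = (\<Prod>i\<in>I. const_poly (f i))"
  by (induction I rule: infinite_finite_induct) (auto simp: const_poly_hom)

lemma const_poly_sign: "const_poly (of_int (sign p)) = of_int (sign p)"
  by (simp add: sign_def const_poly_hom)

lemma eval_poly_sign: "eval_poly (of_int (sign p)) z = of_int (sign p)"
  by (simp add: sign_def eval_poly_1 eval_poly_uminus)

lemma det_const_poly:
  fixes P :: "complex ^ 'k ^ 'k"
  shows "det (\<chi> i j. (const_poly (P $ i $ j) :: 'n polynomial)) = const_poly (det P)"
  by (simp add: det_def const_poly_sum const_poly_hom const_poly_prod const_poly_sign)

lemma eval_poly_det:
  fixes M :: "('n::finite polynomial) ^ 'k ^ 'k"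
  shows "eval_poly (det M) z = det (\<chi> i j. eval_poly (M $ i $ j) z)"
  by (simp add: det_def eval_poly_sum eval_poly_mult eval_poly_prod eval_poly_sign)

definition pencil :: "('n::finite \<Rightarrow> complex ^ 'n ^ 'n) \<Rightarrow> 'n polynomial ^ 'n ^ 'n" where
  "pencil B = (\<chi> k l. (if k = l then var_poly None else 0) + (\<Sum>i\<in>UNIV. var_poly (Some i) * const_poly (B i $ k $ l)))"

text \<open>P has constant entries and hence intertwines the pencils as well. Its determinant is a
  nonzero constant and cancels in the polynomial ring.\<close>

lemma pencil_similar:
  assumes "\<And>i. A i ** P = P ** T i" and P: "det P \<noteq> 0"
  shows "det (pencil A) = det (pencil T)"
proof -
  let ?P = "(\<chi> k l. const_poly (P $ k $ l)) :: 'a polynomial ^ 'a ^ 'a"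
  have e: "(\<Sum>j\<in>UNIV. A i $ k $ j * P $ j $ l) = (\<Sum>j\<in>UNIV. P $ k $ j * T i $ j $ l)" for i k l
    using assms(1)[of i] by (simp add: matrix_matrix_mult_def vec_eq_iff)
  have "pencil A ** ?P = ?P ** pencil T"
  proof (simp only: vec_eq_iff, intro allI)
    fix k l
    have "(pencil A ** ?P) $ k $ l = (\<Sum>j\<in>UNIV. (if k = j then var_poly None else 0) * const_poly (P $ j $ l)) +
       (\<Sum>j\<in>UNIV. \<Sum>i\<in>UNIV. var_poly (Some i) * const_poly (A i $ k $ j * P $ j $ l))"
      by (simp add: matrix_matrix_mult_def pencil_def distrib_right sum.distrib sum_distrib_right const_poly_hom mult.assoc)
    also have "\<dots> = var_poly None * const_poly (P $ k $ l) +
       (\<Sum>i\<in>UNIV. var_poly (Some i) * const_poly (\<Sum>j\<in>UNIV. A i $ k $ j * P $ j $ l))"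
      by (subst sum.swap) (simp add: const_poly_sum sum_distrib_left if_distrib[of "\<lambda>x. x * _"] cong: if_cong)
    also have "\<dots> = const_poly (P $ k $ l) * var_poly None +
       (\<Sum>i\<in>UNIV. var_poly (Some i) * const_poly (\<Sum>j\<in>UNIV. P $ k $ j * T i $ j $ l))"
      unfolding e by (simp only: mult.commute[of "var_poly None"])
    also have "\<dots> = (\<Sum>j\<in>UNIV. const_poly (P $ k $ j) * (if j = l then var_poly None else 0)) +
       (\<Sum>j\<in>UNIV. \<Sum>i\<in>UNIV. const_poly (P $ k $ j) * (var_poly (Some i) * const_poly (T i $ j $ l)))"
      by (subst sum.swap) (simp add: const_poly_sum const_poly_hom sum_distrib_left mult.left_commute
          if_distrib[of "\<lambda>x. _ * x"] cong: if_cong)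
    also have "\<dots> = (?P ** pencil T) $ k $ l"
      by (simp add: matrix_matrix_mult_def pencil_def distrib_left sum.distrib sum_distrib_left)
    finally show "(pencil A ** ?P) $ k $ l = (?P ** pencil T) $ k $ l" .
  qed
  then have "det (pencil A) * det ?P = det ?P * det (pencil T)" by (metis det_mul)
  then have "const_poly (det P) * det (pencil A) = const_poly (det P) * det (pencil T)"
    unfolding det_const_poly by (simp only: mult.commute)
  moreover have "const_poly (det P) \<noteq> (0 :: 'a polynomial)"
    using P eval_poly_const[of "det P"] eval_poly_0 by metis
  ultimately show ?thesis using polynomial_mult_cancel by blast
qed

lemma lin_form_option:
  fixes mu :: "'n::finite \<Rightarrow> complex"
  shows "lin_form (\<chi> i. case i of None \<Rightarrow> 1 | Some j \<Rightarrow> mu j) z = eval_poly (lin_poly mu) z"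
proof -
  have "lin_form (\<chi> i. case i of None \<Rightarrow> 1 | Some j \<Rightarrow> mu j) z =
      (\<Sum>i\<in>insert None (range Some). (case i of None \<Rightarrow> 1 | Some j \<Rightarrow> mu j) * z $ i)"
    by (simp add: lin_form_def UNIV_option_conv)
  also have "\<dots> = z $ None + (\<Sum>i\<in>range Some. (case i of None \<Rightarrow> 1 | Some j \<Rightarrow> mu j) * z $ i)"
    by (subst sum.insert) auto
  also have "(\<Sum>i\<in>range Some. (case i of None \<Rightarrow> 1 | Some j \<Rightarrow> mu j) * z $ i) = (\<Sum>j\<in>UNIV. z $ Some j * mu j)"
    by (subst sum.reindex) (auto simp: mult.commute)
  finally show ?thesis by (simp add: eval_lin_poly)
qed

context complex_lie_algebra
begin

lemma span_image_sum:
  assumes K: "finite K" and f: "f \<in> span (g ` K)"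
  shows "\<exists>t. f = (\<Sum>k\<in>K. smul (t k) (g k))"
  using f
proof (induction rule: span_induct)
  case base
  have "\<exists>t. a + b = (\<Sum>k\<in>K. smul (t k) (g k))"
    if "a = (\<Sum>k\<in>K. smul (t k) (g k))" "b = (\<Sum>k\<in>K. smul (s k) (g k))" for a b t s
    using that by (intro exI[of _ "\<lambda>k. t k + s k"]) (simp add: scale_left_distrib sum.distrib)
  moreover have "\<exists>t. smul c a = (\<Sum>k\<in>K. smul (t k) (g k))"
    if "a = (\<Sum>k\<in>K. smul (t k) (g k))" for a c t
    using that by (intro exI[of _ "\<lambda>k. c * t k"]) (simp add: scale_sum_right)
  moreover have "\<exists>t. 0 = (\<Sum>k\<in>K. smul (t k) (g k))"
    by (intro exI[of _ "\<lambda>k. 0"]) simp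
  ultimately show ?case unfolding subspace_def by blast
next
  case (step f)
  then obtain j where j: "j \<in> K" "f = g j" by blast
  have "(\<Sum>k\<in>K. smul (if k = j then 1 else 0) (g k)) = (\<Sum>k\<in>K. if k = j then g k else 0)"
    by (rule sum.cong) auto
  then show ?case using j K by (intro exI[of _ "\<lambda>k. if k = j then 1 else 0"]) simp
qed

context
  fixes e :: "'n::finite \<Rightarrow> 'a"
  assumes e: "indexed_basis e"
begin

lemma e_basis: "inj e" "independent (range e)" "v \<in> span (range e)"
  using e unfolding indexed_basis_def by auto

definition "coord v k = representation (range e) v (e k)"

lemma coord_scale: "coord (smul c v) k = c * coord v k"
  unfolding coord_def by (simp add: e_basis representation_scale)

lemma coord_sum: "coord (\<Sum>i\<in>I. f i) k = (\<Sum>i\<in>I. coord (f i) k)"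
  unfolding coord_def by (simp add: representation_sum e_basis)

lemma coord_basis: "(\<Sum>k\<in>UNIV. smul (coord v k) (e k)) = v"
proof -
  have "(\<Sum>b\<in>range e. smul (representation (range e) v b) b) = v"
    by (rule sum_representation_eq[OF e_basis(2,3)]) auto
  then show ?thesis unfolding coord_def by (simp add: sum.reindex[OF e_basis(1)])
qed

lemma ad_matrix_coord: "ad_matrix e x $ k $ l = coord (bracket x (e l)) k"
  by (simp add: ad_matrix_def coord_def)

lemma char_poly_pencil: "char_poly e = det (pencil (\<lambda>i. ad_matrix e (e i)))"
proof -
  have "mat (var_poly None) + (\<Sum>i\<in>UNIV. \<chi> k l. var_poly (Some i) * const_poly (ad_matrix e (e i) $ k $ l)) =
     pencil (\<lambda>i. ad_matrix e (e i))"
    by (simp add: vec_eq_iff pencil_def mat_def)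
  then show ?thesis unfolding char_poly_def by simp
qed

lemma triangularize:
  assumes s: solvable
  obtains r :: "'n \<Rightarrow> nat" and P :: "complex ^ 'n ^ 'n" and T
  where "inj r" "det P \<noteq> 0" "\<And>x. ad_matrix e x ** P = P ** T x" "\<And>x i j. r j < r i \<Longrightarrow> T x $ i $ j = 0"
proof -
  have card: "card (range e) = CARD('n)" using e_basis(1) by (simp add: card_image)
  have sp: "span (range e) = UNIV" using e unfolding indexed_basis_def by blast
  have fin: "finite (range e)" by simp
  obtain b where b: "\<And>i. i < CARD('n) \<Longrightarrow> b i \<notin> span (b ` {..<i})"
    "\<And>i x. i < CARD('n) \<Longrightarrow> \<exists>c. bracket x (b i) - smul c (b i) \<in> span (b ` {..<i})"
    using flag_exists[OF fin sp e_basis(2) s, of "CARD('n)"] unfolding card by auto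
  obtain r :: "'n \<Rightarrow> nat" where r: "bij_betw r UNIV {..<CARD('n)}"
    using finite_same_card_bij[of "UNIV :: 'n set" "{..<CARD('n)}"] by auto
  then have inj: "inj r" and rN: "r l < CARD('n)" for l
    by (auto simp: bij_betw_def)
  define g where "g = (\<lambda>l. b (r l))"
  have im: "b ` {..<r l} = g ` {k. r k < r l}" for l
  proof -
    have "{..<r l} = r ` {k. r k < r l}"
    proof (intro equalityI subsetI)
      fix m assume m: "m \<in> {..<r l}"
      then have "m \<in> range r" using r rN[of l] by (auto simp: bij_betw_def)
      then show "m \<in> r ` {k. r k < r l}" using m by auto
    qed auto
    then show ?thesis by (simp add: g_def image_image)
  qed
  have "\<exists>t. bracket x (g l) = (\<Sum>k\<in>UNIV. smul (t k) (g k)) \<and> (\<forall>k. r l < r k \<longrightarrow> t k = 0)" for x l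
  proof -
    obtain c where "bracket x (g l) - smul c (g l) \<in> span (g ` {k. r k < r l})"
      using b(2)[OF rN[of l]] unfolding g_def[symmetric] im by (metis g_def)
    then obtain t where t: "bracket x (g l) - smul c (g l) = (\<Sum>k\<in>{k. r k < r l}. smul (t k) (g k))"
      using span_image_sum[of "{k. r k < r l}"] by auto
    \<comment> \<open>All coefficients of the bracket at once: c on the diagonal, the flag
      coefficients at smaller rank, and 0 at larger rank, which is the triangular shape.\<close>
    define t' where "t' = (\<lambda>k. if k = l then c else if r k < r l then t k else 0)"
    have "(\<Sum>k\<in>UNIV. smul (t' k) (g k)) = smul (t' l) (g l) + (\<Sum>k\<in>UNIV - {l}. smul (t' k) (g k))"
      by (rule sum.remove) auto
    also have "(\<Sum>k\<in>UNIV - {l}. smul (t' k) (g k)) = (\<Sum>k\<in>{k. r k < r l}. smul (t k) (g k))"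
      by (rule sum.mono_neutral_cong_right) (auto simp: t'_def)
    finally have "bracket x (g l) = (\<Sum>k\<in>UNIV. smul (t' k) (g k))"
      unfolding t[symmetric] by (simp add: t'_def)
    moreover have "t' k = 0" if "r l < r k" for k using that by (auto simp: t'_def)
    ultimately show ?thesis by blast
  qed
  then obtain \<tau> where \<tau>: "\<And>x l. bracket x (g l) = (\<Sum>k\<in>UNIV. smul (\<tau> x l k) (g k))"
    "\<And>x l k. r l < r k \<Longrightarrow> \<tau> x l k = 0" by metis
  define P :: "complex ^ 'n ^ 'n" where "P = (\<chi> k l. coord (g l) k)"
  have "det P \<noteq> 0"
  proof (rule det_nonzero_kernel, rule ccontr)
    fix v assume v: "P *v v = 0" "v \<noteq> 0"
    have "coord (\<Sum>l\<in>UNIV. smul (v $ l) (g l)) k = 0" for k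
      using v(1) by (simp add: coord_sum coord_scale P_def matrix_vector_mult_def vec_eq_iff mult.commute)
    then have z: "(\<Sum>l\<in>UNIV. smul (v $ l) (g l)) = 0"
      using coord_basis[of "\<Sum>l\<in>UNIV. smul (v $ l) (g l)"] by simp
    obtain l0 where "v $ l0 \<noteq> 0" using v(2) by (auto simp: vec_eq_iff)
    \<comment> \<open>In a linear relation the term of highest rank would lie in the span of the
      earlier vectors of the flag.\<close>
    then obtain l where l: "v $ l \<noteq> 0" and max: "\<And>k. v $ k \<noteq> 0 \<Longrightarrow> r k \<le> r l"
      using ex_has_greatest_nat[of "\<lambda>k. v $ k \<noteq> 0" l0 r "CARD('n)"] rN by (metis less_imp_le)
    have "smul (v $ l) (g l) + (\<Sum>k\<in>UNIV - {l}. smul (v $ k) (g k)) = 0"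
      using z by (simp add: sum.remove[of UNIV l])
    then have "smul (v $ l) (g l) = - (\<Sum>k\<in>UNIV - {l}. smul (v $ k) (g k))" by (simp add: eq_neg_iff_add_eq_0)
    moreover have "(\<Sum>k\<in>UNIV - {l}. smul (v $ k) (g k)) \<in> span (b ` {..<r l})"
    proof (rule span_sum)
      fix k assume "k \<in> UNIV - {l}"
      then have "v $ k = 0 \<or> r k < r l" using max[of k] inj by (metis DiffD2 injD le_neq_implies_less singletonI)
      then show "smul (v $ k) (g k) \<in> span (b ` {..<r l})"
      proof
        assume "r k < r l"
        then show ?thesis unfolding im by (intro span_scale span_base imageI CollectI)
      qed (simp add: span_zero)
    qed
    ultimately have "smul (v $ l) (g l) \<in> span (b ` {..<r l})" using span_neg by simp
    then have "smul (1 / v $ l) (smul (v $ l) (g l)) \<in> span (b ` {..<r l})" by (rule span_scale)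
    then show False using b(1)[OF rN[of l]] l by (simp add: g_def)
  qed
  moreover have "ad_matrix e x ** P = P ** (\<chi> k l. \<tau> x l k)" for x
  proof (simp only: vec_eq_iff, intro allI)
    fix k l
    have "(ad_matrix e x ** P) $ k $ l = coord (\<Sum>j\<in>UNIV. smul (coord (g l) j) (bracket x (e j))) k"
      by (simp add: matrix_matrix_mult_def ad_matrix_coord P_def coord_sum coord_scale mult.commute)
    also have "(\<Sum>j\<in>UNIV. smul (coord (g l) j) (bracket x (e j))) = bracket x (g l)"
      by (subst (2) coord_basis[of "g l", symmetric]) (simp only: bracket_sum_right bracket_scale_right)
    also have "coord (bracket x (g l)) k = (P ** (\<chi> k l. \<tau> x l k)) $ k $ l"
      by (simp add: \<tau>(1) coord_sum coord_scale matrix_matrix_mult_def P_def mult.commute)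
    finally show "(ad_matrix e x ** P) $ k $ l = (P ** (\<chi> k l. \<tau> x l k)) $ k $ l" .
  qed
  ultimately show thesis using that[OF inj, of P "\<lambda>x. \<chi> k l. \<tau> x l k"] \<tau>(2) by simp
qed

lemma char_poly_prod:
  assumes s: solvable
  obtains lam :: "'n \<Rightarrow> 'n \<Rightarrow> complex" where "char_poly e = (\<Prod>k\<in>UNIV. lin_poly (lam k))"
proof -
  obtain r :: "'n \<Rightarrow> nat" and P :: "complex ^ 'n ^ 'n" and T where T: "inj r" "det P \<noteq> 0"
    "\<And>x. ad_matrix e x ** P = P ** T x" "\<And>x i j. r j < r i \<Longrightarrow> T x $ i $ j = 0"
    using triangularize[OF s] by metis
  have "char_poly e = det (pencil (\<lambda>i. T (e i)))"
    unfolding char_poly_pencil by (rule pencil_similar[OF T(3,2)])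
  also have "\<dots> = (\<Prod>k\<in>UNIV. pencil (\<lambda>i. T (e i)) $ k $ k)"
    by (rule det_triangular_rank[OF T(1)]) (auto simp: pencil_def T(4) const_poly_hom)
  also have "\<dots> = (\<Prod>k\<in>UNIV. lin_poly (\<lambda>i. T (e i) $ k $ k))"
    by (simp add: pencil_def lin_poly_def)
  finally show thesis by (rule that)
qed

lemma var_None_dvd_char_poly: "var_poly None dvd char_poly e"
  unfolding lin_poly_zero[symmetric] lin_poly_dvd_iff
proof (intro allI impI)
  fix z :: "complex ^ 'n option" assume "eval_poly (lin_poly (\<lambda>_. 0)) z = 0"
  then have z0: "z $ None = 0" by (simp add: eval_lin_poly)
  define x where "x = (\<Sum>i\<in>UNIV. smul (z $ Some i) (e i))"
  define A :: "complex ^ 'n ^ 'n" where "A = (\<chi> k l. \<Sum>i\<in>UNIV. z $ Some i * ad_matrix e (e i) $ k $ l)"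
  have "eval_poly (char_poly e) z = det A"
    unfolding char_poly_pencil eval_poly_det A_def
    by (rule arg_cong[where f = det])
       (simp add: pencil_def vec_eq_iff eval_poly_add eval_poly_sum eval_poly_mult eval_poly_var eval_poly_const z0 eval_poly_0)
  also have "det A = 0"
  proof (cases "\<forall>i. z $ Some i = 0")
    case True
    \<comment> \<open>For x = 0 the coordinates of x are no nonzero kernel vector, but the matrix
      itself is 0.\<close>
    then have "A *v axis undefined 1 = 0" by (simp add: A_def vec_eq_iff matrix_vector_mult_def)
    then show ?thesis by (rule det_eq_0_kernel) (simp add: axis_eq_0_iff)
  next
    case False
    have "A *v (\<chi> l. z $ Some l) = 0"
    proof (simp only: vec_eq_iff, intro allI)
      fix k
      have "(A *v (\<chi> l. z $ Some l)) $ k = (\<Sum>l\<in>UNIV. \<Sum>i\<in>UNIV. z $ Some l * (z $ Some i * coord (bracket (e i) (e l)) k))"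
        by (simp add: A_def matrix_vector_mult_def ad_matrix_coord sum_distrib_right sum_distrib_left mult_ac)
      also have "\<dots> = coord (bracket x x) k"
        unfolding x_def
        by (simp only: bracket_sum_right bracket_sum_left bracket_scale_right bracket_scale_left coord_sum coord_scale scale_sum_right)
      finally show "(A *v (\<chi> l. z $ Some l)) $ k = 0 $ k"
        using coord_scale[of 0 0 k] by (simp add: bracket_self)
    qed
    then show ?thesis by (rule det_eq_0_kernel) (use False in \<open>auto simp: vec_eq_iff\<close>)
  qed
  finally show "eval_poly (char_poly e) z = 0" .
qed

lemma betti_bound:
  assumes s: solvable
  shows "betti j e \<le> enat ((spectral_index e - 1) choose j)"
proof -
  obtain lam :: "'n \<Rightarrow> 'n \<Rightarrow> complex" where q: "char_poly e = (\<Prod>k\<in>UNIV. lin_poly (lam k))"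
    using char_poly_prod[OF s] by blast
  let ?zero = "\<lambda>_::'n. 0::complex"
  have zero: "?zero \<in> range lam"
    using var_None_dvd_prod[of UNIV lam] var_None_dvd_char_poly unfolding q by (metis finite rangeI)
  \<comment> \<open>Each form once, without the zero form: the latter is the factor
    \<open>z_0\<close> and accounts for the 1 subtracted from the spectral index.\<close>
  obtain mus where mus: "set mus = range lam - {?zero}" "distinct mus"
    using finite_distinct_list[of "range lam - {?zero}"] by auto
  define as where "as = map (\<lambda>mu. (\<chi> i. case i of None \<Rightarrow> 1 | Some j \<Rightarrow> mu j) :: complex ^ 'n option) mus"
  have "length as = card (range lam - {?zero})"
    using mus distinct_card[of mus] by (simp add: as_def)
  also have "\<dots> = spectral_index e - 1"
    using zero by (simp add: spectral_index_def q num_irreducible_factors_prod card_Diff_singleton)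
  finally have len: "length as = spectral_index e - 1" .
  have "eigenvariety_complement e = {z. \<forall>mu\<in>set mus. eval_poly (lin_poly mu) z \<noteq> 0}"
    unfolding eigenvariety_complement_def q z0_free_part_prod[OF finite] mus(1)
    by (auto simp: eval_poly_prod)
  also have "\<dots> = arrangement as"
    by (simp add: as_def arrangement_def lin_form_option)
  finally have V: "eigenvariety_complement e = arrangement as" .
  show ?thesis
    unfolding betti_def V len[symmetric] by (rule de_rham_betti_le[OF open_arrangement betti_le_arrangement])
qed

end

end

theorem corollary4p20:
  fixes smul :: "complex \<Rightarrow> 'a::ab_group_add \<Rightarrow> 'a"
    and bracket :: "'a \<Rightarrow> 'a \<Rightarrow> 'a"
    and x :: "'n::finite \<Rightarrow> 'a"
    and j :: nat
  assumes "complex_lie_algebra smul bracket"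
    and "complex_lie_algebra.solvable smul bracket"
    and "complex_lie_algebra.indexed_basis smul x"
  shows "complex_lie_algebra.betti smul bracket j x
           \<le> enat ((complex_lie_algebra.spectral_index smul bracket x - 1) choose j)"
  using complex_lie_algebra.betti_bound[OF assms(1,3,2)] .

end
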